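(* Let $k$ be a field, $G$ a group and $\Phi: G\times G\times G\to k^*$ a (normalized) 3-cocycle. Let $\mathcal{C}$ be the set of conjugacy classes of $G$; for each $C\in\mathcal{C}$ fix an element $g(C)\in C$, let $Z_C$ be the centralizer of $g(C)$ in $G$, and let $\tilde{\Phi}_C$ be the 2-cocycle on $Z_C$ given by $\tilde{\Phi}_C(e,f)=\tilde{\Phi}(e,f,g(C))$. Then there are equivalences of categories $$\mathcal{MB}(kG,\Phi)\;\cong\;\prod_{C\in\mathcal{C}}(kZ_C,\tilde{\Phi}_C)\text{-}\mathrm{rep}\;\cong\;\prod_{C\in\mathcal{C}}k^{\tilde{\Phi}_C}Z_C\text{-}\mathrm{mod},$$ where $\mathcal{MB}(kG,\Phi)$ is the category of $(kG,\Phi)$-Majid bimodules, $(kZ_C,\tilde{\Phi}_C)\text{-}\mathrm{rep}$ is the category of $\tilde{\Phi}_C$-representations of $Z_C$, and $k^{\tilde{\Phi}_C}Z_C\text{-}\mathrm{mod}$ is the category of left modules over the twisted group algebra $k^{\tilde{\Phi}_C}Z_C$.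
   Context: Tensor products are over $k$, and $\epsilon$ denotes the unit of $G$. A (normalized) 3-cocycle is a map $\Phi:G\times G\times G\to k^*$ with $\Phi(e,f,g)\Phi(e,fg,h)\Phi(f,g,h)=\Phi(ef,g,h)\Phi(e,f,gh)$ and $\Phi(\epsilon,e,f)=\Phi(e,\epsilon,f)=\Phi(e,f,\epsilon)=1$ for all $e,f,g,h\in G$. A $(kG,\Phi)$-Majid bimodule is a $kG$-bicomodule $M$, with coactions $\delta_L,\delta_R$, equivalently a $G$-bigraded space $M=\bigoplus_{g,h\in G}{}^gM^h$ with ${}^gM^h=\{m:\delta_L(m)=g\otimes m,\ \delta_R(m)=m\otimes h\}$, together with bicomodule morphisms $kG\otimes M\to M$, $f\otimes m\mapsto f.m$, and $M\otimes kG\to M$, $m\otimes f\mapsto m.f$ (so $f.{}^gM^h\subseteq{}^{fg}M^{fh}$ and ${}^gM^h.f\subseteq{}^{gf}M^{hf}$), such that $\epsilon.m=m=m.\epsilon$ and, for all $e,f,g,h\in G$, $m\in{}^gM^h$, $$e.(f.m)=\tfrac{\Phi(e,f,g)}{\Phi(e,f,h)}(ef).m,\quad (m.e).f=\tfrac{\Phi(h,e,f)}{\Phi(g,e,f)}m.(ef),\quad (e.m).f=\tfrac{\Phi(e,h,f)}{\Phi(e,g,f)}e.(m.f).$$ Morphisms of Majid bimodules are linear maps commuting with both coactions and both actions. For $e,f,g\in G$ put $$\tilde{\Phi}(e,f,g)=\frac{\Phi(e,f,g)\,\Phi(ef,f^{-1},e^{-1})\,\Phi(e,fg,f^{-1})}{\Phi(efg,f^{-1},e^{-1})\,\Phi(e,f,f^{-1})}.$$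 For a map $\alpha:Z\times Z\to k^*$ on a group $Z$, an $\alpha$-representation (projective representation) of $Z$ is a vector space $V$ with a map $\rho:Z\to GL(V)$ such that $\rho(\epsilon)=\mathrm{Id}_V$ and $\rho(g)\rho(h)=\alpha(g,h)\rho(gh)$ for all $g,h\in Z$; morphisms are linear maps intertwining the actions. For a 2-cocycle $\alpha$ on $Z$, the twisted group algebra $k^{\alpha}Z$ has basis $\{\bar z\mid z\in Z\}$ and product $\bar g\,\bar h=\alpha(g,h)\overline{gh}$. *)

theory Defs
  imports "HOL-Algebra.Module" "HOL-Algebra.Group_Action" "HOL-Library.Equipollence"
begin

section \<open>Categories and equivalences of categories\<close>

text \<open>Hom-sets are indexed by pairs of objects and need not be disjoint; hence composition, and the
  arrow part of a functor, take the objects involved as arguments.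
  \<open>cmp \<C> X Y Z g f\<close> is the composite of \<open>f : X \<rightarrow> Y\<close> and \<open>g : Y \<rightarrow> Z\<close>.\<close>

record ('o, 'a) cat =
  obj :: "'o set"
  arr :: "'o \<Rightarrow> 'o \<Rightarrow> 'a set"
  ident :: "'o \<Rightarrow> 'a"
  cmp :: "'o \<Rightarrow> 'o \<Rightarrow> 'o \<Rightarrow> 'a \<Rightarrow> 'a \<Rightarrow> 'a"

locale category =
  fixes \<C> :: "('o, 'a) cat"
  assumes ident_arr: "X \<in> obj \<C> \<Longrightarrow> ident \<C> X \<in> arr \<C> X X"
    and cmp_arr: "\<lbrakk>X \<in> obj \<C>; Y \<in> obj \<C>; Z \<in> obj \<C>; f \<in> arr \<C> X Y; g \<in> arr \<C> Y Z\<rbrakk>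
      \<Longrightarrow> cmp \<C> X Y Z g f \<in> arr \<C> X Z"
    and cmp_ident_right: "\<lbrakk>X \<in> obj \<C>; Y \<in> obj \<C>; f \<in> arr \<C> X Y\<rbrakk>
      \<Longrightarrow> cmp \<C> X X Y f (ident \<C> X) = f"
    and cmp_ident_left: "\<lbrakk>X \<in> obj \<C>; Y \<in> obj \<C>; f \<in> arr \<C> X Y\<rbrakk>
      \<Longrightarrow> cmp \<C> X Y Y (ident \<C> Y) f = f"
    and cmp_assoc: "\<lbrakk>W \<in> obj \<C>; X \<in> obj \<C>; Y \<in> obj \<C>; Z \<in> obj \<C>;
        f \<in> arr \<C> W X; g \<in> arr \<C> X Y; h \<in> arr \<C> Y Z\<rbrakk>
      \<Longrightarrow> cmp \<C> W Y Z h (cmp \<C> W X Y g f) = cmp \<C> W X Z (cmp \<C> X Y Z h g) f"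

definition is_functor ::
  "('o, 'a) cat \<Rightarrow> ('p, 'b) cat \<Rightarrow> ('o \<Rightarrow> 'p) \<Rightarrow> ('o \<Rightarrow> 'o \<Rightarrow> 'a \<Rightarrow> 'b) \<Rightarrow> bool" where
  "is_functor \<C> \<D> F\<^sub>o F\<^sub>a \<longleftrightarrow>
     (\<forall>X\<in>obj \<C>. F\<^sub>o X \<in> obj \<D>) \<and>
     (\<forall>X\<in>obj \<C>. \<forall>Y\<in>obj \<C>. \<forall>f\<in>arr \<C> X Y. F\<^sub>a X Y f \<in> arr \<D> (F\<^sub>o X) (F\<^sub>o Y)) \<and>
     (\<forall>X\<in>obj \<C>. F\<^sub>a X X (ident \<C> X) = ident \<D> (F\<^sub>o X)) \<and>
     (\<forall>X\<in>obj \<C>. \<forall>Y\<in>obj \<C>. \<forall>Z\<in>obj \<C>. \<forall>f\<in>arr \<C> X Y. \<forall>g\<in>arr \<C> Y Z.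
        F\<^sub>a X Z (cmp \<C> X Y Z g f) =
        cmp \<D> (F\<^sub>o X) (F\<^sub>o Y) (F\<^sub>o Z) (F\<^sub>a Y Z g) (F\<^sub>a X Y f))"

definition is_iso :: "('o, 'a) cat \<Rightarrow> 'o \<Rightarrow> 'o \<Rightarrow> 'a \<Rightarrow> bool" where
  "is_iso \<C> X Y f \<longleftrightarrow> f \<in> arr \<C> X Y \<and>
     (\<exists>g\<in>arr \<C> Y X. cmp \<C> X Y X g f = ident \<C> X \<and> cmp \<C> Y X Y f g = ident \<C> Y)"

definition is_natural_iso ::
  "('o, 'a) cat \<Rightarrow> ('p, 'b) cat \<Rightarrow> ('o \<Rightarrow> 'p) \<Rightarrow> ('o \<Rightarrow> 'o \<Rightarrow> 'a \<Rightarrow> 'b) \<Rightarrow>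
   ('o \<Rightarrow> 'p) \<Rightarrow> ('o \<Rightarrow> 'o \<Rightarrow> 'a \<Rightarrow> 'b) \<Rightarrow> ('o \<Rightarrow> 'b) \<Rightarrow> bool" where
  "is_natural_iso \<C> \<D> F\<^sub>o F\<^sub>a G\<^sub>o G\<^sub>a \<eta> \<longleftrightarrow>
     (\<forall>X\<in>obj \<C>. is_iso \<D> (F\<^sub>o X) (G\<^sub>o X) (\<eta> X)) \<and>
     (\<forall>X\<in>obj \<C>. \<forall>Y\<in>obj \<C>. \<forall>f\<in>arr \<C> X Y.
        cmp \<D> (F\<^sub>o X) (F\<^sub>o Y) (G\<^sub>o Y) (\<eta> Y) (F\<^sub>a X Y f) =
        cmp \<D> (F\<^sub>o X) (G\<^sub>o X) (G\<^sub>o Y) (G\<^sub>a X Y f) (\<eta> X))"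

definition equivalent_categories :: "('o, 'a) cat \<Rightarrow> ('p, 'b) cat \<Rightarrow> bool" where
  "equivalent_categories \<C> \<D> \<longleftrightarrow> category \<C> \<and> category \<D> \<and>
     (\<exists>F\<^sub>o F\<^sub>a G\<^sub>o G\<^sub>a \<eta> \<theta>.
        is_functor \<C> \<D> F\<^sub>o F\<^sub>a \<and> is_functor \<D> \<C> G\<^sub>o G\<^sub>a \<and>
        is_natural_iso \<C> \<C> (\<lambda>X. X) (\<lambda>X Y f. f)
          (\<lambda>X. G\<^sub>o (F\<^sub>o X)) (\<lambda>X Y f. G\<^sub>a (F\<^sub>o X) (F\<^sub>o Y) (F\<^sub>a X Y f)) \<eta> \<and>
        is_natural_iso \<D> \<D> (\<lambda>X. F\<^sub>o (G\<^sub>o X)) (\<lambda>X Y f. F\<^sub>a (G\<^sub>o X) (G\<^sub>o Y) (G\<^sub>a X Y f))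
          (\<lambda>X. X) (\<lambda>X Y f. f) \<theta>)"

definition product_category ::
  "'i set \<Rightarrow> ('i \<Rightarrow> ('o, 'a) cat) \<Rightarrow> ('i \<Rightarrow> 'o, 'i \<Rightarrow> 'a) cat" where
  "product_category I \<D> = \<lparr>
     obj = (\<Pi>\<^sub>E i\<in>I. obj (\<D> i)),
     arr = (\<lambda>X Y. \<Pi>\<^sub>E i\<in>I. arr (\<D> i) (X i) (Y i)),
     ident = (\<lambda>X. \<lambda>i\<in>I. ident (\<D> i) (X i)),
     cmp = (\<lambda>X Y Z g f. \<lambda>i\<in>I. cmp (\<D> i) (X i) (Y i) (Z i) (g i) (f i))\<rparr>"


section \<open>Linear maps\<close>

definition linear_maps ::
  "('r, 'm) ring_scheme \<Rightarrow> ('r, 'v, 'n) module_scheme \<Rightarrow> ('r, 'w, 'p) module_scheme \<Rightarrow>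
   ('v \<Rightarrow> 'w) set" where
  "linear_maps R M N = {f \<in> carrier M \<rightarrow> carrier N.
     (\<forall>x\<in>carrier M. \<forall>y\<in>carrier M. f (x \<oplus>\<^bsub>M\<^esub> y) = f x \<oplus>\<^bsub>N\<^esub> f y) \<and>
     (\<forall>a\<in>carrier R. \<forall>x\<in>carrier M. f (a \<odot>\<^bsub>M\<^esub> x) = a \<odot>\<^bsub>N\<^esub> f x)}"

definition GL :: "('r, 'm) ring_scheme \<Rightarrow> ('r, 'v, 'n) module_scheme \<Rightarrow> ('v \<Rightarrow> 'v) set" where
  "GL K V = {f \<in> linear_maps K V V. bij_betw f (carrier V) (carrier V)}"


section \<open>Cocycles\<close>

text \<open>For a field \<open>K\<close>, the multiplicative group of \<open>K\<close> is \<open>Units K\<close>.\<close>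

definition normalized_3_cocycle ::
  "('k, 'r) ring_scheme \<Rightarrow> ('g, 's) monoid_scheme \<Rightarrow> ('g \<Rightarrow> 'g \<Rightarrow> 'g \<Rightarrow> 'k) \<Rightarrow> bool" where
  "normalized_3_cocycle K G \<Phi> \<longleftrightarrow>
     (\<forall>e\<in>carrier G. \<forall>f\<in>carrier G. \<forall>g\<in>carrier G. \<Phi> e f g \<in> Units K) \<and>
     (\<forall>e\<in>carrier G. \<forall>f\<in>carrier G. \<forall>g\<in>carrier G. \<forall>h\<in>carrier G.
        \<Phi> e f g \<otimes>\<^bsub>K\<^esub> \<Phi> e (f \<otimes>\<^bsub>G\<^esub> g) h \<otimes>\<^bsub>K\<^esub> \<Phi> f g h =
        \<Phi> (e \<otimes>\<^bsub>G\<^esub> f) g h \<otimes>\<^bsub>K\<^esub> \<Phi> e f (g \<otimes>\<^bsub>G\<^esub> h)) \<and>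
     (\<forall>e\<in>carrier G. \<forall>f\<in>carrier G.
        \<Phi> \<one>\<^bsub>G\<^esub> e f = \<one>\<^bsub>K\<^esub> \<and> \<Phi> e \<one>\<^bsub>G\<^esub> f = \<one>\<^bsub>K\<^esub> \<and> \<Phi> e f \<one>\<^bsub>G\<^esub> = \<one>\<^bsub>K\<^esub>)"

definition Phi_tilde ::
  "('k, 'r) ring_scheme \<Rightarrow> ('g, 's) monoid_scheme \<Rightarrow> ('g \<Rightarrow> 'g \<Rightarrow> 'g \<Rightarrow> 'k) \<Rightarrow>
   'g \<Rightarrow> 'g \<Rightarrow> 'g \<Rightarrow> 'k" where
  "Phi_tilde K G \<Phi> e f g =
     (\<Phi> e f g \<otimes>\<^bsub>K\<^esub> \<Phi> (e \<otimes>\<^bsub>G\<^esub> f) (inv\<^bsub>G\<^esub> f) (inv\<^bsub>G\<^esub> e) \<otimes>\<^bsub>K\<^esub> \<Phi> e (f \<otimes>\<^bsub>G\<^esub> g) (inv\<^bsub>G\<^esub> f)) \<otimes>\<^bsub>K\<^esub>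
     inv\<^bsub>K\<^esub> (\<Phi> (e \<otimes>\<^bsub>G\<^esub> f \<otimes>\<^bsub>G\<^esub> g) (inv\<^bsub>G\<^esub> f) (inv\<^bsub>G\<^esub> e) \<otimes>\<^bsub>K\<^esub> \<Phi> e f (inv\<^bsub>G\<^esub> f))"

definition conjugacy_classes :: "('g, 's) monoid_scheme \<Rightarrow> 'g set set" where
  "conjugacy_classes G =
     orbits G (carrier G) (\<lambda>x. \<lambda>g\<in>carrier G. x \<otimes>\<^bsub>G\<^esub> g \<otimes>\<^bsub>G\<^esub> inv\<^bsub>G\<^esub> x)"

definition centralizer :: "('g, 's) monoid_scheme \<Rightarrow> 'g \<Rightarrow> ('g, 's) monoid_scheme" where
  "centralizer G g = G\<lparr>carrier := {z \<in> carrier G. z \<otimes>\<^bsub>G\<^esub> g = g \<otimes>\<^bsub>G\<^esub> z}\<rparr>"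


section \<open>Majid bimodules\<close>

text \<open>Since the group algebra \<open>kG\<close> has basis \<open>G\<close>, the tensor products \<open>kG \<otimes> M\<close> and \<open>M \<otimes> kG\<close> are
  both modelled by finitely supported families \<open>t : G \<rightarrow> M\<close>, the family \<open>t\<close> standing for the sum
  of all \<open>x \<otimes> t x\<close> (respectively \<open>t x \<otimes> x\<close>). A linear action \<open>kG \<otimes> M \<rightarrow> M\<close> is then the same as a
  family of linear maps indexed by \<open>G\<close>. Inherited \<open>mult\<close> and \<open>one\<close> fields of the module records
  play no role.\<close>

record ('k, 'v, 'g) majid_bimodule = "('k, 'v) module" +
  lcoact :: "'v \<Rightarrow> 'g \<Rightarrow> 'v"
  rcoact :: "'v \<Rightarrow> 'g \<Rightarrow> 'v"
  lact :: "'g \<Rightarrow> 'v \<Rightarrow> 'v"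
  ract :: "'v \<Rightarrow> 'g \<Rightarrow> 'v"

definition tensor_kG ::
  "('g, 's) monoid_scheme \<Rightarrow> ('k, 'v, 'n) module_scheme \<Rightarrow> ('g \<Rightarrow> 'v) set" where
  "tensor_kG G M = {t. (\<forall>x\<in>carrier G. t x \<in> carrier M) \<and>
     (\<forall>x. x \<notin> carrier G \<longrightarrow> t x = \<zero>\<^bsub>M\<^esub>) \<and> finite {x. t x \<noteq> \<zero>\<^bsub>M\<^esub>}}"

definition pure_tensor :: "('k, 'v, 'n) module_scheme \<Rightarrow> 'g \<Rightarrow> 'v \<Rightarrow> 'g \<Rightarrow> 'v" where
  "pure_tensor M g m = (\<lambda>x. if x = g then m else \<zero>\<^bsub>M\<^esub>)"

text \<open>The last two conjuncts are the counit law and coassociativity (read off at the basis elements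
  \<open>x \<otimes> y\<close> of \<open>kG \<otimes> kG\<close>), for the coalgebra structure in which every element of \<open>G\<close> is grouplike.\<close>

definition kG_coaction ::
  "('k, 'r) ring_scheme \<Rightarrow> ('g, 's) monoid_scheme \<Rightarrow> ('k, 'v, 'n) module_scheme \<Rightarrow>
   ('v \<Rightarrow> 'g \<Rightarrow> 'v) \<Rightarrow> bool" where
  "kG_coaction K G M \<delta> \<longleftrightarrow>
     (\<forall>m\<in>carrier M. \<delta> m \<in> tensor_kG G M) \<and>
     (\<forall>x\<in>carrier G. (\<lambda>m. \<delta> m x) \<in> linear_maps K M M) \<and>
     (\<forall>m\<in>carrier M. finsum M (\<delta> m) {x \<in> carrier G. \<delta> m x \<noteq> \<zero>\<^bsub>M\<^esub>} = m) \<and>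
     (\<forall>m\<in>carrier M. \<forall>x\<in>carrier G. \<delta> (\<delta> m x) = pure_tensor M x (\<delta> m x))"

definition bigraded_part ::
  "('k, 'v, 'g, 'n) majid_bimodule_scheme \<Rightarrow> 'g \<Rightarrow> 'g \<Rightarrow> 'v set" where
  "bigraded_part M g h =
     {m \<in> carrier M. lcoact M m = pure_tensor M g m \<and> rcoact M m = pure_tensor M h m}"

text \<open>The assumptions \<open>lact_lcoact\<close> to \<open>ract_rcoact\<close> say that the actions are bicomodule morphisms;
  here \<open>kG \<otimes> M\<close> and \<open>M \<otimes> kG\<close> carry the codiagonal coactions.\<close>

locale Majid_bimodule = module K M
  for K :: "('k, 'r) ring_scheme" and M :: "('k, 'v, 'g) majid_bimodule" +
  fixes G :: "('g, 's) monoid_scheme" and \<Phi> :: "'g \<Rightarrow> 'g \<Rightarrow> 'g \<Rightarrow> 'k"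
  assumes lcoaction: "kG_coaction K G M (lcoact M)"
    and rcoaction: "kG_coaction K G M (rcoact M)"
    and bicomodule: "\<lbrakk>m \<in> carrier M; x \<in> carrier G; y \<in> carrier G\<rbrakk>
      \<Longrightarrow> rcoact M (lcoact M m x) y = lcoact M (rcoact M m y) x"
    and lact_linear: "f \<in> carrier G \<Longrightarrow> lact M f \<in> linear_maps K M M"
    and ract_linear: "f \<in> carrier G \<Longrightarrow> (\<lambda>m. ract M m f) \<in> linear_maps K M M"
    and lact_lcoact: "\<lbrakk>m \<in> carrier M; f \<in> carrier G; x \<in> carrier G\<rbrakk>
      \<Longrightarrow> lcoact M (lact M f m) (f \<otimes>\<^bsub>G\<^esub> x) = lact M f (lcoact M m x)"
    and lact_rcoact: "\<lbrakk>m \<in> carrier M; f \<in> carrier G; x \<in> carrier G\<rbrakk>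
      \<Longrightarrow> rcoact M (lact M f m) (f \<otimes>\<^bsub>G\<^esub> x) = lact M f (rcoact M m x)"
    and ract_lcoact: "\<lbrakk>m \<in> carrier M; f \<in> carrier G; x \<in> carrier G\<rbrakk>
      \<Longrightarrow> lcoact M (ract M m f) (x \<otimes>\<^bsub>G\<^esub> f) = ract M (lcoact M m x) f"
    and ract_rcoact: "\<lbrakk>m \<in> carrier M; f \<in> carrier G; x \<in> carrier G\<rbrakk>
      \<Longrightarrow> rcoact M (ract M m f) (x \<otimes>\<^bsub>G\<^esub> f) = ract M (rcoact M m x) f"
    and lact_one: "m \<in> carrier M \<Longrightarrow> lact M \<one>\<^bsub>G\<^esub> m = m"
    and ract_one: "m \<in> carrier M \<Longrightarrow> ract M m \<one>\<^bsub>G\<^esub> = m"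
    and lact_lact: "\<lbrakk>e \<in> carrier G; f \<in> carrier G; g \<in> carrier G; h \<in> carrier G;
        m \<in> bigraded_part M g h\<rbrakk>
      \<Longrightarrow> lact M e (lact M f m) =
          (\<Phi> e f g \<otimes>\<^bsub>K\<^esub> inv\<^bsub>K\<^esub> \<Phi> e f h) \<odot>\<^bsub>M\<^esub> lact M (e \<otimes>\<^bsub>G\<^esub> f) m"
    and ract_ract: "\<lbrakk>e \<in> carrier G; f \<in> carrier G; g \<in> carrier G; h \<in> carrier G;
        m \<in> bigraded_part M g h\<rbrakk>
      \<Longrightarrow> ract M (ract M m e) f =
          (\<Phi> h e f \<otimes>\<^bsub>K\<^esub> inv\<^bsub>K\<^esub> \<Phi> g e f) \<odot>\<^bsub>M\<^esub> ract M m (e \<otimes>\<^bsub>G\<^esub> f)"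
    and lact_ract: "\<lbrakk>e \<in> carrier G; f \<in> carrier G; g \<in> carrier G; h \<in> carrier G;
        m \<in> bigraded_part M g h\<rbrakk>
      \<Longrightarrow> ract M (lact M e m) f =
          (\<Phi> e h f \<otimes>\<^bsub>K\<^esub> inv\<^bsub>K\<^esub> \<Phi> e g f) \<odot>\<^bsub>M\<^esub> lact M e (ract M m f)"

text \<open>Morphisms, here and below, are extensional functions on the carrier, so that equality of
  morphisms is equality in HOL.\<close>

definition Majid_homs ::
  "('k, 'r) ring_scheme \<Rightarrow> ('g, 's) monoid_scheme \<Rightarrow> ('k, 'v, 'g) majid_bimodule \<Rightarrow>
   ('k, 'v, 'g) majid_bimodule \<Rightarrow> ('v \<Rightarrow> 'v) set" where
  "Majid_homs K G M N = {\<phi> \<in> linear_maps K M N \<inter> extensional (carrier M).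
     \<forall>m\<in>carrier M. \<forall>x\<in>carrier G.
       lcoact N (\<phi> m) x = \<phi> (lcoact M m x) \<and> rcoact N (\<phi> m) x = \<phi> (rcoact M m x) \<and>
       \<phi> (lact M x m) = lact N x (\<phi> m) \<and> \<phi> (ract M m x) = ract N (\<phi> m) x}"

text \<open>In this and the two categories below, the objects are the structures whose carrier is a subset
  of a fixed type \<open>'v\<close>, which thus serves as the universe of sets.\<close>

definition Majid_category ::
  "('k, 'r) ring_scheme \<Rightarrow> ('g, 's) monoid_scheme \<Rightarrow> ('g \<Rightarrow> 'g \<Rightarrow> 'g \<Rightarrow> 'k) \<Rightarrow>
   (('k, 'v, 'g) majid_bimodule, 'v \<Rightarrow> 'v) cat" where
  "Majid_category K G \<Phi> = \<lparr>
     obj = {M. Majid_bimodule K M G \<Phi>},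
     arr = Majid_homs K G,
     ident = (\<lambda>M. restrict id (carrier M)),
     cmp = (\<lambda>L M N g f. compose (carrier L) g f)\<rparr>"


section \<open>Projective representations\<close>

record ('k, 'v, 'g) proj_rep = "('k, 'v) module" +
  rho :: "'g \<Rightarrow> 'v \<Rightarrow> 'v"

locale projective_representation = module K V
  for K :: "('k, 'r) ring_scheme" and V :: "('k, 'v, 'g) proj_rep" +
  fixes Z :: "('g, 's) monoid_scheme" and \<alpha> :: "'g \<Rightarrow> 'g \<Rightarrow> 'k"
  assumes rho_GL: "g \<in> carrier Z \<Longrightarrow> rho V g \<in> GL K V"
    and rho_one: "v \<in> carrier V \<Longrightarrow> rho V \<one>\<^bsub>Z\<^esub> v = v"
    and rho_mult: "\<lbrakk>g \<in> carrier Z; h \<in> carrier Z; v \<in> carrier V\<rbrakk>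
      \<Longrightarrow> rho V g (rho V h v) = \<alpha> g h \<odot>\<^bsub>V\<^esub> rho V (g \<otimes>\<^bsub>Z\<^esub> h) v"

definition proj_rep_homs ::
  "('k, 'r) ring_scheme \<Rightarrow> ('g, 's) monoid_scheme \<Rightarrow> ('k, 'v, 'g) proj_rep \<Rightarrow>
   ('k, 'v, 'g) proj_rep \<Rightarrow> ('v \<Rightarrow> 'v) set" where
  "proj_rep_homs K Z V W = {\<phi> \<in> linear_maps K V W \<inter> extensional (carrier V).
     \<forall>z\<in>carrier Z. \<forall>v\<in>carrier V. \<phi> (rho V z v) = rho W z (\<phi> v)}"

definition proj_rep_category ::
  "('k, 'r) ring_scheme \<Rightarrow> ('g, 's) monoid_scheme \<Rightarrow> ('g \<Rightarrow> 'g \<Rightarrow> 'k) \<Rightarrow>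
   (('k, 'v, 'g) proj_rep, 'v \<Rightarrow> 'v) cat" where
  "proj_rep_category K Z \<alpha> = \<lparr>
     obj = {V. projective_representation K V Z \<alpha>},
     arr = proj_rep_homs K Z,
     ident = (\<lambda>V. restrict id (carrier V)),
     cmp = (\<lambda>U V W g f. compose (carrier U) g f)\<rparr>"


section \<open>Twisted group algebras and their modules\<close>

text \<open>An element is the finitely supported family of its coefficients with respect to the basis
  indexed by \<open>Z\<close>. The unit is the basis vector at \<open>\<one>\<^bsub>Z\<^esub>\<close>, which is correct for a 2-cocycle \<open>\<alpha>\<close> with
  \<open>\<alpha> \<one>\<^bsub>Z\<^esub> z = \<alpha> z \<one>\<^bsub>Z\<^esub> = \<one>\<^bsub>K\<^esub>\<close>.\<close>

definition twisted_group_algebra ::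
  "('k, 'r) ring_scheme \<Rightarrow> ('g, 's) monoid_scheme \<Rightarrow> ('g \<Rightarrow> 'g \<Rightarrow> 'k) \<Rightarrow> ('g \<Rightarrow> 'k) ring" where
  "twisted_group_algebra K Z \<alpha> = \<lparr>
     carrier = {a. (\<forall>z\<in>carrier Z. a z \<in> carrier K) \<and> (\<forall>z. z \<notin> carrier Z \<longrightarrow> a z = \<zero>\<^bsub>K\<^esub>) \<and>
                   finite {z. a z \<noteq> \<zero>\<^bsub>K\<^esub>}},
     mult = (\<lambda>a b z. finsum K (\<lambda>(x, y). a x \<otimes>\<^bsub>K\<^esub> b y \<otimes>\<^bsub>K\<^esub> \<alpha> x y)
              {(x, y). x \<in> carrier Z \<and> y \<in> carrier Z \<and> a x \<noteq> \<zero>\<^bsub>K\<^esub> \<and> b y \<noteq> \<zero>\<^bsub>K\<^esub> \<and>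
                       x \<otimes>\<^bsub>Z\<^esub> y = z}),
     one = (\<lambda>z. if z = \<one>\<^bsub>Z\<^esub> then \<one>\<^bsub>K\<^esub> else \<zero>\<^bsub>K\<^esub>),
     zero = (\<lambda>z. \<zero>\<^bsub>K\<^esub>),
     add = (\<lambda>a b z. a z \<oplus>\<^bsub>K\<^esub> b z)\<rparr>"

text \<open>The library locale \<^locale>\<open>module\<close> requires a commutative ring; these are its axioms over an
  arbitrary unital ring.\<close>

locale left_module = R: ring R + M: abelian_group M
  for R :: "('r, 's) ring_scheme" and M :: "('r, 'v, 'n) module_scheme" +
  assumes smult_closed: "\<lbrakk>a \<in> carrier R; x \<in> carrier M\<rbrakk> \<Longrightarrow> a \<odot>\<^bsub>M\<^esub> x \<in> carrier M"
    and smult_l_distr: "\<lbrakk>a \<in> carrier R; b \<in> carrier R; x \<in> carrier M\<rbrakk>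
      \<Longrightarrow> (a \<oplus>\<^bsub>R\<^esub> b) \<odot>\<^bsub>M\<^esub> x = a \<odot>\<^bsub>M\<^esub> x \<oplus>\<^bsub>M\<^esub> b \<odot>\<^bsub>M\<^esub> x"
    and smult_r_distr: "\<lbrakk>a \<in> carrier R; x \<in> carrier M; y \<in> carrier M\<rbrakk>
      \<Longrightarrow> a \<odot>\<^bsub>M\<^esub> (x \<oplus>\<^bsub>M\<^esub> y) = a \<odot>\<^bsub>M\<^esub> x \<oplus>\<^bsub>M\<^esub> a \<odot>\<^bsub>M\<^esub> y"
    and smult_assoc: "\<lbrakk>a \<in> carrier R; b \<in> carrier R; x \<in> carrier M\<rbrakk>
      \<Longrightarrow> (a \<otimes>\<^bsub>R\<^esub> b) \<odot>\<^bsub>M\<^esub> x = a \<odot>\<^bsub>M\<^esub> (b \<odot>\<^bsub>M\<^esub> x)"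
    and smult_one: "x \<in> carrier M \<Longrightarrow> \<one>\<^bsub>R\<^esub> \<odot>\<^bsub>M\<^esub> x = x"

definition left_module_category ::
  "('r, 's) ring_scheme \<Rightarrow> (('r, 'v) module, 'v \<Rightarrow> 'v) cat" where
  "left_module_category R = \<lparr>
     obj = {M. left_module R M},
     arr = (\<lambda>M N. linear_maps R M N \<inter> extensional (carrier M)),
     ident = (\<lambda>M. restrict id (carrier M)),
     cmp = (\<lambda>L M N g f. compose (carrier L) g f)\<rparr>"

end

theory Submission
  imports Defs "HOL-Algebra.Free_Abelian_Groups"
begin

text \<open>Write \<open>M g h\<close> for the part of bidegree \<open>(g, h)\<close> of a Majid bimodule \<open>M\<close>. Acting from either
side by a group element is bijective on homogeneous parts, because acting by the inverse undoes it up
to a nonzero scalar. Hence \<open>M\<close> is determined by the parts \<open>M g \<one>\<close>, between which only the adjoint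
action \<open>m \<mapsto> (e.m).e\<inverse>\<close> remains; it carries \<open>M g \<one>\<close> to \<open>M (e g e\<inverse>) \<one>\<close>. Moving the brackets in
\<open>(e.((f.m).f\<inverse>)).e\<inverse>\<close> with the three axioms produces exactly the factor \<open>Phi_tilde e f g\<close>
(lemma \<open>ad_mult\<close>). So \<open>M (g(C)) \<one>\<close> is a projective representation of the centralizer of \<open>g(C)\<close>, and
these fibres, one for each conjugacy class, are the value of the functor at \<open>M\<close>.

Choose for every \<open>x\<close> in a class \<open>C\<close> an element \<open>t\<close> with \<open>t g(C) t\<inverse> = x\<close>. Every homogeneous element of
degree \<open>(g, h)\<close> with \<open>g h\<inverse> = x\<close> is \<open>(t.v).(t\<inverse> h)\<close> for a unique \<open>v\<close> in the fibre of \<open>C\<close>. Acting on it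
by \<open>e\<close> gives an element of the same shape, with \<open>v\<close> replaced by the adjoint action of some \<open>z\<close> in the
centralizer, times a scalar that depends on \<open>\<Phi>\<close> and the group elements only (lemma \<open>l_sandwich_ad\<close>).
Since the same scalar occurs in every bimodule, a family of intertwiners of the fibres extends
uniquely to a morphism of bimodules: the functor is fully faithful.

For essential surjectivity, put a copy of the representation of the class of \<open>g h\<inverse>\<close> in each bidegree
\<open>(g, h)\<close> and define the actions by the formulas just found. The axioms then become identities between
the scalars, and these are read off from the free bimodule on one generator of bidegree \<open>(g, \<one>)\<close>:
there, both sides are the factor by which one and the same multiple of a basis vector is scaled, and
the bimodule axioms are two or three instances of the cocycle condition (lemma
\<open>homogeneous_action_free\<close>). The direct sum consists of finitely supported families indexed by pairs of
group elements, and the cardinality hypotheses make room for it in the given type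
(lemma \<open>ex_inj_fin_families\<close>).

The second equivalence is taken factor by factor. A representation becomes a module by letting a
linear combination of group elements act linearly, and a module over the twisted group algebra becomes
a representation by restricting its action to multiples of the unit and to the basis vectors. The
2-cocycle condition for \<open>Phi_tilde\<close> comes from associativity of composition of three adjoint actions
in the free bimodule, and associativity of the twisted group algebra is the module law for its regular
representation (lemma \<open>ring_TA\<close>).\<close>

section \<open>Fully faithful and essentially surjective functors\<close>

definition ff_ess_surj ::
  "('o, 'a) cat \<Rightarrow> ('p, 'b) cat \<Rightarrow> ('o \<Rightarrow> 'p) \<Rightarrow> ('o \<Rightarrow> 'o \<Rightarrow> 'a \<Rightarrow> 'b) \<Rightarrow> bool" where
  "ff_ess_surj \<C> \<D> F\<^sub>o F\<^sub>a \<longleftrightarrow> is_functor \<C> \<D> F\<^sub>o F\<^sub>a \<and>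
     (\<forall>X\<in>obj \<C>. \<forall>Y\<in>obj \<C>. bij_betw (F\<^sub>a X Y) (arr \<C> X Y) (arr \<D> (F\<^sub>o X) (F\<^sub>o Y))) \<and>
     (\<forall>Y\<in>obj \<D>. \<exists>X\<in>obj \<C>. \<exists>f. is_iso \<D> (F\<^sub>o X) Y f)"

context
  fixes \<C> :: "('o, 'a) cat" and \<D> :: "('p, 'b) cat"
    and F :: "'o \<Rightarrow> 'p" and Fa :: "'o \<Rightarrow> 'o \<Rightarrow> 'a \<Rightarrow> 'b"
  assumes catC: "category \<C>" and catD: "category \<D>" and ff: "ff_ess_surj \<C> \<D> F Fa"
begin

interpretation C: category \<C> by (rule catC)
interpretation D: category \<D> by (rule catD)

lemma ff_obj: "X \<in> obj \<C> \<Longrightarrow> F X \<in> obj \<D>"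
  and ff_arr: "\<lbrakk>X \<in> obj \<C>; Y \<in> obj \<C>; f \<in> arr \<C> X Y\<rbrakk> \<Longrightarrow> Fa X Y f \<in> arr \<D> (F X) (F Y)"
  and ff_ident: "X \<in> obj \<C> \<Longrightarrow> Fa X X (ident \<C> X) = ident \<D> (F X)"
  and ff_cmp: "\<lbrakk>X \<in> obj \<C>; Y \<in> obj \<C>; Z \<in> obj \<C>; f \<in> arr \<C> X Y; g \<in> arr \<C> Y Z\<rbrakk>
    \<Longrightarrow> Fa X Z (cmp \<C> X Y Z g f) = cmp \<D> (F X) (F Y) (F Z) (Fa Y Z g) (Fa X Y f)"
  and ff_bij: "\<lbrakk>X \<in> obj \<C>; Y \<in> obj \<C>\<rbrakk> \<Longrightarrow> bij_betw (Fa X Y) (arr \<C> X Y) (arr \<D> (F X) (F Y))"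
  using ff unfolding ff_ess_surj_def is_functor_def by simp_all

lemma ff_eqI: "\<lbrakk>X \<in> obj \<C>; Y \<in> obj \<C>; f \<in> arr \<C> X Y; g \<in> arr \<C> X Y; Fa X Y f = Fa X Y g\<rbrakk> \<Longrightarrow> f = g"
  using ff_bij[of X Y] by (metis bij_betw_imp_inj_on inj_onD)

lemma ff_full:
  assumes "X \<in> obj \<C>" "Y \<in> obj \<C>" "u \<in> arr \<D> (F X) (F Y)"
  obtains f where "f \<in> arr \<C> X Y" "Fa X Y f = u"
  using ff_bij[OF assms(1,2)] assms(3) that by (metis bij_betw_imp_surj_on imageE)

lemma ff_reflects_iso:
  assumes XY: "X \<in> obj \<C>" "Y \<in> obj \<C>" and f: "f \<in> arr \<C> X Y" and iso: "is_iso \<D> (F X) (F Y) (Fa X Y f)"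
  shows "is_iso \<C> X Y f"
proof -
  obtain v where v: "v \<in> arr \<D> (F Y) (F X)"
    "cmp \<D> (F X) (F Y) (F X) v (Fa X Y f) = ident \<D> (F X)"
    "cmp \<D> (F Y) (F X) (F Y) (Fa X Y f) v = ident \<D> (F Y)"
    using iso unfolding is_iso_def by (elim conjE bexE)
  obtain g where g: "g \<in> arr \<C> Y X" "Fa Y X g = v"
    by (rule ff_full[OF XY(2,1) v(1)])
  have "Fa X X (cmp \<C> X Y X g f) = Fa X X (ident \<C> X)"
    using ff_cmp[OF XY(1) XY(2) XY(1) f g(1)] ff_ident[OF XY(1)] v(2) g(2) by metis
  then have "cmp \<C> X Y X g f = ident \<C> X"
    by (rule ff_eqI[OF XY(1) XY(1) C.cmp_arr[OF XY(1) XY(2) XY(1) f g(1)] C.ident_arr[OF XY(1)]])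
  moreover have "Fa Y Y (cmp \<C> Y X Y f g) = Fa Y Y (ident \<C> Y)"
    using ff_cmp[OF XY(2) XY(1) XY(2) g(1) f] ff_ident[OF XY(2)] v(3) g(2) by metis
  then have "cmp \<C> Y X Y f g = ident \<C> Y"
    by (rule ff_eqI[OF XY(2) XY(2) C.cmp_arr[OF XY(2) XY(1) XY(2) g(1) f] C.ident_arr[OF XY(2)]])
  ultimately show ?thesis using f g(1) unfolding is_iso_def
    by (intro conjI bexI[of _ g])
qed

text \<open>The object part of the inverse functor and the isomorphisms \<open>\<theta>\<close> are chosen by essential
surjectivity; full faithfulness then forces the arrow part and makes all laws hold, since each of them
can be tested after applying \<open>F\<close> or after composing with \<open>\<theta>\<close>.\<close>

lemma ff_ess_surj_imp_equivalent: "equivalent_categories \<C> \<D>"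
proof -
  have "\<forall>Y\<in>obj \<D>. \<exists>X f g. X \<in> obj \<C> \<and> f \<in> arr \<D> (F X) Y \<and> g \<in> arr \<D> Y (F X) \<and>
      cmp \<D> (F X) Y (F X) g f = ident \<D> (F X) \<and> cmp \<D> Y (F X) Y f g = ident \<D> Y"
  proof
    fix Y assume "Y \<in> obj \<D>"
    then obtain X f where "X \<in> obj \<C>" "is_iso \<D> (F X) Y f"
      using ff unfolding ff_ess_surj_def by blast
    moreover from this obtain g where "g \<in> arr \<D> Y (F X)"
      "cmp \<D> (F X) Y (F X) g f = ident \<D> (F X)" "cmp \<D> Y (F X) Y f g = ident \<D> Y"
      unfolding is_iso_def by (elim conjE bexE)
    ultimately show "\<exists>X f g. X \<in> obj \<C> \<and> f \<in> arr \<D> (F X) Y \<and> g \<in> arr \<D> Y (F X) \<and>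
        cmp \<D> (F X) Y (F X) g f = ident \<D> (F X) \<and> cmp \<D> Y (F X) Y f g = ident \<D> Y"
      unfolding is_iso_def by (intro exI[of _ X] exI[of _ f] exI[of _ g]) simp
  qed
  then have "\<exists>H \<theta> \<zeta>. \<forall>Y\<in>obj \<D>. H Y \<in> obj \<C> \<and> \<theta> Y \<in> arr \<D> (F (H Y)) Y \<and> \<zeta> Y \<in> arr \<D> Y (F (H Y)) \<and>
      cmp \<D> (F (H Y)) Y (F (H Y)) (\<zeta> Y) (\<theta> Y) = ident \<D> (F (H Y)) \<and>
      cmp \<D> Y (F (H Y)) Y (\<theta> Y) (\<zeta> Y) = ident \<D> Y"
    by (simp only: bchoice_iff)
  then obtain H \<theta> \<zeta> where "\<forall>Y\<in>obj \<D>. H Y \<in> obj \<C> \<and> \<theta> Y \<in> arr \<D> (F (H Y)) Y \<and> \<zeta> Y \<in> arr \<D> Y (F (H Y)) \<and>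
      cmp \<D> (F (H Y)) Y (F (H Y)) (\<zeta> Y) (\<theta> Y) = ident \<D> (F (H Y)) \<and>
      cmp \<D> Y (F (H Y)) Y (\<theta> Y) (\<zeta> Y) = ident \<D> Y"
    by (elim exE)
  then have H: "\<And>Y. Y \<in> obj \<D> \<Longrightarrow> H Y \<in> obj \<C>"
    and \<theta>: "\<And>Y. Y \<in> obj \<D> \<Longrightarrow> \<theta> Y \<in> arr \<D> (F (H Y)) Y"
    and \<zeta>: "\<And>Y. Y \<in> obj \<D> \<Longrightarrow> \<zeta> Y \<in> arr \<D> Y (F (H Y))"
    and \<zeta>\<theta>: "\<And>Y. Y \<in> obj \<D> \<Longrightarrow> cmp \<D> (F (H Y)) Y (F (H Y)) (\<zeta> Y) (\<theta> Y) = ident \<D> (F (H Y))"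
    and \<theta>\<zeta>: "\<And>Y. Y \<in> obj \<D> \<Longrightarrow> cmp \<D> Y (F (H Y)) Y (\<theta> Y) (\<zeta> Y) = ident \<D> Y"
    by simp_all
  note [simp] = H \<theta> \<zeta> \<zeta>\<theta> \<theta>\<zeta> ff_obj ff_arr
  \<comment> \<open>The inverse functor sends an arrow to the unique preimage of its conjugate by \<open>\<theta>\<close>.\<close>
  define cj where "cj Y Y' u = cmp \<D> (F (H Y)) Y' (F (H Y')) (\<zeta> Y') (cmp \<D> (F (H Y)) Y Y' u (\<theta> Y))" for Y Y' u
  define Ha where "Ha Y Y' u = inv_into (arr \<C> (H Y) (H Y')) (Fa (H Y) (H Y')) (cj Y Y' u)" for Y Y' u
  have cj: "cj Y Y' u \<in> arr \<D> (F (H Y)) (F (H Y'))" if "Y \<in> obj \<D>" "Y' \<in> obj \<D>" "u \<in> arr \<D> Y Y'" for Y Y' u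
    unfolding cj_def using that
    by (intro D.cmp_arr[of _ Y'] D.cmp_arr[of _ Y]) simp_all
  have Ha: "Ha Y Y' u \<in> arr \<C> (H Y) (H Y')" and FHa: "Fa (H Y) (H Y') (Ha Y Y' u) = cj Y Y' u"
    if "Y \<in> obj \<D>" "Y' \<in> obj \<D>" "u \<in> arr \<D> Y Y'" for Y Y' u
    using cj[OF that] ff_bij[of "H Y" "H Y'"] that unfolding Ha_def bij_betw_def
    by (auto intro: inv_into_into f_inv_into_f)
  have \<theta>cj: "cmp \<D> (F (H Y)) (F (H Y')) Y' (\<theta> Y') (cj Y Y' u) = cmp \<D> (F (H Y)) Y Y' u (\<theta> Y)"
    if "Y \<in> obj \<D>" "Y' \<in> obj \<D>" "u \<in> arr \<D> Y Y'" for Y Y' u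
  proof -
    have a: "cmp \<D> (F (H Y)) Y Y' u (\<theta> Y) \<in> arr \<D> (F (H Y)) Y'"
      using that by (intro D.cmp_arr[of _ Y]) simp_all
    show ?thesis unfolding cj_def using that a
      by (subst D.cmp_assoc[of _ Y' "F (H Y')" Y']) (simp_all add: D.cmp_ident_left)
  qed
  have \<theta>_mono: "p = q" if "Y \<in> obj \<D>" "Z \<in> obj \<D>" "p \<in> arr \<D> Z (F (H Y))" "q \<in> arr \<D> Z (F (H Y))"
    "cmp \<D> Z (F (H Y)) Y (\<theta> Y) p = cmp \<D> Z (F (H Y)) Y (\<theta> Y) q" for Y Z p q
  proof -
    have "cmp \<D> Z Y (F (H Y)) (\<zeta> Y) (cmp \<D> Z (F (H Y)) Y (\<theta> Y) r) = r" if "r \<in> arr \<D> Z (F (H Y))" for r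
      using that \<open>Y \<in> obj \<D>\<close> \<open>Z \<in> obj \<D>\<close>
      by (subst D.cmp_assoc[of _ "F (H Y)" Y "F (H Y)"]) (simp_all add: D.cmp_ident_left)
    then show ?thesis using that by metis
  qed
  have fun_H: "is_functor \<D> \<C> H Ha"
    unfolding is_functor_def
  proof (intro conjI ballI)
    fix Y assume Y: "Y \<in> obj \<D>"
    have "cj Y Y (ident \<D> Y) = ident \<D> (F (H Y))"
      unfolding cj_def using Y by (simp add: D.cmp_ident_left)
    then show "Ha Y Y (ident \<D> Y) = ident \<C> (H Y)"
      using Y by (intro ff_eqI[of "H Y" "H Y"]) (simp_all add: Ha FHa D.ident_arr C.ident_arr ff_ident)
  next
    fix X Y Z u w assume o: "X \<in> obj \<D>" "Y \<in> obj \<D>" "Z \<in> obj \<D>" and u: "u \<in> arr \<D> X Y" and w: "w \<in> arr \<D> Y Z"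
    note c = D.cmp_arr[OF o u w]
    have 1: "cmp \<D> (F (H X)) (F (H Y)) (F (H Z)) (cj Y Z w) (cj X Y u) = cj X Z (cmp \<D> X Y Z w u)"
    proof (rule \<theta>_mono[OF o(3)])
      show "cmp \<D> (F (H X)) (F (H Z)) Z (\<theta> Z) (cmp \<D> (F (H X)) (F (H Y)) (F (H Z)) (cj Y Z w) (cj X Y u))
        = cmp \<D> (F (H X)) (F (H Z)) Z (\<theta> Z) (cj X Z (cmp \<D> X Y Z w u))"
        (is "?l = ?r")
      proof -
        have "?l = cmp \<D> (F (H X)) (F (H Y)) Z (cmp \<D> (F (H Y)) (F (H Z)) Z (\<theta> Z) (cj Y Z w)) (cj X Y u)"
          using o u w cj by (intro D.cmp_assoc) simp_all
        also have "\<dots> = cmp \<D> (F (H X)) (F (H Y)) Z (cmp \<D> (F (H Y)) Y Z w (\<theta> Y)) (cj X Y u)"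
          using o w by (simp only: \<theta>cj)
        also have "\<dots> = cmp \<D> (F (H X)) Y Z w (cmp \<D> (F (H X)) (F (H Y)) Y (\<theta> Y) (cj X Y u))"
          using o u w cj by (intro D.cmp_assoc[symmetric]) simp_all
        also have "\<dots> = cmp \<D> (F (H X)) Y Z w (cmp \<D> (F (H X)) X Y u (\<theta> X))"
          using o u by (simp only: \<theta>cj)
        also have "\<dots> = cmp \<D> (F (H X)) X Z (cmp \<D> X Y Z w u) (\<theta> X)"
          using o u w by (intro D.cmp_assoc) simp_all
        also have "\<dots> = ?r" using o c by (simp only: \<theta>cj)
        finally show ?thesis .
      qed
    qed (use o u w c cj in \<open>auto intro: D.cmp_arr[of _ "F (H Y)"]\<close>)
    show "Ha X Z (cmp \<D> X Y Z w u) = cmp \<C> (H X) (H Y) (H Z) (Ha Y Z w) (Ha X Y u)"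
      using o u w c 1 by (intro ff_eqI[of "H X" "H Z"])
        (simp_all add: Ha FHa ff_cmp C.cmp_arr[of _ "H Y"])
  qed (simp_all add: Ha)
  have nat_\<theta>: "is_natural_iso \<D> \<D> (\<lambda>X. F (H X)) (\<lambda>X Y f. Fa (H X) (H Y) (Ha X Y f)) (\<lambda>X. X) (\<lambda>X Y f. f) \<theta>"
    unfolding is_natural_iso_def is_iso_def
  proof (intro conjI ballI)
    show "\<exists>g\<in>arr \<D> Y (F (H Y)). cmp \<D> (F (H Y)) Y (F (H Y)) g (\<theta> Y) = ident \<D> (F (H Y)) \<and>
        cmp \<D> Y (F (H Y)) Y (\<theta> Y) g = ident \<D> Y" if "Y \<in> obj \<D>" for Y
      using that by (intro bexI[of _ "\<zeta> Y"]) simp_all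
  qed (simp_all add: FHa \<theta>cj)
  define \<eta> where "\<eta> X = inv_into (arr \<C> X (H (F X))) (Fa X (H (F X))) (\<zeta> (F X))" for X
  have \<eta>: "\<eta> X \<in> arr \<C> X (H (F X))" "Fa X (H (F X)) (\<eta> X) = \<zeta> (F X)" if "X \<in> obj \<C>" for X
    using that ff_bij[of X "H (F X)"] unfolding \<eta>_def bij_betw_def
    by (auto intro: inv_into_into f_inv_into_f)
  have iso_\<eta>: "is_iso \<C> X (H (F X)) (\<eta> X)" if "X \<in> obj \<C>" for X
  proof (rule ff_reflects_iso)
    show "is_iso \<D> (F X) (F (H (F X))) (Fa X (H (F X)) (\<eta> X))"
      unfolding is_iso_def using that by (auto simp: \<eta> intro!: bexI[of _ "\<theta> (F X)"])
  qed (use that \<eta> in auto)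
  have nat_\<eta>: "is_natural_iso \<C> \<C> (\<lambda>X. X) (\<lambda>X Y f. f)
      (\<lambda>X. H (F X)) (\<lambda>X Y f. Ha (F X) (F Y) (Fa X Y f)) \<eta>"
    unfolding is_natural_iso_def
  proof (intro conjI ballI iso_\<eta>)
    fix X Y f assume o: "X \<in> obj \<C>" "Y \<in> obj \<C>" and f: "f \<in> arr \<C> X Y"
    have c1: "cmp \<C> X Y (H (F Y)) (\<eta> Y) f \<in> arr \<C> X (H (F Y))"
      using o f \<eta> by (intro C.cmp_arr[of _ Y]) auto
    have c2: "cmp \<C> X (H (F X)) (H (F Y)) (Ha (F X) (F Y) (Fa X Y f)) (\<eta> X) \<in> arr \<C> X (H (F Y))"
      using o f \<eta> by (intro C.cmp_arr[of _ "H (F X)"]) (auto simp: Ha)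
    have "cmp \<D> (F X) (F Y) (F (H (F Y))) (\<zeta> (F Y)) (Fa X Y f)
        = cmp \<D> (F X) (F (H (F X))) (F (H (F Y))) (cj (F X) (F Y) (Fa X Y f)) (\<zeta> (F X))"
    proof (rule \<theta>_mono)
      show "cmp \<D> (F X) (F (H (F Y))) (F Y) (\<theta> (F Y)) (cmp \<D> (F X) (F Y) (F (H (F Y))) (\<zeta> (F Y)) (Fa X Y f)) =
        cmp \<D> (F X) (F (H (F Y))) (F Y) (\<theta> (F Y))
          (cmp \<D> (F X) (F (H (F X))) (F (H (F Y))) (cj (F X) (F Y) (Fa X Y f)) (\<zeta> (F X)))"
        (is "?l = ?r")
      proof -
        have "?l = cmp \<D> (F X) (F Y) (F Y) (cmp \<D> (F Y) (F (H (F Y))) (F Y) (\<theta> (F Y)) (\<zeta> (F Y))) (Fa X Y f)"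
          using o f by (intro D.cmp_assoc) simp_all
        also have "\<dots> = cmp \<D> (F X) (F X) (F Y) (Fa X Y f) (cmp \<D> (F X) (F (H (F X))) (F X) (\<theta> (F X)) (\<zeta> (F X)))"
          using o f by (simp add: D.cmp_ident_left D.cmp_ident_right)
        also have "\<dots> = cmp \<D> (F X) (F (H (F X))) (F Y)
            (cmp \<D> (F (H (F X))) (F X) (F Y) (Fa X Y f) (\<theta> (F X))) (\<zeta> (F X))"
          using o f by (intro D.cmp_assoc) simp_all
        also have "\<dots> = cmp \<D> (F X) (F (H (F X))) (F Y)
            (cmp \<D> (F (H (F X))) (F (H (F Y))) (F Y) (\<theta> (F Y)) (cj (F X) (F Y) (Fa X Y f))) (\<zeta> (F X))"
          using o f by (simp only: \<theta>cj ff_obj ff_arr)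
        also have "\<dots> = ?r"
          using o f cj by (intro D.cmp_assoc[symmetric]) simp_all
        finally show ?thesis .
      qed
    qed (use o f cj in \<open>auto intro: D.cmp_arr[of _ "F Y"] D.cmp_arr[of _ "F (H (F X))"]\<close>)
    then show "cmp \<C> X Y (H (F Y)) (\<eta> Y) f = cmp \<C> X (H (F X)) (H (F Y)) (Ha (F X) (F Y) (Fa X Y f)) (\<eta> X)"
      using o f c1 c2 by (intro ff_eqI[of X "H (F Y)"]) (simp_all add: ff_cmp \<eta> Ha FHa)
  qed
  have "is_functor \<C> \<D> F Fa" using ff by (simp add: ff_ess_surj_def)
  then show ?thesis
    unfolding equivalent_categories_def using catC catD fun_H nat_\<eta> nat_\<theta>
    by (intro conjI exI[of _ F] exI[of _ Fa] exI[of _ H] exI[of _ Ha] exI[of _ \<eta>] exI[of _ \<theta>])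
qed

end

section \<open>Products of categories\<close>

lemma category_product:
  assumes "\<And>i. i \<in> I \<Longrightarrow> category (\<D> i)"
  shows "category (product_category I \<D>)"
proof
  fix X assume "X \<in> obj (product_category I \<D>)"
  then show "ident (product_category I \<D>) X \<in> arr (product_category I \<D>) X X"
    by (auto simp: product_category_def PiE_iff intro!: category.ident_arr assms)
next
  fix X Y Z f g
  assume "X \<in> obj (product_category I \<D>)" "Y \<in> obj (product_category I \<D>)" "Z \<in> obj (product_category I \<D>)"
    "f \<in> arr (product_category I \<D>) X Y" "g \<in> arr (product_category I \<D>) Y Z"
  then show "cmp (product_category I \<D>) X Y Z g f \<in> arr (product_category I \<D>) X Z"
    by (auto simp: product_category_def PiE_iff intro!: category.cmp_arr[where Y = "Y _"] assms)
next
  fix X Y f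
  assume *: "X \<in> obj (product_category I \<D>)" "Y \<in> obj (product_category I \<D>)"
    "f \<in> arr (product_category I \<D>) X Y"
  show "cmp (product_category I \<D>) X X Y f (ident (product_category I \<D>) X) = f"
    using * by (intro extensionalityI[of _ I])
      (auto simp: product_category_def PiE_iff intro!: category.cmp_ident_right assms)
  show "cmp (product_category I \<D>) X Y Y (ident (product_category I \<D>) Y) f = f"
    using * by (intro extensionalityI[of _ I])
      (auto simp: product_category_def PiE_iff intro!: category.cmp_ident_left assms)
next
  fix W X Y Z f g h
  assume "W \<in> obj (product_category I \<D>)" "X \<in> obj (product_category I \<D>)"
    "Y \<in> obj (product_category I \<D>)" "Z \<in> obj (product_category I \<D>)"
    "f \<in> arr (product_category I \<D>) W X" "g \<in> arr (product_category I \<D>) X Y"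
    "h \<in> arr (product_category I \<D>) Y Z"
  then show "cmp (product_category I \<D>) W Y Z h (cmp (product_category I \<D>) W X Y g f)
    = cmp (product_category I \<D>) W X Z (cmp (product_category I \<D>) X Y Z h g) f"
    by (intro extensionalityI[of _ I])
      (auto simp: product_category_def PiE_iff intro!: category.cmp_assoc assms)
qed

text \<open>An inverse is chosen in every factor; the choice has to be cut down to \<open>I\<close> because arrows of the
product are extensional.\<close>

lemma is_iso_product:
  assumes X: "X \<in> extensional I" and f: "f \<in> extensional I"
    and iso: "\<And>i. i \<in> I \<Longrightarrow> is_iso (\<D> i) (X i) (Y i) (f i)"
  shows "is_iso (product_category I \<D>) X Y f"
proof -
  have "\<forall>i\<in>I. \<exists>g. g \<in> arr (\<D> i) (Y i) (X i) \<and>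
    cmp (\<D> i) (X i) (Y i) (X i) g (f i) = ident (\<D> i) (X i) \<and>
    cmp (\<D> i) (Y i) (X i) (Y i) (f i) g = ident (\<D> i) (Y i)"
    using iso by (auto simp: is_iso_def)
  then obtain g where g: "\<forall>i\<in>I. g i \<in> arr (\<D> i) (Y i) (X i) \<and>
    cmp (\<D> i) (X i) (Y i) (X i) (g i) (f i) = ident (\<D> i) (X i) \<and>
    cmp (\<D> i) (Y i) (X i) (Y i) (f i) (g i) = ident (\<D> i) (Y i)"
    unfolding bchoice_iff by (elim exE)
  have "f i \<in> arr (\<D> i) (X i) (Y i)" if "i \<in> I" for i using iso[OF that] by (simp add: is_iso_def)
  then show ?thesis
    unfolding is_iso_def using X f g
    by (auto simp: product_category_def PiE_iff intro!: bexI[of _ "restrict g I"] restrict_ext)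
qed

lemma ff_ess_surj_product:
  assumes ff: "\<And>i. i \<in> I \<Longrightarrow> ff_ess_surj (\<C> i) (\<D> i) (F i) (Fa i)"
  shows "ff_ess_surj (product_category I \<C>) (product_category I \<D>)
    (\<lambda>X. \<lambda>i\<in>I. F i (X i)) (\<lambda>X Y f. \<lambda>i\<in>I. Fa i (X i) (Y i) (f i))"
  unfolding ff_ess_surj_def
proof (intro conjI ballI)
  show "is_functor (product_category I \<C>) (product_category I \<D>)
    (\<lambda>X. \<lambda>i\<in>I. F i (X i)) (\<lambda>X Y f. \<lambda>i\<in>I. Fa i (X i) (Y i) (f i))"
    using ff unfolding is_functor_def ff_ess_surj_def product_category_def
    by (auto simp: PiE_iff intro!: restrict_ext)
next
  fix X Y assume "X \<in> obj (product_category I \<C>)" "Y \<in> obj (product_category I \<C>)"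
  then have b: "bij_betw (Fa i (X i) (Y i)) (arr (\<C> i) (X i) (Y i)) (arr (\<D> i) (F i (X i)) (F i (Y i)))"
    if "i \<in> I" for i using ff[OF that] that by (auto simp: product_category_def ff_ess_surj_def)
  have inv: "inv_into (arr (\<C> i) (X i) (Y i)) (Fa i (X i) (Y i)) u \<in> arr (\<C> i) (X i) (Y i)"
    if "i \<in> I" "u \<in> arr (\<D> i) (F i (X i)) (F i (Y i))" for i u
    using b[OF that(1)] that(2) by (metis bij_betw_def inv_into_into)
  show "bij_betw (\<lambda>f. \<lambda>i\<in>I. Fa i (X i) (Y i) (f i)) (arr (product_category I \<C>) X Y)
     (arr (product_category I \<D>) (\<lambda>i\<in>I. F i (X i)) (\<lambda>i\<in>I. F i (Y i)))"
    by (rule bij_betw_byWitness[where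
          f' = "\<lambda>u. \<lambda>i\<in>I. inv_into (arr (\<C> i) (X i) (Y i)) (Fa i (X i) (Y i)) (u i)"])
      (use inv in \<open>auto simp: product_category_def PiE_iff bij_betw_inv_into_left[OF b]
         bij_betw_inv_into_right[OF b] bij_betw_apply[OF b] intro!: extensionalityI[of _ I]\<close>)
next
  fix Y assume Y: "Y \<in> obj (product_category I \<D>)"
  then have "\<forall>i\<in>I. \<exists>X f. X \<in> obj (\<C> i) \<and> is_iso (\<D> i) (F i X) (Y i) f"
    using ff by (auto simp: product_category_def ff_ess_surj_def PiE_iff Bex_def)
  then obtain X f where Xf: "\<forall>i\<in>I. X i \<in> obj (\<C> i) \<and> is_iso (\<D> i) (F i (X i)) (Y i) (f i)"
    unfolding bchoice_iff by (elim exE)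
  have "is_iso (product_category I \<D>) (\<lambda>i\<in>I. F i (restrict X I i)) Y (restrict f I)"
    by (rule is_iso_product) (use Xf in auto)
  then show "\<exists>X\<in>obj (product_category I \<C>). \<exists>f. is_iso (product_category I \<D>) (\<lambda>i\<in>I. F i (X i)) Y f"
    using Xf by (intro bexI[of _ "restrict X I"]) (auto simp: product_category_def)
qed

section \<open>Homogeneous elements of Majid bimodules\<close>

locale three_cocycle = K: field K + G: group G
  for K :: "('k, 'r) ring_scheme" and G :: "('g, 's) monoid_scheme" (structure)
    and \<Phi> :: "'g \<Rightarrow> 'g \<Rightarrow> 'g \<Rightarrow> 'k" +
  assumes cocycle_axioms: "normalized_3_cocycle K G \<Phi>"
begin

lemma Phi_Units [simp]: "\<lbrakk>e \<in> carrier G; f \<in> carrier G; g \<in> carrier G\<rbrakk> \<Longrightarrow> \<Phi> e f g \<in> Units K"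
  and Phi_cocycle: "\<lbrakk>e \<in> carrier G; f \<in> carrier G; g \<in> carrier G; h \<in> carrier G\<rbrakk> \<Longrightarrow>
        \<Phi> e f g \<otimes>\<^bsub>K\<^esub> \<Phi> e (f \<otimes> g) h \<otimes>\<^bsub>K\<^esub> \<Phi> f g h = \<Phi> (e \<otimes> f) g h \<otimes>\<^bsub>K\<^esub> \<Phi> e f (g \<otimes> h)"
  and Phi_one [simp]: "\<lbrakk>e \<in> carrier G; f \<in> carrier G\<rbrakk> \<Longrightarrow> \<Phi> \<one> e f = \<one>\<^bsub>K\<^esub>"
    "\<lbrakk>e \<in> carrier G; f \<in> carrier G\<rbrakk> \<Longrightarrow> \<Phi> e \<one> f = \<one>\<^bsub>K\<^esub>"
    "\<lbrakk>e \<in> carrier G; f \<in> carrier G\<rbrakk> \<Longrightarrow> \<Phi> e f \<one> = \<one>\<^bsub>K\<^esub>"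
  using cocycle_axioms unfolding normalized_3_cocycle_def by simp_all

declare K.Units_closed [simp] K.Units_m_closed [simp] K.Units_inv_Units [simp]

lemma inv_one_K [simp]: "inv\<^bsub>K\<^esub> \<one>\<^bsub>K\<^esub> = \<one>\<^bsub>K\<^esub>"
  by (rule K.comm_inv_char) auto

lemma inv_mult_Units: "\<lbrakk>a \<in> Units K; b \<in> Units K\<rbrakk> \<Longrightarrow> inv\<^bsub>K\<^esub> (a \<otimes>\<^bsub>K\<^esub> b) = inv\<^bsub>K\<^esub> a \<otimes>\<^bsub>K\<^esub> inv\<^bsub>K\<^esub> b"
proof (rule K.comm_inv_char)
  assume ab: "a \<in> Units K" "b \<in> Units K"
  have "a \<otimes>\<^bsub>K\<^esub> b \<otimes>\<^bsub>K\<^esub> (inv\<^bsub>K\<^esub> a \<otimes>\<^bsub>K\<^esub> inv\<^bsub>K\<^esub> b) = (a \<otimes>\<^bsub>K\<^esub> inv\<^bsub>K\<^esub> a) \<otimes>\<^bsub>K\<^esub> (b \<otimes>\<^bsub>K\<^esub> inv\<^bsub>K\<^esub> b)"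
    using ab by (simp add: K.m_ac del: K.Units_r_inv)
  then show "a \<otimes>\<^bsub>K\<^esub> b \<otimes>\<^bsub>K\<^esub> (inv\<^bsub>K\<^esub> a \<otimes>\<^bsub>K\<^esub> inv\<^bsub>K\<^esub> b) = \<one>\<^bsub>K\<^esub>"
    using ab by simp
qed auto

lemma Units_l_cancel:
  "\<lbrakk>a \<in> Units K; x \<in> carrier K; y \<in> carrier K; a \<otimes>\<^bsub>K\<^esub> x = a \<otimes>\<^bsub>K\<^esub> y\<rbrakk> \<Longrightarrow> x = y"
  by (metis K.Units_l_cancel)

lemma quotient_eqI:
  assumes "a \<in> Units K" "b \<in> Units K" "c \<in> Units K" "d \<in> Units K" "a \<otimes>\<^bsub>K\<^esub> d = c \<otimes>\<^bsub>K\<^esub> b"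
  shows "a \<otimes>\<^bsub>K\<^esub> inv\<^bsub>K\<^esub> b = c \<otimes>\<^bsub>K\<^esub> inv\<^bsub>K\<^esub> d"
proof -
  have "a \<otimes>\<^bsub>K\<^esub> inv\<^bsub>K\<^esub> b = a \<otimes>\<^bsub>K\<^esub> d \<otimes>\<^bsub>K\<^esub> inv\<^bsub>K\<^esub> d \<otimes>\<^bsub>K\<^esub> inv\<^bsub>K\<^esub> b"
    using assms(1-4) by (simp add: K.m_assoc)
  also have "\<dots> = c \<otimes>\<^bsub>K\<^esub> inv\<^bsub>K\<^esub> d \<otimes>\<^bsub>K\<^esub> (b \<otimes>\<^bsub>K\<^esub> inv\<^bsub>K\<^esub> b)"
    unfolding assms(5) using assms(1-4) by (simp add: K.m_ac del: K.Units_r_inv)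
  finally show ?thesis using assms by simp
qed

text \<open>The scalars produced by moving brackets around an element \<open>m\<close> of bidegree \<open>(g, \<one>)\<close> in a bimodule:
\<open>e.((a.m).b)\<close> is the multiple of \<open>((e a).m).b\<close> by \<open>left_scalar g e a b\<close>, and \<open>((a.m).b).c\<close> that of
\<open>(a.m).(b c)\<close> by \<open>right_scalar g a b c\<close>; replacing \<open>m\<close> by its adjoint transform under \<open>z\<close>, the
element \<open>(a.((z.m).z\<inverse>)).b\<close> is the multiple of \<open>((a z).m).(z\<inverse> b)\<close> by \<open>conj_scalar g a z b\<close>. If
\<open>e a = a' z\<close>, the quotient \<open>transport_scalar\<close> compares \<open>e.((a.m).b)\<close> with
\<open>(a'.((z.m).z\<inverse>)).(z b)\<close>.\<close>

definition left_scalar where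
  "left_scalar g e a b = \<Phi> e (a \<otimes> g) b \<otimes>\<^bsub>K\<^esub> inv\<^bsub>K\<^esub> \<Phi> e a b \<otimes>\<^bsub>K\<^esub> \<Phi> e a g"

definition right_scalar where
  "right_scalar g a b c = \<Phi> a b c \<otimes>\<^bsub>K\<^esub> inv\<^bsub>K\<^esub> \<Phi> (a \<otimes> g) b c"

definition conj_scalar where
  "conj_scalar g a z b = right_scalar g (a \<otimes> z) (inv z) b \<otimes>\<^bsub>K\<^esub> left_scalar g a z (inv z)"

definition transport_scalar where
  "transport_scalar g e a b a' z = left_scalar g e a b \<otimes>\<^bsub>K\<^esub> inv\<^bsub>K\<^esub> conj_scalar g a' z (z \<otimes> b)"

lemma left_scalar_Units [simp]:
  "\<lbrakk>g \<in> carrier G; e \<in> carrier G; a \<in> carrier G; b \<in> carrier G\<rbrakk> \<Longrightarrow> left_scalar g e a b \<in> Units K"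
  and right_scalar_Units [simp]:
  "\<lbrakk>g \<in> carrier G; a \<in> carrier G; b \<in> carrier G; c \<in> carrier G\<rbrakk> \<Longrightarrow> right_scalar g a b c \<in> Units K"
  and Phi_tilde_Units [simp]:
  "\<lbrakk>e \<in> carrier G; f \<in> carrier G; g \<in> carrier G\<rbrakk> \<Longrightarrow> Phi_tilde K G \<Phi> e f g \<in> Units K"
  by (simp_all add: left_scalar_def right_scalar_def Phi_tilde_def)

lemma conj_scalar_Units [simp]:
  "\<lbrakk>g \<in> carrier G; a \<in> carrier G; z \<in> carrier G; b \<in> carrier G\<rbrakk> \<Longrightarrow> conj_scalar g a z b \<in> Units K"
  by (simp add: conj_scalar_def)

lemma transport_scalar_Units [simp]:
  "\<lbrakk>g \<in> carrier G; e \<in> carrier G; a \<in> carrier G; b \<in> carrier G; a' \<in> carrier G; z \<in> carrier G\<rbrakk>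
    \<Longrightarrow> transport_scalar g e a b a' z \<in> Units K"
  by (simp add: transport_scalar_def)

end

text \<open>What remains of a Majid bimodule when addition is forgotten: sets of homogeneous elements with
multiplication by units and the two actions. All bracket manipulations take place at this level, so
that they apply both to Majid bimodules and to the free model below, whose elements are multiples of
single basis vectors.\<close>

locale homogeneous_action = three_cocycle K G \<Phi>
  for K :: "('k, 'r) ring_scheme" and G :: "('g, 's) monoid_scheme" (structure)
    and \<Phi> :: "'g \<Rightarrow> 'g \<Rightarrow> 'g \<Rightarrow> 'k" +
  fixes H :: "'g \<Rightarrow> 'g \<Rightarrow> 'x set" and sm :: "'k \<Rightarrow> 'x \<Rightarrow> 'x"
    and l :: "'g \<Rightarrow> 'x \<Rightarrow> 'x" and r :: "'x \<Rightarrow> 'g \<Rightarrow> 'x"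
  assumes sm_closed: "\<lbrakk>k \<in> Units K; g \<in> carrier G; h \<in> carrier G; m \<in> H g h\<rbrakk> \<Longrightarrow> sm k m \<in> H g h"
    and sm_sm: "\<lbrakk>j \<in> Units K; k \<in> Units K; g \<in> carrier G; h \<in> carrier G; m \<in> H g h\<rbrakk> \<Longrightarrow>
      sm j (sm k m) = sm (j \<otimes>\<^bsub>K\<^esub> k) m"
    and sm_one: "\<lbrakk>g \<in> carrier G; h \<in> carrier G; m \<in> H g h\<rbrakk> \<Longrightarrow> sm \<one>\<^bsub>K\<^esub> m = m"
    and l_closed: "\<lbrakk>e \<in> carrier G; g \<in> carrier G; h \<in> carrier G; m \<in> H g h\<rbrakk> \<Longrightarrow>
      l e m \<in> H (e \<otimes> g) (e \<otimes> h)"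
    and r_closed: "\<lbrakk>e \<in> carrier G; g \<in> carrier G; h \<in> carrier G; m \<in> H g h\<rbrakk> \<Longrightarrow>
      r m e \<in> H (g \<otimes> e) (h \<otimes> e)"
    and l_sm: "\<lbrakk>k \<in> Units K; e \<in> carrier G; g \<in> carrier G; h \<in> carrier G; m \<in> H g h\<rbrakk> \<Longrightarrow>
      l e (sm k m) = sm k (l e m)"
    and r_sm: "\<lbrakk>k \<in> Units K; e \<in> carrier G; g \<in> carrier G; h \<in> carrier G; m \<in> H g h\<rbrakk> \<Longrightarrow>
      r (sm k m) e = sm k (r m e)"
    and l_one: "\<lbrakk>g \<in> carrier G; h \<in> carrier G; m \<in> H g h\<rbrakk> \<Longrightarrow> l \<one> m = m"
    and r_one: "\<lbrakk>g \<in> carrier G; h \<in> carrier G; m \<in> H g h\<rbrakk> \<Longrightarrow> r m \<one> = m"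
    and l_l: "\<lbrakk>e \<in> carrier G; f \<in> carrier G; g \<in> carrier G; h \<in> carrier G; m \<in> H g h\<rbrakk> \<Longrightarrow>
      l e (l f m) = sm (\<Phi> e f g \<otimes>\<^bsub>K\<^esub> inv\<^bsub>K\<^esub> \<Phi> e f h) (l (e \<otimes> f) m)"
    and r_r: "\<lbrakk>e \<in> carrier G; f \<in> carrier G; g \<in> carrier G; h \<in> carrier G; m \<in> H g h\<rbrakk> \<Longrightarrow>
      r (r m e) f = sm (\<Phi> h e f \<otimes>\<^bsub>K\<^esub> inv\<^bsub>K\<^esub> \<Phi> g e f) (r m (e \<otimes> f))"
    and l_r: "\<lbrakk>e \<in> carrier G; f \<in> carrier G; g \<in> carrier G; h \<in> carrier G; m \<in> H g h\<rbrakk> \<Longrightarrow>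
      r (l e m) f = sm (\<Phi> e h f \<otimes>\<^bsub>K\<^esub> inv\<^bsub>K\<^esub> \<Phi> e g f) (l e (r m f))"
begin

lemma l_of_r:
  assumes "e \<in> carrier G" "f \<in> carrier G" "g \<in> carrier G" "h \<in> carrier G" "m \<in> H g h"
  shows "l e (r m f) = sm (\<Phi> e g f \<otimes>\<^bsub>K\<^esub> inv\<^bsub>K\<^esub> \<Phi> e h f) (r (l e m) f)"
proof -
  note m = r_closed[OF assms(2-5)] and lm = l_closed[OF assms(1) _ _ r_closed[OF assms(2-5)]]
  have "\<Phi> e g f \<otimes>\<^bsub>K\<^esub> inv\<^bsub>K\<^esub> \<Phi> e h f \<otimes>\<^bsub>K\<^esub> (\<Phi> e h f \<otimes>\<^bsub>K\<^esub> inv\<^bsub>K\<^esub> \<Phi> e g f)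
      = (\<Phi> e g f \<otimes>\<^bsub>K\<^esub> inv\<^bsub>K\<^esub> \<Phi> e g f) \<otimes>\<^bsub>K\<^esub> (\<Phi> e h f \<otimes>\<^bsub>K\<^esub> inv\<^bsub>K\<^esub> \<Phi> e h f)"
    using assms by (simp add: K.m_ac del: K.Units_r_inv K.Units_l_inv)
  also have "\<dots> = \<one>\<^bsub>K\<^esub>" using assms by simp
  finally show ?thesis
    using assms lm by (simp add: l_r[OF assms] sm_sm[of _ _ "e \<otimes> (g \<otimes> f)" "e \<otimes> (h \<otimes> f)"]
      sm_one[of "e \<otimes> (g \<otimes> f)" "e \<otimes> (h \<otimes> f)"])
qed

text \<open>The adjoint action; it preserves right degree \<open>\<one>\<close>.\<close>

definition ad where "ad e m = r (l e m) (inv e)"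

lemma ad_closed:
  assumes "e \<in> carrier G" "g \<in> carrier G" "m \<in> H g \<one>"
  shows "ad e m \<in> H (e \<otimes> g \<otimes> inv e) \<one>"
  using r_closed[of "inv e" "e \<otimes> g" "e \<otimes> \<one>" "l e m"] l_closed[of e g \<one> m] assms by (simp add: ad_def)

lemma ad_sm:
  assumes "k \<in> Units K" "e \<in> carrier G" "g \<in> carrier G" "h \<in> carrier G" "m \<in> H g h"
  shows "ad e (sm k m) = sm k (ad e m)"
  using assms l_closed[OF assms(2-)]
  by (simp add: ad_def l_sm[of _ _ g h] r_sm[of _ _ "e \<otimes> g" "e \<otimes> h"])

lemma ad_one: "\<lbrakk>g \<in> carrier G; h \<in> carrier G; m \<in> H g h\<rbrakk> \<Longrightarrow> ad \<one> m = m"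
  by (simp add: ad_def l_one r_one)

text \<open>This is where \<open>Phi_tilde\<close> comes from: in \<open>(e.((f.m).f\<inverse>)).e\<inverse>\<close> the inner right action is first moved
out of the left action by \<open>e\<close>, then the two left and the two right actions are merged. The three
bracket moves contribute the three quotients in the definition of \<open>Phi_tilde\<close>, with one factor equal
to \<open>\<one>\<close> by normalization.\<close>

lemma ad_mult:
  assumes [simp]: "e \<in> carrier G" "f \<in> carrier G" "g \<in> carrier G" and m: "m \<in> H g \<one>"
  shows "ad e (ad f m) = sm (Phi_tilde K G \<Phi> e f g) (ad (e \<otimes> f) m)"
proof -
  have fm: "l f m \<in> H (f \<otimes> g) f" using l_closed[of f g \<one> m] m by simp
  have efm: "l (e \<otimes> f) m \<in> H (e \<otimes> f \<otimes> g) (e \<otimes> f)" using l_closed[of "e \<otimes> f" g \<one> m] m by simp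
  note efmf = r_closed[OF _ _ _ efm, of "inv f", simplified]
  note efmfe = r_closed[OF _ _ _ efm, of "inv f \<otimes> inv e", simplified]
  have "l e (ad f m) = sm (\<Phi> e (f \<otimes> g) (inv f) \<otimes>\<^bsub>K\<^esub> inv\<^bsub>K\<^esub> \<Phi> e f (inv f)) (r (l e (l f m)) (inv f))"
    unfolding ad_def using l_of_r[OF _ _ _ _ fm, of e "inv f"] by simp
  also have "l e (l f m) = sm (\<Phi> e f g) (l (e \<otimes> f) m)"
    using l_l[OF _ _ _ _ m, of e f] by simp
  also have "r \<dots> (inv f) = sm (\<Phi> e f g) (r (l (e \<otimes> f) m) (inv f))"
    using r_sm[OF _ _ _ _ efm] by simp
  finally have 1: "l e (ad f m) = sm (\<Phi> e (f \<otimes> g) (inv f) \<otimes>\<^bsub>K\<^esub> inv\<^bsub>K\<^esub> \<Phi> e f (inv f) \<otimes>\<^bsub>K\<^esub> \<Phi> e f g)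
      (r (l (e \<otimes> f) m) (inv f))"
    using sm_sm[OF _ _ _ _ efmf] by simp
  have "ad e (ad f m) = sm (\<Phi> e (f \<otimes> g) (inv f) \<otimes>\<^bsub>K\<^esub> inv\<^bsub>K\<^esub> \<Phi> e f (inv f) \<otimes>\<^bsub>K\<^esub> \<Phi> e f g)
      (r (r (l (e \<otimes> f) m) (inv f)) (inv e))"
    unfolding ad_def[of e] 1 using r_sm[OF _ _ _ _ efmf] by simp
  also have "r (r (l (e \<otimes> f) m) (inv f)) (inv e) =
      sm (\<Phi> (e \<otimes> f) (inv f) (inv e) \<otimes>\<^bsub>K\<^esub> inv\<^bsub>K\<^esub> \<Phi> (e \<otimes> f \<otimes> g) (inv f) (inv e)) (ad (e \<otimes> f) m)"
    using r_r[OF _ _ _ _ efm, of "inv f" "inv e"] by (simp add: ad_def G.inv_mult_group)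
  finally have 2: "ad e (ad f m) = sm (\<Phi> e (f \<otimes> g) (inv f) \<otimes>\<^bsub>K\<^esub> inv\<^bsub>K\<^esub> \<Phi> e f (inv f) \<otimes>\<^bsub>K\<^esub> \<Phi> e f g \<otimes>\<^bsub>K\<^esub>
      (\<Phi> (e \<otimes> f) (inv f) (inv e) \<otimes>\<^bsub>K\<^esub> inv\<^bsub>K\<^esub> \<Phi> (e \<otimes> f \<otimes> g) (inv f) (inv e))) (ad (e \<otimes> f) m)"
    using sm_sm[OF _ _ _ _ ad_closed[OF _ _ m, of "e \<otimes> f"]] by simp
  show ?thesis
    unfolding 2 Phi_tilde_def by (simp add: inv_mult_Units K.m_ac)
qed


definition sandwich where "sandwich m a b = r (l a m) b"

lemma sandwich_closed:
  assumes "g \<in> carrier G" "a \<in> carrier G" "b \<in> carrier G" "m \<in> H g \<one>"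
  shows "sandwich m a b \<in> H (a \<otimes> g \<otimes> b) (a \<otimes> b)"
  using r_closed[of b "a \<otimes> g" "a \<otimes> \<one>" "l a m"] l_closed[of a g \<one> m] assms by (simp add: sandwich_def)

lemma sandwich_sm:
  assumes "k \<in> Units K" "g \<in> carrier G" "a \<in> carrier G" "b \<in> carrier G" "m \<in> H g \<one>"
  shows "sandwich (sm k m) a b = sm k (sandwich m a b)"
  using assms l_closed[of a g \<one> m]
  by (simp add: sandwich_def l_sm[of _ _ g \<one>] r_sm[of _ _ "a \<otimes> g" "a"])

lemma l_sandwich:
  assumes [simp]: "g \<in> carrier G" "a \<in> carrier G" "b \<in> carrier G" "e \<in> carrier G" and m: "m \<in> H g \<one>"
  shows "l e (sandwich m a b) = sm (left_scalar g e a b) (sandwich m (e \<otimes> a) b)"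
proof -
  have am: "l a m \<in> H (a \<otimes> g) a" and eam: "l (e \<otimes> a) m \<in> H (e \<otimes> a \<otimes> g) (e \<otimes> a)"
    using l_closed[of a g \<one> m] l_closed[of "e \<otimes> a" g \<one> m] m by simp_all
  have "l e (sandwich m a b) = sm (\<Phi> e (a \<otimes> g) b \<otimes>\<^bsub>K\<^esub> inv\<^bsub>K\<^esub> \<Phi> e a b) (r (l e (l a m)) b)"
    unfolding sandwich_def using l_of_r[OF _ _ _ _ am] by simp
  also have "l e (l a m) = sm (\<Phi> e a g) (l (e \<otimes> a) m)"
    using l_l[OF _ _ _ _ m, of e a] by simp
  also have "r \<dots> b = sm (\<Phi> e a g) (sandwich m (e \<otimes> a) b)"
    unfolding sandwich_def using r_sm[OF _ _ _ _ eam] by simp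
  finally show ?thesis
    using sm_sm[OF _ _ _ _ sandwich_closed[OF _ _ _ m]] by (simp add: left_scalar_def)
qed

lemma r_sandwich:
  assumes [simp]: "g \<in> carrier G" "a \<in> carrier G" "b \<in> carrier G" "c \<in> carrier G" and m: "m \<in> H g \<one>"
  shows "r (sandwich m a b) c = sm (right_scalar g a b c) (sandwich m a (b \<otimes> c))"
  using r_r[of b c "a \<otimes> g" a "l a m"] l_closed[of a g \<one> m] m by (simp add: sandwich_def right_scalar_def)

lemma sandwich_ad:
  assumes [simp]: "g \<in> carrier G" "a \<in> carrier G" "b \<in> carrier G" "z \<in> carrier G" and m: "m \<in> H g \<one>"
  shows "sandwich (ad z m) a b = sm (conj_scalar g a z b) (sandwich m (a \<otimes> z) (inv z \<otimes> b))"
proof -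
  have "ad z m = sandwich m z (inv z)" by (simp add: ad_def sandwich_def)
  then have "sandwich (ad z m) a b = r (sm (left_scalar g a z (inv z)) (sandwich m (a \<otimes> z) (inv z))) b"
    unfolding sandwich_def[of "ad z m"] using l_sandwich[OF _ _ _ _ m, of z "inv z" a] by simp
  also have "\<dots> = sm (left_scalar g a z (inv z)) (sm (right_scalar g (a \<otimes> z) (inv z) b) (sandwich m (a \<otimes> z) (inv z \<otimes> b)))"
    using r_sm[OF _ _ _ _ sandwich_closed[OF _ _ _ m]] r_sandwich[OF _ _ _ _ m] by simp
  finally show ?thesis
    using sm_sm[OF _ _ _ _ sandwich_closed[OF _ _ _ m]] by (simp add: conj_scalar_def K.m_comm)
qed

text \<open>Both sides are multiples of \<open>((e a).m).b\<close>, because \<open>a' z = e a\<close> and \<open>z\<inverse> (z b) = b\<close>; the factor is the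
quotient of the two multiples, hence the same in all homogeneous actions.\<close>

lemma l_sandwich_ad:
  assumes [simp]: "g \<in> carrier G" "a \<in> carrier G" "b \<in> carrier G" "e \<in> carrier G"
    "a' \<in> carrier G" "z \<in> carrier G" and ea: "e \<otimes> a = a' \<otimes> z" and m: "m \<in> H g \<one>"
  shows "l e (sandwich m a b) = sm (transport_scalar g e a b a' z) (sandwich (ad z m) a' (z \<otimes> b))"
proof -
  have b: "inv z \<otimes> (z \<otimes> b) = b" by (simp flip: G.m_assoc)
  note c = sandwich_closed[OF _ _ _ m, of "a' \<otimes> z" b]
  have "sm (transport_scalar g e a b a' z) (sandwich (ad z m) a' (z \<otimes> b)) =
    sm (transport_scalar g e a b a' z \<otimes>\<^bsub>K\<^esub> conj_scalar g a' z (z \<otimes> b)) (sandwich m (a' \<otimes> z) b)"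
    using sandwich_ad[OF _ _ _ _ m, of a' "z \<otimes> b" z] sm_sm[OF _ _ _ _ c] b by simp
  also have "transport_scalar g e a b a' z \<otimes>\<^bsub>K\<^esub> conj_scalar g a' z (z \<otimes> b) = left_scalar g e a b"
    by (simp add: transport_scalar_def K.m_assoc)
  finally show ?thesis using l_sandwich[OF _ _ _ _ m, of a b e] ea by simp
qed

lemma ad_centralizer:
  assumes "g \<in> carrier G" "z \<in> carrier G" "z \<otimes> g = g \<otimes> z" "m \<in> H g \<one>"
  shows "ad z m \<in> H g \<one>"
proof -
  have "z \<otimes> g \<otimes> inv z = g" unfolding assms(3) using assms(1,2) by (simp add: G.m_assoc)
  then show ?thesis using ad_closed[of z g m] assms by simp
qed

text \<open>The scalar identities below come from computing one element in two ways: here \<open>f.(e.((a.m).b))\<close>,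
acting by \<open>e\<close> and \<open>f\<close> in succession or by \<open>f e\<close> at once. They are stated as equations between multiples
of one homogeneous element, so that the scalars can be compared wherever multiples determine their
factor.\<close>

lemma transport_scalar_mult_sm:
  assumes [simp]: "g \<in> carrier G" "a \<in> carrier G" "b \<in> carrier G" "e \<in> carrier G" "f \<in> carrier G"
    "a' \<in> carrier G" "z \<in> carrier G" "a'' \<in> carrier G" "z' \<in> carrier G"
    and ea: "e \<otimes> a = a' \<otimes> z" and fa: "f \<otimes> a' = a'' \<otimes> z'"
    and z: "z \<otimes> g = g \<otimes> z" and z': "z' \<otimes> g = g \<otimes> z'" and m: "m \<in> H g \<one>"
  shows "sm (transport_scalar g e a b a' z \<otimes>\<^bsub>K\<^esub> transport_scalar g f a' (z \<otimes> b) a'' z' \<otimes>\<^bsub>K\<^esub> Phi_tilde K G \<Phi> z' z g)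
      (sandwich (ad (z' \<otimes> z) m) a'' (z' \<otimes> z \<otimes> b)) =
    sm (\<Phi> f e (a \<otimes> g \<otimes> b) \<otimes>\<^bsub>K\<^esub> inv\<^bsub>K\<^esub> \<Phi> f e (a \<otimes> b) \<otimes>\<^bsub>K\<^esub> transport_scalar g (f \<otimes> e) a b a'' (z' \<otimes> z))
      (sandwich (ad (z' \<otimes> z) m) a'' (z' \<otimes> z \<otimes> b))" (is "_ = ?r")
proof -
  have zz: "z' \<otimes> z \<otimes> g = g \<otimes> (z' \<otimes> z)"
    using z z' by (metis G.m_assoc assms(1,7,9))
  have fea: "f \<otimes> e \<otimes> a = a'' \<otimes> (z' \<otimes> z)"
    using ea fa by (metis G.m_assoc assms(2,4,5,6,7,8,9))
  note cz = ad_centralizer[OF _ _ z m, simplified] and czz = ad_centralizer[OF _ _ zz m, simplified]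
  note cl = sandwich_closed[OF _ _ _ cz, of a' "z \<otimes> b"]
  note cl' = sandwich_closed[OF _ _ _ czz, of a'' "z' \<otimes> z \<otimes> b", simplified]
  have "l f (l e (sandwich m a b)) = sm (transport_scalar g e a b a' z) (l f (sandwich (ad z m) a' (z \<otimes> b)))"
    using l_sandwich_ad[OF _ _ _ _ _ _ ea m, of b] l_sm[OF _ _ _ _ cl] by simp
  also have "l f (sandwich (ad z m) a' (z \<otimes> b)) =
      sm (transport_scalar g f a' (z \<otimes> b) a'' z') (sandwich (ad z' (ad z m)) a'' (z' \<otimes> z \<otimes> b))"
    using l_sandwich_ad[OF _ _ _ _ _ _ fa cz, of "z \<otimes> b"] by (simp add: G.m_assoc)
  also have "sandwich (ad z' (ad z m)) a'' (z' \<otimes> z \<otimes> b) =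
      sm (Phi_tilde K G \<Phi> z' z g) (sandwich (ad (z' \<otimes> z) m) a'' (z' \<otimes> z \<otimes> b))"
    using ad_mult[OF _ _ _ m, of z' z] sandwich_sm[OF _ _ _ _ czz] by simp
  finally have 1: "l f (l e (sandwich m a b)) =
      sm (transport_scalar g e a b a' z \<otimes>\<^bsub>K\<^esub> transport_scalar g f a' (z \<otimes> b) a'' z' \<otimes>\<^bsub>K\<^esub> Phi_tilde K G \<Phi> z' z g)
      (sandwich (ad (z' \<otimes> z) m) a'' (z' \<otimes> z \<otimes> b))"
    using sm_sm[OF _ _ _ _ cl'] by (simp add: K.m_assoc)
  have "l f (l e (sandwich m a b)) =
      sm (\<Phi> f e (a \<otimes> g \<otimes> b) \<otimes>\<^bsub>K\<^esub> inv\<^bsub>K\<^esub> \<Phi> f e (a \<otimes> b)) (l (f \<otimes> e) (sandwich m a b))"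
    using l_l[OF _ _ _ _ sandwich_closed[OF _ _ _ m, of a b], of f e] by simp
  also have "l (f \<otimes> e) (sandwich m a b) = sm (transport_scalar g (f \<otimes> e) a b a'' (z' \<otimes> z))
      (sandwich (ad (z' \<otimes> z) m) a'' (z' \<otimes> z \<otimes> b))"
    using l_sandwich_ad[OF _ _ _ _ _ _ fea m, of b] by simp
  finally show ?thesis using 1 sm_sm[OF _ _ _ _ cl'] by simp
qed

lemma transport_right_scalar_sm:
  assumes [simp]: "g \<in> carrier G" "a \<in> carrier G" "b \<in> carrier G" "e \<in> carrier G"
    "a' \<in> carrier G" "z \<in> carrier G" "c \<in> carrier G" and ea: "e \<otimes> a = a' \<otimes> z"
    and z: "z \<otimes> g = g \<otimes> z" and m: "m \<in> H g \<one>"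
  shows "sm (transport_scalar g e a b a' z \<otimes>\<^bsub>K\<^esub> right_scalar g a' (z \<otimes> b) c) (sandwich (ad z m) a' (z \<otimes> b \<otimes> c)) =
    sm (\<Phi> e (a \<otimes> b) c \<otimes>\<^bsub>K\<^esub> inv\<^bsub>K\<^esub> \<Phi> e (a \<otimes> g \<otimes> b) c \<otimes>\<^bsub>K\<^esub> (right_scalar g a b c \<otimes>\<^bsub>K\<^esub> transport_scalar g e a (b \<otimes> c) a' z))
      (sandwich (ad z m) a' (z \<otimes> b \<otimes> c))"
proof -
  note cz = ad_centralizer[OF _ _ z m, simplified]
  note cl = sandwich_closed[OF _ _ _ cz, of a' "z \<otimes> b"]
  note cl' = sandwich_closed[OF _ _ _ cz, of a' "z \<otimes> b \<otimes> c"]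
  note cm = sandwich_closed[OF _ _ _ m, of a b] and cm' = sandwich_closed[OF _ _ _ m, of a "b \<otimes> c"]
  have 1: "r (l e (sandwich m a b)) c =
    sm (transport_scalar g e a b a' z \<otimes>\<^bsub>K\<^esub> right_scalar g a' (z \<otimes> b) c) (sandwich (ad z m) a' (z \<otimes> b \<otimes> c))"
    using l_sandwich_ad[OF _ _ _ _ _ _ ea m, of b] r_sm[OF _ _ _ _ cl] r_sandwich[OF _ _ _ _ cz, of a' "z \<otimes> b" c]
      sm_sm[OF _ _ _ _ cl'] by simp
  have "r (l e (sandwich m a b)) c =
      sm (\<Phi> e (a \<otimes> b) c \<otimes>\<^bsub>K\<^esub> inv\<^bsub>K\<^esub> \<Phi> e (a \<otimes> g \<otimes> b) c) (l e (r (sandwich m a b) c))"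
    using l_r[OF _ _ _ _ cm, of e c] by simp
  also have "l e (r (sandwich m a b) c) =
      sm (right_scalar g a b c) (sm (transport_scalar g e a (b \<otimes> c) a' z) (sandwich (ad z m) a' (z \<otimes> b \<otimes> c)))"
    using r_sandwich[OF _ _ _ _ m, of a b c] l_sm[OF _ _ _ _ cm'] l_sandwich_ad[OF _ _ _ _ _ _ ea m, of "b \<otimes> c"]
    by (simp add: G.m_assoc)
  finally show ?thesis using 1 sm_sm[OF _ _ _ _ cl'] by simp
qed

text \<open>The composite of three adjoint actions, bracketed in two ways.\<close>

lemma Phi_tilde_cocycle_sm:
  assumes [simp]: "g \<in> carrier G" "x \<in> carrier G" "y \<in> carrier G" "z \<in> carrier G"
    and z: "z \<otimes> g = g \<otimes> z" and m: "m \<in> H g \<one>"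
  shows "sm (Phi_tilde K G \<Phi> x y g \<otimes>\<^bsub>K\<^esub> Phi_tilde K G \<Phi> (x \<otimes> y) z g) (ad (x \<otimes> y \<otimes> z) m) =
    sm (Phi_tilde K G \<Phi> x (y \<otimes> z) g \<otimes>\<^bsub>K\<^esub> Phi_tilde K G \<Phi> y z g) (ad (x \<otimes> y \<otimes> z) m)"
proof -
  note cz = ad_centralizer[OF _ _ z m, simplified]
  note c = ad_closed[OF _ _ m, of "x \<otimes> y \<otimes> z"] and c' = ad_closed[OF _ _ m, of "y \<otimes> z"]
  have "ad x (ad y (ad z m)) =
    sm (Phi_tilde K G \<Phi> x y g \<otimes>\<^bsub>K\<^esub> Phi_tilde K G \<Phi> (x \<otimes> y) z g) (ad (x \<otimes> y \<otimes> z) m)"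
    using ad_mult[OF _ _ _ cz, of x y] ad_mult[OF _ _ _ m, of "x \<otimes> y" z] sm_sm[OF _ _ _ _ c] by simp
  moreover have "ad x (ad y (ad z m)) =
    sm (Phi_tilde K G \<Phi> x (y \<otimes> z) g \<otimes>\<^bsub>K\<^esub> Phi_tilde K G \<Phi> y z g) (ad (x \<otimes> y \<otimes> z) m)"
    using ad_mult[OF _ _ _ m, of y z] ad_sm[OF _ _ _ _ c'] ad_mult[OF _ _ _ m, of x "y \<otimes> z"]
      sm_sm[OF _ _ _ _ c] by (simp add: K.m_comm G.m_assoc)
  ultimately show ?thesis by simp
qed

end

section \<open>The free bimodule on one homogeneous generator\<close>

context three_cocycle
begin

text \<open>The triple \<open>(s, a, b)\<close> stands for \<open>s\<close> times \<open>(a.u).b\<close>, where \<open>u\<close> is a free generator of bidegree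
\<open>(g, \<one>)\<close>.\<close>

definition free_part :: "'g \<Rightarrow> 'g \<Rightarrow> 'g \<Rightarrow> ('k \<times> 'g \<times> 'g) set" where
  "free_part g x y = {(s, a, b). s \<in> Units K \<and> a \<in> carrier G \<and> b \<in> carrier G \<and> a \<otimes> g \<otimes> b = x \<and> a \<otimes> b = y}"

text \<open>The cocycle condition at \<open>(e, f, a, b)\<close>, \<open>(e, f, a g, b)\<close> and \<open>(e, f, a, g)\<close>.\<close>

lemma left_scalar_mult:
  assumes [simp]: "g \<in> carrier G" "a \<in> carrier G" "b \<in> carrier G" "e \<in> carrier G" "f \<in> carrier G"
  shows "left_scalar g e (f \<otimes> a) b \<otimes>\<^bsub>K\<^esub> left_scalar g f a b =
    \<Phi> e f (a \<otimes> g \<otimes> b) \<otimes>\<^bsub>K\<^esub> inv\<^bsub>K\<^esub> \<Phi> e f (a \<otimes> b) \<otimes>\<^bsub>K\<^esub> left_scalar g (e \<otimes> f) a b"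
proof -
  let ?A1 = "\<Phi> e f a" and ?B1 = "\<Phi> e f (a \<otimes> g)"
  let ?A2 = "\<Phi> e (f \<otimes> a) b" and ?A3 = "\<Phi> f a b" and ?A4 = "\<Phi> (e \<otimes> f) a b" and ?A5 = "\<Phi> e f (a \<otimes> b)"
  let ?B2 = "\<Phi> e (f \<otimes> (a \<otimes> g)) b" and ?B3 = "\<Phi> f (a \<otimes> g) b" and ?B4 = "\<Phi> (e \<otimes> f) (a \<otimes> g) b"
    and ?B5 = "\<Phi> e f (a \<otimes> g \<otimes> b)"
  let ?C2 = "\<Phi> e (f \<otimes> a) g" and ?C3 = "\<Phi> f a g" and ?C4 = "\<Phi> (e \<otimes> f) a g"
  have A: "?A1 \<otimes>\<^bsub>K\<^esub> ?A2 \<otimes>\<^bsub>K\<^esub> ?A3 = ?A4 \<otimes>\<^bsub>K\<^esub> ?A5" by (rule Phi_cocycle) simp_all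
  have B: "?B1 \<otimes>\<^bsub>K\<^esub> ?B2 \<otimes>\<^bsub>K\<^esub> ?B3 = ?B4 \<otimes>\<^bsub>K\<^esub> ?B5" by (rule Phi_cocycle) simp_all
  have C: "?A1 \<otimes>\<^bsub>K\<^esub> ?C2 \<otimes>\<^bsub>K\<^esub> ?C3 = ?C4 \<otimes>\<^bsub>K\<^esub> ?B1" by (rule Phi_cocycle) simp_all
  have "(?A1 \<otimes>\<^bsub>K\<^esub> ?B1) \<otimes>\<^bsub>K\<^esub> (?B2 \<otimes>\<^bsub>K\<^esub> ?C2 \<otimes>\<^bsub>K\<^esub> ?B3 \<otimes>\<^bsub>K\<^esub> ?C3 \<otimes>\<^bsub>K\<^esub> (?A4 \<otimes>\<^bsub>K\<^esub> ?A5)) =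
      (?A1 \<otimes>\<^bsub>K\<^esub> ?C2 \<otimes>\<^bsub>K\<^esub> ?C3) \<otimes>\<^bsub>K\<^esub> (?B1 \<otimes>\<^bsub>K\<^esub> ?B2 \<otimes>\<^bsub>K\<^esub> ?B3) \<otimes>\<^bsub>K\<^esub> (?A4 \<otimes>\<^bsub>K\<^esub> ?A5)"
    by (simp add: K.m_ac)
  also have "\<dots> = (?A1 \<otimes>\<^bsub>K\<^esub> ?B1) \<otimes>\<^bsub>K\<^esub> (?B5 \<otimes>\<^bsub>K\<^esub> ?B4 \<otimes>\<^bsub>K\<^esub> ?C4 \<otimes>\<^bsub>K\<^esub> (?A2 \<otimes>\<^bsub>K\<^esub> ?A3))"
    unfolding C B A[symmetric] by (simp add: K.m_ac)
  finally have D: "?B2 \<otimes>\<^bsub>K\<^esub> ?C2 \<otimes>\<^bsub>K\<^esub> ?B3 \<otimes>\<^bsub>K\<^esub> ?C3 \<otimes>\<^bsub>K\<^esub> (?A4 \<otimes>\<^bsub>K\<^esub> ?A5) =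
      ?B5 \<otimes>\<^bsub>K\<^esub> ?B4 \<otimes>\<^bsub>K\<^esub> ?C4 \<otimes>\<^bsub>K\<^esub> (?A2 \<otimes>\<^bsub>K\<^esub> ?A3)"
    by (rule Units_l_cancel[rotated 3]) simp_all
  have "?B2 \<otimes>\<^bsub>K\<^esub> ?C2 \<otimes>\<^bsub>K\<^esub> ?B3 \<otimes>\<^bsub>K\<^esub> ?C3 \<otimes>\<^bsub>K\<^esub> inv\<^bsub>K\<^esub> (?A2 \<otimes>\<^bsub>K\<^esub> ?A3) =
      ?B5 \<otimes>\<^bsub>K\<^esub> ?B4 \<otimes>\<^bsub>K\<^esub> ?C4 \<otimes>\<^bsub>K\<^esub> inv\<^bsub>K\<^esub> (?A4 \<otimes>\<^bsub>K\<^esub> ?A5)"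
    by (rule quotient_eqI) (simp_all only: D, simp_all)
  then show ?thesis
    by (simp add: left_scalar_def inv_mult_Units K.m_ac G.m_assoc)
qed

text \<open>The cocycle condition at \<open>(a, b, c, d)\<close> and \<open>(a g, b, c, d)\<close>, in which the factor \<open>\<Phi> b c d\<close> cancels.\<close>

lemma right_scalar_mult:
  assumes [simp]: "g \<in> carrier G" "a \<in> carrier G" "b \<in> carrier G" "c \<in> carrier G" "d \<in> carrier G"
  shows "right_scalar g a b c \<otimes>\<^bsub>K\<^esub> right_scalar g a (b \<otimes> c) d =
    \<Phi> (a \<otimes> b) c d \<otimes>\<^bsub>K\<^esub> inv\<^bsub>K\<^esub> \<Phi> (a \<otimes> g \<otimes> b) c d \<otimes>\<^bsub>K\<^esub> right_scalar g a b (c \<otimes> d)"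
proof -
  let ?A1 = "\<Phi> a b c" and ?A2 = "\<Phi> a (b \<otimes> c) d" and ?C = "\<Phi> b c d" and ?A4 = "\<Phi> (a \<otimes> b) c d"
    and ?A5 = "\<Phi> a b (c \<otimes> d)"
  let ?B1 = "\<Phi> (a \<otimes> g) b c" and ?B2 = "\<Phi> (a \<otimes> g) (b \<otimes> c) d" and ?B4 = "\<Phi> (a \<otimes> g \<otimes> b) c d"
    and ?B5 = "\<Phi> (a \<otimes> g) b (c \<otimes> d)"
  have A: "?A1 \<otimes>\<^bsub>K\<^esub> ?A2 \<otimes>\<^bsub>K\<^esub> ?C = ?A4 \<otimes>\<^bsub>K\<^esub> ?A5" by (rule Phi_cocycle) simp_all
  have B: "?B1 \<otimes>\<^bsub>K\<^esub> ?B2 \<otimes>\<^bsub>K\<^esub> ?C = ?B4 \<otimes>\<^bsub>K\<^esub> ?B5" by (rule Phi_cocycle) simp_all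
  have "?C \<otimes>\<^bsub>K\<^esub> (?A1 \<otimes>\<^bsub>K\<^esub> ?A2 \<otimes>\<^bsub>K\<^esub> (?B4 \<otimes>\<^bsub>K\<^esub> ?B5)) = (?A1 \<otimes>\<^bsub>K\<^esub> ?A2 \<otimes>\<^bsub>K\<^esub> ?C) \<otimes>\<^bsub>K\<^esub> (?B4 \<otimes>\<^bsub>K\<^esub> ?B5)"
    by (simp add: K.m_ac)
  also have "\<dots> = ?C \<otimes>\<^bsub>K\<^esub> (?A4 \<otimes>\<^bsub>K\<^esub> ?A5 \<otimes>\<^bsub>K\<^esub> (?B1 \<otimes>\<^bsub>K\<^esub> ?B2))"
    unfolding A B[symmetric] by (simp add: K.m_ac)
  finally have D: "?A1 \<otimes>\<^bsub>K\<^esub> ?A2 \<otimes>\<^bsub>K\<^esub> (?B4 \<otimes>\<^bsub>K\<^esub> ?B5) = ?A4 \<otimes>\<^bsub>K\<^esub> ?A5 \<otimes>\<^bsub>K\<^esub> (?B1 \<otimes>\<^bsub>K\<^esub> ?B2)"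
    by (rule Units_l_cancel[rotated 3]) simp_all
  have "?A1 \<otimes>\<^bsub>K\<^esub> ?A2 \<otimes>\<^bsub>K\<^esub> inv\<^bsub>K\<^esub> (?B1 \<otimes>\<^bsub>K\<^esub> ?B2) = ?A4 \<otimes>\<^bsub>K\<^esub> ?A5 \<otimes>\<^bsub>K\<^esub> inv\<^bsub>K\<^esub> (?B4 \<otimes>\<^bsub>K\<^esub> ?B5)"
    by (rule quotient_eqI) (simp_all only: D, simp_all)
  then show ?thesis by (simp add: right_scalar_def inv_mult_Units K.m_ac)
qed

text \<open>The cocycle condition at \<open>(e, a, b, c)\<close> and \<open>(e, a g, b, c)\<close>.\<close>

lemma left_right_scalar:
  assumes [simp]: "g \<in> carrier G" "a \<in> carrier G" "b \<in> carrier G" "e \<in> carrier G" "c \<in> carrier G"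
  shows "right_scalar g (e \<otimes> a) b c \<otimes>\<^bsub>K\<^esub> left_scalar g e a b =
    \<Phi> e (a \<otimes> b) c \<otimes>\<^bsub>K\<^esub> inv\<^bsub>K\<^esub> \<Phi> e (a \<otimes> g \<otimes> b) c \<otimes>\<^bsub>K\<^esub> (left_scalar g e a (b \<otimes> c) \<otimes>\<^bsub>K\<^esub> right_scalar g a b c)"
proof -
  let ?A1 = "\<Phi> e a b" and ?A2 = "\<Phi> e (a \<otimes> b) c" and ?A3 = "\<Phi> a b c" and ?A4 = "\<Phi> (e \<otimes> a) b c"
    and ?A5 = "\<Phi> e a (b \<otimes> c)"
  let ?B1 = "\<Phi> e (a \<otimes> g) b" and ?B2 = "\<Phi> e (a \<otimes> g \<otimes> b) c" and ?B3 = "\<Phi> (a \<otimes> g) b c"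
    and ?B4 = "\<Phi> (e \<otimes> (a \<otimes> g)) b c" and ?B5 = "\<Phi> e (a \<otimes> g) (b \<otimes> c)" and ?C = "\<Phi> e a g"
  have A: "?A1 \<otimes>\<^bsub>K\<^esub> ?A2 \<otimes>\<^bsub>K\<^esub> ?A3 = ?A4 \<otimes>\<^bsub>K\<^esub> ?A5" by (rule Phi_cocycle) simp_all
  have B: "?B1 \<otimes>\<^bsub>K\<^esub> ?B2 \<otimes>\<^bsub>K\<^esub> ?B3 = ?B4 \<otimes>\<^bsub>K\<^esub> ?B5" by (rule Phi_cocycle) simp_all
  have "?A4 \<otimes>\<^bsub>K\<^esub> ?B1 \<otimes>\<^bsub>K\<^esub> ?C \<otimes>\<^bsub>K\<^esub> (?B2 \<otimes>\<^bsub>K\<^esub> ?A5 \<otimes>\<^bsub>K\<^esub> ?B3) = (?B1 \<otimes>\<^bsub>K\<^esub> ?B2 \<otimes>\<^bsub>K\<^esub> ?B3) \<otimes>\<^bsub>K\<^esub> (?A4 \<otimes>\<^bsub>K\<^esub> ?A5) \<otimes>\<^bsub>K\<^esub> ?C"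
    by (simp add: K.m_ac)
  also have "\<dots> = ?A2 \<otimes>\<^bsub>K\<^esub> ?B5 \<otimes>\<^bsub>K\<^esub> ?C \<otimes>\<^bsub>K\<^esub> ?A3 \<otimes>\<^bsub>K\<^esub> (?B4 \<otimes>\<^bsub>K\<^esub> ?A1)"
    unfolding A[symmetric] B by (simp add: K.m_ac)
  finally have D: "?A4 \<otimes>\<^bsub>K\<^esub> ?B1 \<otimes>\<^bsub>K\<^esub> ?C \<otimes>\<^bsub>K\<^esub> (?B2 \<otimes>\<^bsub>K\<^esub> ?A5 \<otimes>\<^bsub>K\<^esub> ?B3) =
    ?A2 \<otimes>\<^bsub>K\<^esub> ?B5 \<otimes>\<^bsub>K\<^esub> ?C \<otimes>\<^bsub>K\<^esub> ?A3 \<otimes>\<^bsub>K\<^esub> (?B4 \<otimes>\<^bsub>K\<^esub> ?A1)" .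
  have "?A4 \<otimes>\<^bsub>K\<^esub> ?B1 \<otimes>\<^bsub>K\<^esub> ?C \<otimes>\<^bsub>K\<^esub> inv\<^bsub>K\<^esub> (?B4 \<otimes>\<^bsub>K\<^esub> ?A1) =
      ?A2 \<otimes>\<^bsub>K\<^esub> ?B5 \<otimes>\<^bsub>K\<^esub> ?C \<otimes>\<^bsub>K\<^esub> ?A3 \<otimes>\<^bsub>K\<^esub> inv\<^bsub>K\<^esub> (?B2 \<otimes>\<^bsub>K\<^esub> ?A5 \<otimes>\<^bsub>K\<^esub> ?B3)"
    by (rule quotient_eqI) (simp_all only: D, simp_all)
  then show ?thesis by (simp add: right_scalar_def left_scalar_def inv_mult_Units K.m_ac G.m_assoc)
qed

lemma left_scalar_one [simp]: "\<lbrakk>g \<in> carrier G; a \<in> carrier G; b \<in> carrier G\<rbrakk> \<Longrightarrow> left_scalar g \<one> a b = \<one>\<^bsub>K\<^esub>"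
  and right_scalar_one [simp]: "\<lbrakk>g \<in> carrier G; a \<in> carrier G; b \<in> carrier G\<rbrakk> \<Longrightarrow> right_scalar g a b \<one> = \<one>\<^bsub>K\<^esub>"
  by (simp_all add: left_scalar_def right_scalar_def)

lemma homogeneous_action_free:
  assumes g [simp]: "g \<in> carrier G"
  shows "homogeneous_action K G \<Phi> (free_part g) (\<lambda>k (s, a, b). (k \<otimes>\<^bsub>K\<^esub> s, a, b))
    (\<lambda>e (s, a, b). (left_scalar g e a b \<otimes>\<^bsub>K\<^esub> s, e \<otimes> a, b)) (\<lambda>(s, a, b) c. (right_scalar g a b c \<otimes>\<^bsub>K\<^esub> s, a, b \<otimes> c))"
proof (unfold_locales, goal_cases)
  \<comment> \<open>Cases 10 to 12 are \<open>l_l\<close>, \<open>r_r\<close> and \<open>l_r\<close>, the only axioms that use the cocycle condition.\<close>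
  case (10 e f x h m)
  then show ?case using left_scalar_mult[OF g]
    by (auto simp: free_part_def G.m_assoc simp flip: K.m_assoc)
next
  case (11 e f x h m)
  then show ?case using right_scalar_mult[OF g]
    by (auto simp: free_part_def G.m_assoc K.m_comm[of "right_scalar g _ (_ \<otimes> _) _"] simp flip: K.m_assoc)
next
  case (12 e f x h m)
  then show ?case using left_right_scalar[OF g]
    by (auto simp: free_part_def G.m_assoc simp flip: K.m_assoc)
qed (auto simp: free_part_def G.m_assoc K.m_assoc K.m_lcomm)

text \<open>In the free model a multiple of a basis vector determines its factor, so the equations between
homogeneous elements become equations between scalars.\<close>

lemma
  assumes g [simp]: "g \<in> carrier G"
  shows transport_scalar_mult: "\<lbrakk>a \<in> carrier G; b \<in> carrier G; e \<in> carrier G; f \<in> carrier G;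
      a' \<in> carrier G; z \<in> carrier G; a'' \<in> carrier G; z' \<in> carrier G;
      e \<otimes> a = a' \<otimes> z; f \<otimes> a' = a'' \<otimes> z'; z \<otimes> g = g \<otimes> z; z' \<otimes> g = g \<otimes> z'\<rbrakk> \<Longrightarrow>
      transport_scalar g e a b a' z \<otimes>\<^bsub>K\<^esub> transport_scalar g f a' (z \<otimes> b) a'' z' \<otimes>\<^bsub>K\<^esub> Phi_tilde K G \<Phi> z' z g =
      \<Phi> f e (a \<otimes> g \<otimes> b) \<otimes>\<^bsub>K\<^esub> inv\<^bsub>K\<^esub> \<Phi> f e (a \<otimes> b) \<otimes>\<^bsub>K\<^esub> transport_scalar g (f \<otimes> e) a b a'' (z' \<otimes> z)"
    and transport_right_scalar: "\<lbrakk>a \<in> carrier G; b \<in> carrier G; e \<in> carrier G; a' \<in> carrier G; z \<in> carrier G;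
      c \<in> carrier G; e \<otimes> a = a' \<otimes> z; z \<otimes> g = g \<otimes> z\<rbrakk> \<Longrightarrow>
      transport_scalar g e a b a' z \<otimes>\<^bsub>K\<^esub> right_scalar g a' (z \<otimes> b) c =
      \<Phi> e (a \<otimes> b) c \<otimes>\<^bsub>K\<^esub> inv\<^bsub>K\<^esub> \<Phi> e (a \<otimes> g \<otimes> b) c \<otimes>\<^bsub>K\<^esub> (right_scalar g a b c \<otimes>\<^bsub>K\<^esub> transport_scalar g e a (b \<otimes> c) a' z)"
    and Phi_tilde_cocycle: "\<lbrakk>x \<in> carrier G; y \<in> carrier G; z \<in> carrier G; z \<otimes> g = g \<otimes> z\<rbrakk> \<Longrightarrow>
      Phi_tilde K G \<Phi> x y g \<otimes>\<^bsub>K\<^esub> Phi_tilde K G \<Phi> (x \<otimes> y) z g =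
      Phi_tilde K G \<Phi> x (y \<otimes> z) g \<otimes>\<^bsub>K\<^esub> Phi_tilde K G \<Phi> y z g"
proof -
  interpret F: homogeneous_action K G \<Phi> "free_part g" "\<lambda>k (s, a, b). (k \<otimes>\<^bsub>K\<^esub> s, a, b)"
    "\<lambda>e (s, a, b). (left_scalar g e a b \<otimes>\<^bsub>K\<^esub> s, e \<otimes> a, b)" "\<lambda>(s, a, b) c. (right_scalar g a b c \<otimes>\<^bsub>K\<^esub> s, a, b \<otimes> c)"
    by (rule homogeneous_action_free) simp
  have u: "(\<one>\<^bsub>K\<^esub>, \<one>, \<one>) \<in> free_part g g \<one>" by (simp add: free_part_def)
  have cancel: "j = k" if jk: "p \<in> free_part g x y" "j \<in> Units K" "k \<in> Units K"
    "(case p of (s, a, b) \<Rightarrow> (j \<otimes>\<^bsub>K\<^esub> s, a, b)) = (case p of (s, a, b) \<Rightarrow> (k \<otimes>\<^bsub>K\<^esub> s, a, b))" for p x y j k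
  proof -
    obtain s where "s \<in> Units K" "j \<otimes>\<^bsub>K\<^esub> s = k \<otimes>\<^bsub>K\<^esub> s"
      using jk(1,4) by (auto simp: free_part_def)
    then show ?thesis
      using Units_l_cancel[of s j k] jk(2,3) by (simp add: K.m_comm)
  qed
  show "transport_scalar g e a b a' z \<otimes>\<^bsub>K\<^esub> transport_scalar g f a' (z \<otimes> b) a'' z' \<otimes>\<^bsub>K\<^esub> Phi_tilde K G \<Phi> z' z g =
      \<Phi> f e (a \<otimes> g \<otimes> b) \<otimes>\<^bsub>K\<^esub> inv\<^bsub>K\<^esub> \<Phi> f e (a \<otimes> b) \<otimes>\<^bsub>K\<^esub> transport_scalar g (f \<otimes> e) a b a'' (z' \<otimes> z)"
    if "a \<in> carrier G" "b \<in> carrier G" "e \<in> carrier G" "f \<in> carrier G"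
      "a' \<in> carrier G" "z \<in> carrier G" "a'' \<in> carrier G" "z' \<in> carrier G"
      "e \<otimes> a = a' \<otimes> z" "f \<otimes> a' = a'' \<otimes> z'" "z \<otimes> g = g \<otimes> z" "z' \<otimes> g = g \<otimes> z'"
  proof -
    have zz: "z' \<otimes> z \<otimes> g = g \<otimes> (z' \<otimes> z)" using that g by (metis G.m_assoc)
    show ?thesis
      by (rule cancel[OF F.sandwich_closed[OF _ _ _ F.ad_centralizer[OF _ _ zz u]] _ _
            F.transport_scalar_mult_sm[OF g that u]]) (use that in simp_all)
  qed
  show "transport_scalar g e a b a' z \<otimes>\<^bsub>K\<^esub> right_scalar g a' (z \<otimes> b) c =
      \<Phi> e (a \<otimes> b) c \<otimes>\<^bsub>K\<^esub> inv\<^bsub>K\<^esub> \<Phi> e (a \<otimes> g \<otimes> b) c \<otimes>\<^bsub>K\<^esub> (right_scalar g a b c \<otimes>\<^bsub>K\<^esub> transport_scalar g e a (b \<otimes> c) a' z)"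
    if "a \<in> carrier G" "b \<in> carrier G" "e \<in> carrier G" "a' \<in> carrier G" "z \<in> carrier G"
      "c \<in> carrier G" "e \<otimes> a = a' \<otimes> z" "z \<otimes> g = g \<otimes> z"
    by (rule cancel[OF F.sandwich_closed[OF _ _ _ F.ad_centralizer[OF _ _ that(8) u]] _ _
          F.transport_right_scalar_sm[OF g that u]]) (use that in simp_all)
  show "Phi_tilde K G \<Phi> x y g \<otimes>\<^bsub>K\<^esub> Phi_tilde K G \<Phi> (x \<otimes> y) z g =
      Phi_tilde K G \<Phi> x (y \<otimes> z) g \<otimes>\<^bsub>K\<^esub> Phi_tilde K G \<Phi> y z g"
    if "x \<in> carrier G" "y \<in> carrier G" "z \<in> carrier G" "z \<otimes> g = g \<otimes> z"
    by (rule cancel[OF F.ad_closed[OF _ _ u] _ _ F.Phi_tilde_cocycle_sm[OF g that u]])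
      (use that in simp_all)
qed

lemma transport_scalar_one [simp]:
  assumes "g \<in> carrier G" "a \<in> carrier G" "b \<in> carrier G"
  shows "transport_scalar g \<one> a b a \<one> = \<one>\<^bsub>K\<^esub>"
  using assms by (simp add: transport_scalar_def conj_scalar_def right_scalar_def left_scalar_def)

text \<open>The cocycle condition at \<open>(g, z, z\<inverse>, z)\<close>. The two scalars arise when the adjoint action of \<open>z\<close> on an
element of bidegree \<open>(g, \<one>)\<close> is computed as a left transport followed by a right action, so together they
have to give \<open>\<one>\<close>.\<close>

lemma transport_right_scalar_one:
  assumes [simp]: "g \<in> carrier G" "z \<in> carrier G" and z: "z \<otimes> g = g \<otimes> z"
  shows "transport_scalar g z \<one> \<one> \<one> z \<otimes>\<^bsub>K\<^esub> right_scalar g \<one> z (inv z) = \<one>\<^bsub>K\<^esub>"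
proof -
  have "\<Phi> g z (inv z) \<otimes>\<^bsub>K\<^esub> \<Phi> z (inv z) z = \<Phi> (z \<otimes> g) (inv z) z"
    using Phi_cocycle[of g z "inv z" z] z by simp
  then have "inv\<^bsub>K\<^esub> \<Phi> g z (inv z) \<otimes>\<^bsub>K\<^esub> inv\<^bsub>K\<^esub> \<Phi> z (inv z) z \<otimes>\<^bsub>K\<^esub> \<Phi> (z \<otimes> g) (inv z) z = \<one>\<^bsub>K\<^esub>"
    using K.Units_l_inv[of "\<Phi> (z \<otimes> g) (inv z) z"]
      inv_mult_Units[of "\<Phi> g z (inv z)" "\<Phi> z (inv z) z", symmetric] by (simp del: K.Units_l_inv)
  then show ?thesis
    by (simp add: transport_scalar_def conj_scalar_def right_scalar_def left_scalar_def inv_mult_Units K.m_ac)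
qed

lemma Phi_tilde_one [simp]:
  assumes "f \<in> carrier G" "g \<in> carrier G"
  shows "Phi_tilde K G \<Phi> \<one> f g = \<one>\<^bsub>K\<^esub>" "Phi_tilde K G \<Phi> f \<one> g = \<one>\<^bsub>K\<^esub>"
  using assms by (simp_all add: Phi_tilde_def)

end

section \<open>Concrete categories and linear maps\<close>

lemma category_concrete:
  fixes c :: "'o \<Rightarrow> 'v set"
  assumes id: "\<And>X. X \<in> Ob \<Longrightarrow> restrict id (c X) \<in> A X X"
    and comp: "\<And>X Y Z f g. \<lbrakk>X \<in> Ob; Y \<in> Ob; Z \<in> Ob; f \<in> A X Y; g \<in> A Y Z\<rbrakk> \<Longrightarrow> compose (c X) g f \<in> A X Z"
    and ext: "\<And>X Y. A X Y \<subseteq> c X \<rightarrow>\<^sub>E c Y"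
  shows "category \<lparr>obj = Ob, arr = A, ident = (\<lambda>X. restrict id (c X)), cmp = (\<lambda>X Y Z g f. compose (c X) g f)\<rparr>" (is "category ?C")
proof
  fix X Y f
  assume "f \<in> arr ?C X Y"
  then have "f \<in> c X \<rightarrow>\<^sub>E c Y" using ext by auto
  then show "cmp ?C X X Y f
      (ident ?C X) = f"
    and "cmp ?C X Y Y
      (ident ?C Y) f = f"
    by (auto simp: compose_def PiE_iff restrict_def fun_eq_iff extensional_def)
next
  fix W X Y Z f g h
  assume "f \<in> arr ?C W X"
  then have "f \<in> c W \<rightarrow>\<^sub>E c X" using ext by auto
  then show "cmp ?C W Y Z h
      (cmp ?C W X Y g f) =
    cmp ?C W X Z
      (cmp ?C X Y Z h g) f"
    by (auto simp: compose_def PiE_iff restrict_def fun_eq_iff extensional_def)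
qed (use id comp in simp_all)

lemma linear_maps_closed: "\<lbrakk>f \<in> linear_maps R M N; x \<in> carrier M\<rbrakk> \<Longrightarrow> f x \<in> carrier N"
  and linear_maps_add: "\<lbrakk>f \<in> linear_maps R M N; x \<in> carrier M; y \<in> carrier M\<rbrakk> \<Longrightarrow>
    f (x \<oplus>\<^bsub>M\<^esub> y) = f x \<oplus>\<^bsub>N\<^esub> f y"
  and linear_maps_smult: "\<lbrakk>f \<in> linear_maps R M N; a \<in> carrier R; x \<in> carrier M\<rbrakk> \<Longrightarrow>
    f (a \<odot>\<^bsub>M\<^esub> x) = a \<odot>\<^bsub>N\<^esub> f x"
  by (auto simp: linear_maps_def)

lemma linear_maps_zero:
  assumes "f \<in> linear_maps R M N" "abelian_group M" "abelian_group N"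
  shows "f \<zero>\<^bsub>M\<^esub> = \<zero>\<^bsub>N\<^esub>"
proof -
  interpret M: abelian_group M by fact
  interpret N: abelian_group N by fact
  have "f \<zero>\<^bsub>M\<^esub> \<oplus>\<^bsub>N\<^esub> f \<zero>\<^bsub>M\<^esub> = f \<zero>\<^bsub>M\<^esub>"
    using linear_maps_add[OF assms(1), of "\<zero>\<^bsub>M\<^esub>" "\<zero>\<^bsub>M\<^esub>"] by simp
  then show ?thesis
    using linear_maps_closed[OF assms(1) M.zero_closed] N.add.r_cancel_one' by metis
qed

lemma additive_finsum:
  assumes f: "\<And>x. x \<in> carrier M \<Longrightarrow> f x \<in> carrier N"
      "\<And>x y. \<lbrakk>x \<in> carrier M; y \<in> carrier M\<rbrakk> \<Longrightarrow> f (x \<oplus>\<^bsub>M\<^esub> y) = f x \<oplus>\<^bsub>N\<^esub> f y"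
    and M: "abelian_group M" and N: "abelian_group N" and S: "finite S" "h \<in> S \<rightarrow> carrier M"
  shows "f (finsum M h S) = finsum N (\<lambda>s. f (h s)) S"
proof -
  interpret M: abelian_group M by fact
  interpret N: abelian_group N by fact
  have "f \<zero>\<^bsub>M\<^esub> \<oplus>\<^bsub>N\<^esub> f \<zero>\<^bsub>M\<^esub> = f \<zero>\<^bsub>M\<^esub>" using f(2)[of "\<zero>\<^bsub>M\<^esub>" "\<zero>\<^bsub>M\<^esub>"] by simp
  then have z: "f \<zero>\<^bsub>M\<^esub> = \<zero>\<^bsub>N\<^esub>" using f(1)[OF M.zero_closed] N.add.r_cancel_one' by metis
  show ?thesis using S
  proof (induction S rule: finite_induct)
    case empty
    then show ?case using z by simp
  next
    case (insert x S)
    then show ?case using f by (simp add: M.finsum_closed Pi_iff)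
  qed
qed

lemma linear_maps_finsum:
  assumes f: "f \<in> linear_maps R M N" and "abelian_group M" "abelian_group N"
    and "finite S" "h \<in> S \<rightarrow> carrier M"
  shows "f (finsum M h S) = finsum N (\<lambda>s. f (h s)) S"
  by (rule additive_finsum[OF linear_maps_closed[OF f] linear_maps_add[OF f] assms(2-)])

lemma linear_maps_compose:
  "\<lbrakk>f \<in> linear_maps R L M; g \<in> linear_maps R M N\<rbrakk> \<Longrightarrow> (\<lambda>x. g (f x)) \<in> linear_maps R L N"
  by (auto simp: linear_maps_def Pi_iff)

lemma linear_maps_compose_restrict:
  assumes "module R L" "f \<in> linear_maps R L M" "g \<in> linear_maps R M N"
  shows "compose (carrier L) g f \<in> linear_maps R L N"
proof -
  interpret module R L by fact
  show ?thesis using assms(2,3) by (auto simp: linear_maps_def compose_def Pi_iff)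
qed

lemma linear_maps_id:
  assumes "module R L" shows "restrict id (carrier L) \<in> linear_maps R L L"
proof -
  interpret module R L by fact
  show ?thesis by (auto simp: linear_maps_def)
qed

lemma category_proj_rep: "category (proj_rep_category K Z \<alpha>)"
  unfolding proj_rep_category_def
proof (rule category_concrete, goal_cases)
  case (1 X)
  then interpret projective_representation K X Z \<alpha> by simp
  have "rho X z v \<in> carrier X" if "z \<in> carrier Z" "v \<in> carrier X" for z v
    using rho_GL[OF that(1)] that(2) by (auto simp: GL_def linear_maps_def)
  then show ?case using linear_maps_id[OF module_axioms] by (auto simp: proj_rep_homs_def)
next
  case (2 X Y Z' f g)
  then interpret projective_representation K X Z \<alpha> by simp
  have "rho X z v \<in> carrier X" if "z \<in> carrier Z" "v \<in> carrier X" for z v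
    using rho_GL[OF that(1)] that(2) by (auto simp: GL_def linear_maps_def)
  then show ?case using 2 linear_maps_compose_restrict[OF module_axioms, of f Y g Z']
    by (auto simp: proj_rep_homs_def compose_eq linear_maps_closed)
qed (auto simp: proj_rep_homs_def linear_maps_def PiE_def)

lemma category_left_module: "category (left_module_category R)"
  unfolding left_module_category_def
proof (rule category_concrete, goal_cases)
  case (1 X)
  then interpret left_module R X by simp
  show ?case by (auto simp: linear_maps_def smult_closed)
next
  case (2 X Y Z f g)
  then interpret left_module R X by simp
  show ?case using 2 by (auto simp: linear_maps_def smult_closed compose_def Pi_iff)
qed (auto simp: linear_maps_def PiE_def)

lemma coaction_closed:
  "\<lbrakk>kG_coaction K G M \<delta>; m \<in> carrier M; x \<in> carrier G\<rbrakk> \<Longrightarrow> \<delta> m x \<in> carrier M"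
  by (auto simp: kG_coaction_def tensor_kG_def)

lemma Majid_homsD:
  assumes "\<phi> \<in> Majid_homs K G M N"
  shows "\<phi> \<in> linear_maps K M N" "\<phi> \<in> extensional (carrier M)"
    "\<lbrakk>m \<in> carrier M; x \<in> carrier G\<rbrakk> \<Longrightarrow> lcoact N (\<phi> m) x = \<phi> (lcoact M m x)"
    "\<lbrakk>m \<in> carrier M; x \<in> carrier G\<rbrakk> \<Longrightarrow> rcoact N (\<phi> m) x = \<phi> (rcoact M m x)"
    "\<lbrakk>m \<in> carrier M; x \<in> carrier G\<rbrakk> \<Longrightarrow> \<phi> (lact M x m) = lact N x (\<phi> m)"
    "\<lbrakk>m \<in> carrier M; x \<in> carrier G\<rbrakk> \<Longrightarrow> \<phi> (ract M m x) = ract N (\<phi> m) x"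
  using assms unfolding Majid_homs_def by simp_all

lemma category_Majid: "category (Majid_category K G \<Phi>)"
  unfolding Majid_category_def
proof (rule category_concrete, goal_cases)
  case (1 X)
  then interpret Majid_bimodule K X G \<Phi> by simp
  show ?case using linear_maps_id[OF module_axioms]
    by (simp add: Majid_homs_def coaction_closed[OF lcoaction] coaction_closed[OF rcoaction]
        linear_maps_closed[OF lact_linear] linear_maps_closed[OF ract_linear])
next
  case (2 X Y Z f g)
  then interpret Majid_bimodule K X G \<Phi> by simp
  note f = Majid_homsD[OF 2(4)] and g = Majid_homsD[OF 2(5)]
  have fc: "m \<in> carrier X \<Longrightarrow> f m \<in> carrier Y" for m by (rule linear_maps_closed[OF f(1)])
  show ?case
    unfolding Majid_homs_def
  proof (intro CollectI conjI ballI IntI)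
    show "compose (carrier X) g f \<in> linear_maps K X Z"
      using linear_maps_compose_restrict[OF module_axioms f(1) g(1)] .
    fix m x assume mx: "m \<in> carrier X" "x \<in> carrier G"
    have [simp]: "lcoact X m x \<in> carrier X" "rcoact X m x \<in> carrier X" "lact X x m \<in> carrier X" "ract X m x \<in> carrier X"
      using coaction_closed[OF lcoaction mx] coaction_closed[OF rcoaction mx]
        linear_maps_closed[OF lact_linear mx(1)] linear_maps_closed[OF ract_linear mx(1)] mx(2) by auto
    show "lcoact Z (compose (carrier X) g f m) x = compose (carrier X) g f (lcoact X m x)"
      using g(3)[OF fc[OF mx(1)] mx(2)] f(3)[OF mx] mx(1) by (simp add: compose_eq)
    show "rcoact Z (compose (carrier X) g f m) x = compose (carrier X) g f (rcoact X m x)"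
      using g(4)[OF fc[OF mx(1)] mx(2)] f(4)[OF mx] mx(1) by (simp add: compose_eq)
    show "compose (carrier X) g f (lact X x m) = lact Z x (compose (carrier X) g f m)"
      using g(5)[OF fc[OF mx(1)] mx(2)] f(5)[OF mx] mx(1) by (simp add: compose_eq)
    show "compose (carrier X) g f (ract X m x) = ract Z (compose (carrier X) g f m) x"
      using g(6)[OF fc[OF mx(1)] mx(2)] f(6)[OF mx] mx(1) by (simp add: compose_eq)
  qed simp
next
  case (3 X Y)
  show ?case
  proof
    fix \<phi> assume "\<phi> \<in> Majid_homs K G X Y"
    note \<phi> = Majid_homsD(1,2)[OF this]
    show "\<phi> \<in> carrier X \<rightarrow>\<^sub>E carrier Y"
      using \<phi>(2) linear_maps_closed[OF \<phi>(1)] by (simp add: PiE_iff)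
  qed
qed


section \<open>Bijectivity of homogeneous actions\<close>

context homogeneous_action
begin

lemma sm_inv: "\<lbrakk>k \<in> Units K; g \<in> carrier G; h \<in> carrier G; m \<in> H g h\<rbrakk> \<Longrightarrow> sm (inv\<^bsub>K\<^esub> k) (sm k m) = m"
  by (simp add: sm_sm[of _ _ g h] sm_one[of g h])

lemma sm_inj: "\<lbrakk>k \<in> Units K; g \<in> carrier G; h \<in> carrier G; m \<in> H g h; n \<in> H g h; sm k m = sm k n\<rbrakk> \<Longrightarrow> m = n"
  by (metis sm_inv)

text \<open>By \<open>l_l\<close>, the action of \<open>inv e\<close> inverts that of \<open>e\<close> up to a unit.\<close>

lemma l_bij:
  assumes [simp]: "e \<in> carrier G" "g \<in> carrier G" "h \<in> carrier G"
  shows "bij_betw (l e) (H g h) (H (e \<otimes> g) (e \<otimes> h))"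
proof (rule bij_betwI')
  have inj: "m = n" if mn: "m \<in> H g' h'" "n \<in> H g' h'" "l f m = l f n" "f \<in> carrier G" "g' \<in> carrier G" "h' \<in> carrier G"
    for m n f g' h'
    using l_l[OF _ mn(4,5,6,1), of "inv f"] l_l[OF _ mn(4,5,6,2), of "inv f"] mn
    by (intro sm_inj[of "\<Phi> (inv f) f g' \<otimes>\<^bsub>K\<^esub> inv\<^bsub>K\<^esub> \<Phi> (inv f) f h'" g' h' m n])
      (simp_all add: l_one[of g' h'])
  fix m n assume m: "m \<in> H g h" and n: "n \<in> H g h"
  show "l e m = l e n \<longleftrightarrow> m = n" using inj[OF m n] by auto
  show "l e m \<in> H (e \<otimes> g) (e \<otimes> h)" using l_closed m by simp
next
  fix n assume n: "n \<in> H (e \<otimes> g) (e \<otimes> h)"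
  let ?k = "\<Phi> e (inv e) (e \<otimes> g) \<otimes>\<^bsub>K\<^esub> inv\<^bsub>K\<^esub> \<Phi> e (inv e) (e \<otimes> h)"
  have 1: "l (inv e) n \<in> H g h" using l_closed[OF _ _ _ n, of "inv e"] by (simp flip: G.m_assoc)
  have "l e (l (inv e) n) = sm ?k n"
    using l_l[OF _ _ _ _ n, of e "inv e"] n by (simp add: l_one[of "e \<otimes> g" "e \<otimes> h"])
  then have "l e (sm (inv\<^bsub>K\<^esub> ?k) (l (inv e) n)) = n"
    using l_sm[OF _ _ _ _ 1] sm_inv[OF _ _ _ n] by simp
  from this[symmetric] have "n = l e (sm (inv\<^bsub>K\<^esub> ?k) (l (inv e) n))" .
  moreover have "sm (inv\<^bsub>K\<^esub> ?k) (l (inv e) n) \<in> H g h" using 1 sm_closed by simp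
  ultimately show "\<exists>m\<in>H g h. n = l e m" by (rule bexI)
qed

lemma r_bij:
  assumes [simp]: "e \<in> carrier G" "g \<in> carrier G" "h \<in> carrier G"
  shows "bij_betw (\<lambda>m. r m e) (H g h) (H (g \<otimes> e) (h \<otimes> e))"
proof (rule bij_betwI')
  have inj: "m = n" if mn: "m \<in> H g' h'" "n \<in> H g' h'" "r m f = r n f" "f \<in> carrier G" "g' \<in> carrier G" "h' \<in> carrier G"
    for m n f g' h'
    using r_r[OF mn(4) _ mn(5,6,1), of "inv f"] r_r[OF mn(4) _ mn(5,6,2), of "inv f"] mn
    by (intro sm_inj[of "\<Phi> h' f (inv f) \<otimes>\<^bsub>K\<^esub> inv\<^bsub>K\<^esub> \<Phi> g' f (inv f)" g' h' m n])
      (simp_all add: r_one[of g' h'])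
  fix m n assume m: "m \<in> H g h" and n: "n \<in> H g h"
  show "r m e = r n e \<longleftrightarrow> m = n" using inj[OF m n] by auto
  show "r m e \<in> H (g \<otimes> e) (h \<otimes> e)" using r_closed m by simp
next
  fix n assume n: "n \<in> H (g \<otimes> e) (h \<otimes> e)"
  let ?k = "\<Phi> (h \<otimes> e) (inv e) e \<otimes>\<^bsub>K\<^esub> inv\<^bsub>K\<^esub> \<Phi> (g \<otimes> e) (inv e) e"
  have 1: "r n (inv e) \<in> H g h" using r_closed[OF _ _ _ n, of "inv e"] by (simp add: G.m_assoc)
  have "r (r n (inv e)) e = sm ?k n"
    using r_r[OF _ _ _ _ n, of "inv e" e] n by (simp add: r_one[of "g \<otimes> e" "h \<otimes> e"])
  then have "r (sm (inv\<^bsub>K\<^esub> ?k) (r n (inv e))) e = n"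
    using r_sm[OF _ _ _ _ 1] sm_inv[OF _ _ _ n] by simp
  from this[symmetric] have "n = r (sm (inv\<^bsub>K\<^esub> ?k) (r n (inv e))) e" .
  moreover have "sm (inv\<^bsub>K\<^esub> ?k) (r n (inv e)) \<in> H g h" using 1 sm_closed by simp
  ultimately show "\<exists>m\<in>H g h. n = r m e" by (rule bexI)
qed

lemma sandwich_bij:
  assumes "g \<in> carrier G" "a \<in> carrier G" "b \<in> carrier G"
  shows "bij_betw (\<lambda>m. sandwich m a b) (H g \<one>) (H (a \<otimes> g \<otimes> b) (a \<otimes> b))"
  using bij_betw_trans[OF l_bij[of a g \<one>] r_bij[of b "a \<otimes> g" "a \<otimes> \<one>"]] assms
  by (simp add: comp_def sandwich_def)

lemma sandwich_one: "\<lbrakk>g \<in> carrier G; m \<in> H g \<one>\<rbrakk> \<Longrightarrow> sandwich m \<one> \<one> = m"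
  by (simp add: sandwich_def l_one[of g \<one>] r_one[of g \<one>])

lemma ad_bij:
  assumes "g \<in> carrier G" "z \<in> carrier G" "z \<otimes> g = g \<otimes> z"
  shows "bij_betw (ad z) (H g \<one>) (H g \<one>)"
proof -
  have "z \<otimes> g \<otimes> inv z = g" unfolding assms(3) using assms(1,2) by (simp add: G.m_assoc)
  moreover have "ad z = (\<lambda>m. sandwich m z (inv z))" by (rule ext) (simp only: ad_def sandwich_def)
  ultimately show ?thesis using sandwich_bij[of g z "inv z"] assms(1,2) by simp
qed

end


section \<open>The bigrading of a Majid bimodule\<close>

locale majid = three_cocycle K G \<Phi> + Mb: Majid_bimodule K M G \<Phi>
  for K :: "('k, 'r) ring_scheme" and G :: "('g, 's) monoid_scheme" (structure)
    and \<Phi> :: "'g \<Rightarrow> 'g \<Rightarrow> 'g \<Rightarrow> 'k" and M :: "('k, 'v, 'g) majid_bimodule"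
begin

lemmas ab = Mb.M.abelian_group_axioms

abbreviation "part \<equiv> bigraded_part M"

lemma partD: "m \<in> part g h \<Longrightarrow> m \<in> carrier M"
  by (simp add: bigraded_part_def)

lemma lact_zero [simp]: "e \<in> carrier G \<Longrightarrow> lact M e \<zero>\<^bsub>M\<^esub> = \<zero>\<^bsub>M\<^esub>"
  and ract_zero [simp]: "e \<in> carrier G \<Longrightarrow> ract M \<zero>\<^bsub>M\<^esub> e = \<zero>\<^bsub>M\<^esub>"
  using linear_maps_zero[OF Mb.lact_linear ab ab] linear_maps_zero[OF Mb.ract_linear ab ab] by auto

lemma coact_linear:
  "x \<in> carrier G \<Longrightarrow> (\<lambda>m. lcoact M m x) \<in> linear_maps K M M"
  "x \<in> carrier G \<Longrightarrow> (\<lambda>m. rcoact M m x) \<in> linear_maps K M M"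
  using Mb.lcoaction Mb.rcoaction by (simp_all add: kG_coaction_def)

lemma coact_zero [simp]:
  "x \<in> carrier G \<Longrightarrow> lcoact M \<zero>\<^bsub>M\<^esub> x = \<zero>\<^bsub>M\<^esub>" "x \<in> carrier G \<Longrightarrow> rcoact M \<zero>\<^bsub>M\<^esub> x = \<zero>\<^bsub>M\<^esub>"
  using linear_maps_zero[OF coact_linear(1) ab ab] linear_maps_zero[OF coact_linear(2) ab ab] by auto

lemma coact_closed [simp]:
  "\<lbrakk>m \<in> carrier M; x \<in> carrier G\<rbrakk> \<Longrightarrow> lcoact M m x \<in> carrier M"
  "\<lbrakk>m \<in> carrier M; x \<in> carrier G\<rbrakk> \<Longrightarrow> rcoact M m x \<in> carrier M"
  using coaction_closed[OF Mb.lcoaction] coaction_closed[OF Mb.rcoaction] by auto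

lemma act_closed [simp]:
  "\<lbrakk>m \<in> carrier M; e \<in> carrier G\<rbrakk> \<Longrightarrow> lact M e m \<in> carrier M"
  "\<lbrakk>m \<in> carrier M; e \<in> carrier G\<rbrakk> \<Longrightarrow> ract M m e \<in> carrier M"
  using linear_maps_closed[OF Mb.lact_linear] linear_maps_closed[OF Mb.ract_linear] by auto

lemma coact_outside:
  "\<lbrakk>m \<in> carrier M; x \<notin> carrier G\<rbrakk> \<Longrightarrow> lcoact M m x = \<zero>\<^bsub>M\<^esub>"
  "\<lbrakk>m \<in> carrier M; x \<notin> carrier G\<rbrakk> \<Longrightarrow> rcoact M m x = \<zero>\<^bsub>M\<^esub>"
  using Mb.lcoaction Mb.rcoaction by (simp_all add: kG_coaction_def tensor_kG_def)

lemma coact_finite: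
  "m \<in> carrier M \<Longrightarrow> finite {x. lcoact M m x \<noteq> \<zero>\<^bsub>M\<^esub>}" "m \<in> carrier M \<Longrightarrow> finite {x. rcoact M m x \<noteq> \<zero>\<^bsub>M\<^esub>}"
  using Mb.lcoaction Mb.rcoaction by (simp_all add: kG_coaction_def tensor_kG_def)

lemma coact_coact:
  "\<lbrakk>m \<in> carrier M; x \<in> carrier G\<rbrakk> \<Longrightarrow> lcoact M (lcoact M m x) y = (if y = x then lcoact M m x else \<zero>\<^bsub>M\<^esub>)"
  "\<lbrakk>m \<in> carrier M; x \<in> carrier G\<rbrakk> \<Longrightarrow> rcoact M (rcoact M m x) y = (if y = x then rcoact M m x else \<zero>\<^bsub>M\<^esub>)"
  using Mb.lcoaction Mb.rcoaction by (simp_all add: kG_coaction_def pure_tensor_def)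

lemma lcoact_ext:
  assumes "m \<in> carrier M" "n \<in> carrier M" "\<And>x. x \<in> carrier G \<Longrightarrow> lcoact M m x = lcoact M n x"
  shows "m = n"
proof -
  have eq: "lcoact M m = lcoact M n"
  proof
    show "lcoact M m x = lcoact M n x" for x
      using assms(3) coact_outside(1)[of _ x] assms(1,2) by (cases "x \<in> carrier G") auto
  qed
  have "finsum M (lcoact M m) {x \<in> carrier G. lcoact M m x \<noteq> \<zero>\<^bsub>M\<^esub>} = m" if "m \<in> carrier M" for m
    using Mb.lcoaction that unfolding kG_coaction_def by simp
  from this[OF assms(1), unfolded eq] this[OF assms(2)] show ?thesis by (rule trans[OF sym])
qed

lemma rcoact_ext:
  assumes "m \<in> carrier M" "n \<in> carrier M" "\<And>x. x \<in> carrier G \<Longrightarrow> rcoact M m x = rcoact M n x"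
  shows "m = n"
proof -
  have eq: "rcoact M m = rcoact M n"
  proof
    show "rcoact M m x = rcoact M n x" for x
      using assms(3) coact_outside(2)[of _ x] assms(1,2) by (cases "x \<in> carrier G") auto
  qed
  have "finsum M (rcoact M m) {x \<in> carrier G. rcoact M m x \<noteq> \<zero>\<^bsub>M\<^esub>} = m" if "m \<in> carrier M" for m
    using Mb.rcoaction that unfolding kG_coaction_def by simp
  from this[OF assms(1), unfolded eq] this[OF assms(2)] show ?thesis by (rule trans[OF sym])
qed

lemma part_iff:
  assumes "g \<in> carrier G" "h \<in> carrier G"
  shows "m \<in> part g h \<longleftrightarrow> m \<in> carrier M \<and> (\<forall>x\<in>carrier G. lcoact M m x = (if x = g then m else \<zero>\<^bsub>M\<^esub>)) \<and>
    (\<forall>x\<in>carrier G. rcoact M m x = (if x = h then m else \<zero>\<^bsub>M\<^esub>))"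
  using assms coact_outside[of m] by (auto simp: bigraded_part_def pure_tensor_def fun_eq_iff)

lemma part_zero: "\<lbrakk>g \<in> carrier G; h \<in> carrier G\<rbrakk> \<Longrightarrow> \<zero>\<^bsub>M\<^esub> \<in> part g h"
  by (simp add: part_iff)

lemma part_add: "\<lbrakk>g \<in> carrier G; h \<in> carrier G; m \<in> part g h; n \<in> part g h\<rbrakk> \<Longrightarrow> m \<oplus>\<^bsub>M\<^esub> n \<in> part g h"
  by (simp add: part_iff linear_maps_add[OF coact_linear(1)] linear_maps_add[OF coact_linear(2)])

lemma part_smult: "\<lbrakk>g \<in> carrier G; h \<in> carrier G; m \<in> part g h; k \<in> carrier K\<rbrakk> \<Longrightarrow> k \<odot>\<^bsub>M\<^esub> m \<in> part g h"
  by (simp add: part_iff linear_maps_smult[OF coact_linear(1)] linear_maps_smult[OF coact_linear(2)])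

lemma part_lact:
  assumes [simp]: "e \<in> carrier G" "g \<in> carrier G" "h \<in> carrier G" and m: "m \<in> part g h"
  shows "lact M e m \<in> part (e \<otimes> g) (e \<otimes> h)"
proof -
  note mc = partD[OF m]
  have "lcoact M (lact M e m) x = (if x = e \<otimes> g then lact M e m else \<zero>\<^bsub>M\<^esub>)"
    "rcoact M (lact M e m) x = (if x = e \<otimes> h then lact M e m else \<zero>\<^bsub>M\<^esub>)" if x: "x \<in> carrier G" for x
    using Mb.lact_lcoact[OF mc, of e "inv e \<otimes> x"] Mb.lact_rcoact[OF mc, of e "inv e \<otimes> x"] m x
    by (auto simp: part_iff G.inv_solve_left' simp flip: G.m_assoc)
  then show ?thesis using mc by (simp add: part_iff)
qed

lemma part_ract:
  assumes [simp]: "e \<in> carrier G" "g \<in> carrier G" "h \<in> carrier G" and m: "m \<in> part g h"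
  shows "ract M m e \<in> part (g \<otimes> e) (h \<otimes> e)"
proof -
  note mc = partD[OF m]
  have "lcoact M (ract M m e) x = (if x = g \<otimes> e then ract M m e else \<zero>\<^bsub>M\<^esub>)"
    "rcoact M (ract M m e) x = (if x = h \<otimes> e then ract M m e else \<zero>\<^bsub>M\<^esub>)" if x: "x \<in> carrier G" for x
    using Mb.ract_lcoact[OF mc, of e "x \<otimes> inv e"] Mb.ract_rcoact[OF mc, of e "x \<otimes> inv e"] m x
    by (auto simp: part_iff G.inv_solve_right' G.m_assoc)
  then show ?thesis using mc by (simp add: part_iff)
qed

sublocale act: homogeneous_action K G \<Phi> "bigraded_part M" "smult M" "lact M" "ract M"
proof (unfold_locales, goal_cases)
  case (6 k e g h m)
  then show ?case using linear_maps_smult[OF Mb.lact_linear] partD by auto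
next
  case (7 k e g h m)
  then show ?case using linear_maps_smult[OF Mb.ract_linear] partD by auto
qed (auto intro: part_smult part_lact part_ract simp: partD Mb.smult_assoc1
  Mb.lact_lact Mb.ract_ract Mb.lact_ract Mb.lact_one Mb.ract_one linear_maps_smult[OF Mb.lact_linear] linear_maps_smult[OF Mb.ract_linear])

definition proj where "proj g h m = rcoact M (lcoact M m g) h"

lemma proj_linear: "\<lbrakk>g \<in> carrier G; h \<in> carrier G\<rbrakk> \<Longrightarrow> proj g h \<in> linear_maps K M M"
  unfolding proj_def[abs_def] by (intro linear_maps_compose[OF coact_linear(1) coact_linear(2)])

lemma proj_part:
  assumes [simp]: "g \<in> carrier G" "h \<in> carrier G" "m \<in> carrier M"
  shows "proj g h m \<in> part g h"
  using Mb.bicomodule[of "lcoact M m g" _ h, symmetric]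
  by (auto simp: part_iff proj_def coact_coact)

lemma proj_homogeneous:
  assumes [simp]: "g \<in> carrier G" "h \<in> carrier G" "g' \<in> carrier G" "h' \<in> carrier G" and "m \<in> part g h"
  shows "proj g' h' m = (if g' = g \<and> h' = h then m else \<zero>\<^bsub>M\<^esub>)"
  using assms(5) by (auto simp: part_iff proj_def)

text \<open>By the counit laws, an element is the sum of its components for either coaction.\<close>

lemma proj_ext:
  assumes "m \<in> carrier M" "n \<in> carrier M"
    "\<And>g h. \<lbrakk>g \<in> carrier G; h \<in> carrier G\<rbrakk> \<Longrightarrow> proj g h m = proj g h n"
  shows "m = n"
proof (rule lcoact_ext[OF assms(1,2)])
  fix x assume x: "x \<in> carrier G"
  show "lcoact M m x = lcoact M n x"
    using assms(3)[OF x] unfolding proj_def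
    by (rule rcoact_ext[OF coact_closed(1)[OF assms(1) x] coact_closed(1)[OF assms(2) x]])
qed

lemma proj_lact:
  "\<lbrakk>m \<in> carrier M; e \<in> carrier G; g \<in> carrier G; h \<in> carrier G\<rbrakk> \<Longrightarrow>
    proj (e \<otimes> g) (e \<otimes> h) (lact M e m) = lact M e (proj g h m)"
  by (simp add: proj_def Mb.lact_lcoact Mb.lact_rcoact)

lemma proj_ract:
  "\<lbrakk>m \<in> carrier M; e \<in> carrier G; g \<in> carrier G; h \<in> carrier G\<rbrakk> \<Longrightarrow>
    proj (g \<otimes> e) (h \<otimes> e) (ract M m e) = ract M (proj g h m) e"
  by (simp add: proj_def Mb.ract_lcoact Mb.ract_rcoact)

lemma proj_lcoact:
  "\<lbrakk>m \<in> carrier M; x \<in> carrier G; g \<in> carrier G; h \<in> carrier G\<rbrakk> \<Longrightarrow>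
    proj g h (lcoact M m x) = (if g = x then proj g h m else \<zero>\<^bsub>M\<^esub>)"
  by (simp add: proj_def coact_coact)

lemma proj_rcoact:
  "\<lbrakk>m \<in> carrier M; x \<in> carrier G; g \<in> carrier G; h \<in> carrier G\<rbrakk> \<Longrightarrow>
    proj g h (rcoact M m x) = (if h = x then proj g h m else \<zero>\<^bsub>M\<^esub>)"
  using Mb.bicomodule[of m g x, symmetric] by (simp add: proj_def coact_coact)

lemma proj_finite:
  assumes m: "m \<in> carrier M"
  shows "finite {(g, h). g \<in> carrier G \<and> h \<in> carrier G \<and> proj g h m \<noteq> \<zero>\<^bsub>M\<^esub>}"
proof -
  let ?L = "{x. lcoact M m x \<noteq> \<zero>\<^bsub>M\<^esub>} \<inter> carrier G"
  have "{(g, h). g \<in> carrier G \<and> h \<in> carrier G \<and> proj g h m \<noteq> \<zero>\<^bsub>M\<^esub>}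
    \<subseteq> Sigma ?L (\<lambda>g. {x. rcoact M (lcoact M m g) x \<noteq> \<zero>\<^bsub>M\<^esub>})"
    by (auto simp: proj_def)
  moreover have "finite \<dots>"
  proof (rule finite_SigmaI)
    show "finite ?L" using coact_finite(1)[OF m] by simp
    show "finite {x. rcoact M (lcoact M m g) x \<noteq> \<zero>\<^bsub>M\<^esub>}" if "g \<in> ?L" for g
      by (rule coact_finite(2)) (use that m in simp)
  qed
  ultimately show ?thesis by (rule finite_subset)
qed

text \<open>The element is the sum of the given components.\<close>

lemma proj_exists:
  assumes n: "\<And>g h. \<lbrakk>g \<in> carrier G; h \<in> carrier G\<rbrakk> \<Longrightarrow> n g h \<in> part g h"
    and fin: "finite {(g, h). g \<in> carrier G \<and> h \<in> carrier G \<and> n g h \<noteq> \<zero>\<^bsub>M\<^esub>}" (is "finite ?S")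
  obtains m where "m \<in> carrier M" "\<And>g h. \<lbrakk>g \<in> carrier G; h \<in> carrier G\<rbrakk> \<Longrightarrow> proj g h m = n g h"
proof
  have c: "(\<lambda>(g, h). n g h) \<in> ?S \<rightarrow> carrier M" by (auto intro!: partD[OF n])
  show "finsum M (\<lambda>(g, h). n g h) ?S \<in> carrier M" using c by (rule Mb.M.finsum_closed)
  fix g h assume gh: "g \<in> carrier G" "h \<in> carrier G"
  have "proj g h (finsum M (\<lambda>(g, h). n g h) ?S) = finsum M (\<lambda>s. proj g h (case s of (g, h) \<Rightarrow> n g h)) ?S"
    by (rule linear_maps_finsum[OF proj_linear[OF gh] ab ab fin c])
  also have "\<dots> = finsum M (\<lambda>s. if (g, h) = s then n g h else \<zero>\<^bsub>M\<^esub>) ?S"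
    using gh n partD[OF n] by (intro Mb.M.finsum_cong') (auto simp: proj_homogeneous[OF _ _ _ _ n] split: if_splits)
  also have "\<dots> = n g h"
  proof (cases "(g, h) \<in> ?S")
    case True
    then show ?thesis using Mb.M.finsum_singleton[OF True fin, of "\<lambda>_. n g h"] partD[OF n[OF gh]] by simp
  next
    case False
    then have "finsum M (\<lambda>s. if (g, h) = s then n g h else \<zero>\<^bsub>M\<^esub>) ?S = finsum M (\<lambda>s. \<zero>\<^bsub>M\<^esub>) ?S"
      by (intro Mb.M.finsum_cong') auto
    then show ?thesis using False gh by (simp add: Mb.M.finsum_zero)
  qed
  finally show "proj g h (finsum M (\<lambda>(g, h). n g h) ?S) = n g h" .
qed

end

section \<open>The functor to projective representations\<close>

definition fibre_rep ::
  "('g, 's) monoid_scheme \<Rightarrow> ('k, 'v, 'g) majid_bimodule \<Rightarrow> 'g \<Rightarrow> ('k, 'v, 'g) proj_rep" where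
  "fibre_rep G M g = \<lparr>carrier = bigraded_part M g \<one>\<^bsub>G\<^esub>, mult = monoid.mult M, one = monoid.one M,
     ring.zero = ring.zero M, add = ring.add M, smult = module.smult M, rho = (\<lambda>z m. ract M (lact M z m) (inv\<^bsub>G\<^esub> z))\<rparr>"

lemma (in group) group_centralizer:
  assumes g: "g \<in> carrier G"
  shows "group (centralizer G g)" and "\<And>z. z \<in> carrier (centralizer G g) \<Longrightarrow> inv\<^bsub>centralizer G g\<^esub> z = inv z"
proof -
  have s: "subgroup {z \<in> carrier G. z \<otimes> g = g \<otimes> z} G"
  proof
    fix x assume "x \<in> {z \<in> carrier G. z \<otimes> g = g \<otimes> z}"
    then have x: "x \<in> carrier G" "x \<otimes> g = g \<otimes> x" by auto
    have "g \<otimes> inv x = inv x \<otimes> (x \<otimes> g) \<otimes> inv x" using x(1) g by (simp flip: m_assoc)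
    also have "\<dots> = inv x \<otimes> (g \<otimes> x) \<otimes> inv x" by (simp only: x(2))
    also have "\<dots> = inv x \<otimes> g" using x(1) g by (simp add: m_assoc)
    finally have "inv x \<otimes> g = g \<otimes> inv x" ..
    then show "inv x \<in> {z \<in> carrier G. z \<otimes> g = g \<otimes> z}" using x(1) by simp
    fix y assume "y \<in> {z \<in> carrier G. z \<otimes> g = g \<otimes> z}"
    then have y: "y \<in> carrier G" "y \<otimes> g = g \<otimes> y" by auto
    have "x \<otimes> y \<otimes> g = x \<otimes> g \<otimes> y" using x(1) y g by (simp add: m_assoc)
    also have "\<dots> = g \<otimes> (x \<otimes> y)" unfolding x(2) using x(1) y(1) g by (simp add: m_assoc)
    finally show "x \<otimes> y \<in> {z \<in> carrier G. z \<otimes> g = g \<otimes> z}" using x(1) y(1) by simp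
  qed (use g in auto)
  show "group (centralizer G g)"
    unfolding centralizer_def by (rule subgroup.subgroup_is_group[OF s is_group])
  show "inv\<^bsub>centralizer G g\<^esub> z = inv z" if "z \<in> carrier (centralizer G g)" for z
    using m_inv_consistent[OF s] that by (simp add: centralizer_def)
qed

context majid
begin

lemma sandwich_linear:
  assumes "a \<in> carrier G" "b \<in> carrier G"
  shows "(\<lambda>m. act.sandwich m a b) \<in> linear_maps K M M"
  unfolding act.sandwich_def[abs_def] using linear_maps_compose[OF Mb.lact_linear Mb.ract_linear] assms .

lemma ad_linear:
  assumes "z \<in> carrier G"
  shows "act.ad z \<in> linear_maps K M M"
  unfolding act.ad_def[abs_def] using linear_maps_compose[OF Mb.lact_linear Mb.ract_linear] assms by simp

lemma projective_representation_fibre: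
  assumes g [simp]: "g \<in> carrier G"
  shows "projective_representation K (fibre_rep G M g) (centralizer G g) (\<lambda>e f. Phi_tilde K G \<Phi> e f g)"
proof -
  let ?V = "fibre_rep G M g"
  have one: "\<one> \<in> carrier G" by simp
  note pc = partD[of _ g \<one>]
  have neg: "\<ominus>\<^bsub>M\<^esub> m \<in> part g \<one>" if "m \<in> part g \<one>" for m
  proof -
    have "\<ominus>\<^bsub>M\<^esub> m = (\<ominus>\<^bsub>K\<^esub> \<one>\<^bsub>K\<^esub>) \<odot>\<^bsub>M\<^esub> m" using pc[OF that] Mb.smult_l_minus[of "\<one>\<^bsub>K\<^esub>" m] by simp
    then show ?thesis using part_smult[OF g one that, of "\<ominus>\<^bsub>K\<^esub> \<one>\<^bsub>K\<^esub>"] by simp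
  qed
  have ab: "abelian_group ?V"
  proof (rule abelian_groupI)
    fix x assume "x \<in> carrier ?V"
    then show "\<exists>y\<in>carrier ?V. y \<oplus>\<^bsub>?V\<^esub> x = \<zero>\<^bsub>?V\<^esub>"
      using neg pc Mb.M.l_neg by (intro bexI[of _ "\<ominus>\<^bsub>M\<^esub> x"]) (simp_all add: fibre_rep_def)
  qed (auto simp: fibre_rep_def part_add part_zero pc Mb.M.a_ac)
  have mod: "module K ?V"
    by (rule moduleI) (use ab K.is_cring in \<open>auto simp: fibre_rep_def part_smult pc Mb.smult_l_distr
        Mb.smult_r_distr Mb.smult_assoc1\<close>)
  have rho: "rho ?V z = act.ad z" for z
    by (rule ext) (simp add: fibre_rep_def act.ad_def)
  have sub: "z \<in> carrier (centralizer G g) \<Longrightarrow> z \<in> carrier G \<and> z \<otimes> g = g \<otimes> z" for z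
    by (simp add: centralizer_def)
  have GL: "rho ?V z \<in> GL K ?V" if z: "z \<in> carrier (centralizer G g)" for z
  proof -
    have "bij_betw (act.ad z) (part g \<one>) (part g \<one>)" using sub[OF z] by (intro act.ad_bij) auto
    moreover have "act.ad z \<in> linear_maps K ?V ?V"
      using ad_linear[of z] sub[OF z] act.ad_centralizer[of g z] pc
      by (simp add: linear_maps_def fibre_rep_def)
    ultimately show ?thesis unfolding rho GL_def by (simp add: fibre_rep_def)
  qed
  show ?thesis
  proof (intro projective_representation.intro mod projective_representation_axioms.intro GL)
    fix v assume "v \<in> carrier ?V"
    then show "rho ?V \<one>\<^bsub>centralizer G g\<^esub> v = v"
      unfolding rho using act.ad_one[of g \<one> v] by (simp add: fibre_rep_def centralizer_def)
  next
    fix z w v assume zw: "z \<in> carrier (centralizer G g)" "w \<in> carrier (centralizer G g)" and v: "v \<in> carrier ?V"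
    then show "rho ?V z (rho ?V w v) = Phi_tilde K G \<Phi> z w g \<odot>\<^bsub>?V\<^esub> rho ?V (z \<otimes>\<^bsub>centralizer G g\<^esub> w) v"
      unfolding rho using act.ad_mult[of z w g v] sub[OF zw(1)] sub[OF zw(2)]
      by (simp add: fibre_rep_def centralizer_def)
  qed
qed

end

lemma Majid_hom_part:
  assumes "\<phi> \<in> Majid_homs K G M N" "majid K G \<Phi> M" "majid K G \<Phi> N" "g \<in> carrier G" "h \<in> carrier G"
    "m \<in> bigraded_part M g h"
  shows "\<phi> m \<in> bigraded_part N g h"
proof -
  interpret M: majid K G \<Phi> M by fact
  interpret N: majid K G \<Phi> N by fact
  note \<phi> = Majid_homsD[OF assms(1)]
  have m: "m \<in> carrier M" using assms(6) by (rule M.partD)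
  have z: "\<phi> \<zero>\<^bsub>M\<^esub> = \<zero>\<^bsub>N\<^esub>" by (rule linear_maps_zero[OF \<phi>(1) M.ab N.ab])
  show ?thesis
    using assms(4,5,6) m linear_maps_closed[OF \<phi>(1) m] z \<phi>(3,4)[OF m]
    by (auto simp: M.part_iff N.part_iff)
qed

lemma Majid_hom_proj:
  assumes "\<phi> \<in> Majid_homs K G M N" "majid K G \<Phi> M" "majid K G \<Phi> N" "g \<in> carrier G" "h \<in> carrier G" "m \<in> carrier M"
  shows "majid.proj N g h (\<phi> m) = \<phi> (majid.proj M g h m)"
proof -
  interpret M: majid K G \<Phi> M by fact
  interpret N: majid K G \<Phi> N by fact
  note \<phi> = Majid_homsD[OF assms(1)]
  show ?thesis using assms(4-6) \<phi>(3)[OF assms(6,4)] \<phi>(4)[OF M.coact_closed(1)[OF assms(6,4)] assms(5)]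
    by (simp add: M.proj_def N.proj_def)
qed

lemma Majid_hom_eqI:
  assumes "\<phi> \<in> Majid_homs K G M N" "\<psi> \<in> Majid_homs K G M N" "majid K G \<Phi> M" "majid K G \<Phi> N"
    and eq: "\<And>g h m. \<lbrakk>g \<in> carrier G; h \<in> carrier G; m \<in> bigraded_part M g h\<rbrakk> \<Longrightarrow> \<phi> m = \<psi> m"
  shows "\<phi> = \<psi>"
proof (rule extensionalityI)
  interpret M: majid K G \<Phi> M by fact
  interpret N: majid K G \<Phi> N by fact
  fix m assume m: "m \<in> carrier M"
  show "\<phi> m = \<psi> m"
  proof (rule N.proj_ext)
    fix g h assume gh: "g \<in> carrier G" "h \<in> carrier G"
    show "N.proj g h (\<phi> m) = N.proj g h (\<psi> m)"
      using Majid_hom_proj[OF assms(1,3,4) gh m] Majid_hom_proj[OF assms(2,3,4) gh m]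
        eq[OF gh M.proj_part[OF gh m]] by simp
  qed (use m linear_maps_closed[OF Majid_homsD(1)[OF assms(1)]] linear_maps_closed[OF Majid_homsD(1)[OF assms(2)]] in auto)
qed (use Majid_homsD(2)[OF assms(1)] Majid_homsD(2)[OF assms(2)] in auto)

text \<open>A morphism may be prescribed on homogeneous elements: the image of \<open>m\<close> is the element whose
components are the images of the components of \<open>m\<close>. Elements of \<open>N\<close> are determined by their
components, so every property of the extension is checked in one bidegree at a time.\<close>

lemma Majid_hom_extend:
  assumes "majid K G \<Phi> M" "majid K G \<Phi> N"
    and cl: "\<And>g h m. \<lbrakk>g \<in> carrier G; h \<in> carrier G; m \<in> bigraded_part M g h\<rbrakk> \<Longrightarrow> \<psi> g h m \<in> bigraded_part N g h"
    and add: "\<And>g h m n. \<lbrakk>g \<in> carrier G; h \<in> carrier G; m \<in> bigraded_part M g h; n \<in> bigraded_part M g h\<rbrakk> \<Longrightarrow>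
      \<psi> g h (m \<oplus>\<^bsub>M\<^esub> n) = \<psi> g h m \<oplus>\<^bsub>N\<^esub> \<psi> g h n"
    and smult: "\<And>g h m k. \<lbrakk>g \<in> carrier G; h \<in> carrier G; m \<in> bigraded_part M g h; k \<in> carrier K\<rbrakk> \<Longrightarrow>
      \<psi> g h (k \<odot>\<^bsub>M\<^esub> m) = k \<odot>\<^bsub>N\<^esub> \<psi> g h m"
    and lact: "\<And>g h m e. \<lbrakk>g \<in> carrier G; h \<in> carrier G; m \<in> bigraded_part M g h; e \<in> carrier G\<rbrakk> \<Longrightarrow>
      \<psi> (e \<otimes>\<^bsub>G\<^esub> g) (e \<otimes>\<^bsub>G\<^esub> h) (lact M e m) = lact N e (\<psi> g h m)"
    and ract: "\<And>g h m e. \<lbrakk>g \<in> carrier G; h \<in> carrier G; m \<in> bigraded_part M g h; e \<in> carrier G\<rbrakk> \<Longrightarrow>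
      \<psi> (g \<otimes>\<^bsub>G\<^esub> e) (h \<otimes>\<^bsub>G\<^esub> e) (ract M m e) = ract N (\<psi> g h m) e"
  obtains \<phi> where "\<phi> \<in> Majid_homs K G M N"
    "\<And>g h m. \<lbrakk>g \<in> carrier G; h \<in> carrier G; m \<in> bigraded_part M g h\<rbrakk> \<Longrightarrow> \<phi> m = \<psi> g h m"
proof -
  interpret M: majid K G \<Phi> M by fact
  interpret N: majid K G \<Phi> N by fact
  have zero: "\<psi> g h \<zero>\<^bsub>M\<^esub> = \<zero>\<^bsub>N\<^esub>" if gh: "g \<in> carrier G" "h \<in> carrier G" for g h
    using smult[OF gh M.part_zero[OF gh], of "\<zero>\<^bsub>K\<^esub>"] N.partD[OF cl[OF gh M.part_zero[OF gh]]] by simp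
  have "\<exists>n. n \<in> carrier N \<and> (\<forall>g\<in>carrier G. \<forall>h\<in>carrier G. N.proj g h n = \<psi> g h (M.proj g h m))"
    if m: "m \<in> carrier M" for m
  proof -
    have "finite {(g, h). g \<in> carrier G \<and> h \<in> carrier G \<and> \<psi> g h (M.proj g h m) \<noteq> \<zero>\<^bsub>N\<^esub>}"
      by (rule finite_subset[OF _ M.proj_finite[OF m]]) (use zero in auto)
    then obtain n where "n \<in> carrier N"
      "\<And>g h. \<lbrakk>g \<in> carrier G; h \<in> carrier G\<rbrakk> \<Longrightarrow> N.proj g h n = \<psi> g h (M.proj g h m)"
      using N.proj_exists[of "\<lambda>g h. \<psi> g h (M.proj g h m)"] cl[OF _ _ M.proj_part[OF _ _ m]] by blast
    then show ?thesis by blast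
  qed
  then obtain f where fc: "\<And>m. m \<in> carrier M \<Longrightarrow> f m \<in> carrier N"
    and f: "\<And>m g h. \<lbrakk>m \<in> carrier M; g \<in> carrier G; h \<in> carrier G\<rbrakk> \<Longrightarrow> N.proj g h (f m) = \<psi> g h (M.proj g h m)"
    by metis
  define \<phi> where "\<phi> = restrict f (carrier M)"
  have \<phi>c: "\<phi> m \<in> carrier N" if "m \<in> carrier M" for m using fc that by (simp add: \<phi>_def)
  have \<phi>: "N.proj g h (\<phi> m) = \<psi> g h (M.proj g h m)" if "m \<in> carrier M" "g \<in> carrier G" "h \<in> carrier G" for m g h
    using f that by (simp add: \<phi>_def)
  have "\<phi> \<in> linear_maps K M N"
    unfolding linear_maps_def
  proof (intro CollectI conjI ballI)
    show "\<phi> \<in> carrier M \<rightarrow> carrier N" using \<phi>c by simp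
    show "\<phi> (x \<oplus>\<^bsub>M\<^esub> y) = \<phi> x \<oplus>\<^bsub>N\<^esub> \<phi> y" if xy: "x \<in> carrier M" "y \<in> carrier M" for x y
    proof (rule N.proj_ext)
      fix g h assume gh: "g \<in> carrier G" "h \<in> carrier G"
      show "N.proj g h (\<phi> (x \<oplus>\<^bsub>M\<^esub> y)) = N.proj g h (\<phi> x \<oplus>\<^bsub>N\<^esub> \<phi> y)"
        using gh xy \<phi>c by (simp add: \<phi> linear_maps_add[OF M.proj_linear] linear_maps_add[OF N.proj_linear]
            add M.proj_part)
    qed (use xy \<phi>c in auto)
    show "\<phi> (k \<odot>\<^bsub>M\<^esub> x) = k \<odot>\<^bsub>N\<^esub> \<phi> x" if xy: "x \<in> carrier M" "k \<in> carrier K" for x k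
    proof (rule N.proj_ext)
      fix g h assume gh: "g \<in> carrier G" "h \<in> carrier G"
      show "N.proj g h (\<phi> (k \<odot>\<^bsub>M\<^esub> x)) = N.proj g h (k \<odot>\<^bsub>N\<^esub> \<phi> x)"
        using gh xy \<phi>c by (simp add: \<phi> linear_maps_smult[OF M.proj_linear] linear_maps_smult[OF N.proj_linear]
            smult M.proj_part)
    qed (use xy \<phi>c in auto)
  qed
  moreover have "lcoact N (\<phi> m) x = \<phi> (lcoact M m x)" "rcoact N (\<phi> m) x = \<phi> (rcoact M m x)"
    "\<phi> (lact M x m) = lact N x (\<phi> m)" "\<phi> (ract M m x) = ract N (\<phi> m) x"
    if m: "m \<in> carrier M" and x: "x \<in> carrier G" for m x
  proof -
    show "lcoact N (\<phi> m) x = \<phi> (lcoact M m x)"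
      by (rule N.proj_ext) (use m x \<phi>c zero in \<open>simp_all add: \<phi> M.proj_lcoact N.proj_lcoact\<close>)
    show "rcoact N (\<phi> m) x = \<phi> (rcoact M m x)"
      by (rule N.proj_ext) (use m x \<phi>c zero in \<open>simp_all add: \<phi> M.proj_rcoact N.proj_rcoact\<close>)
    show "\<phi> (lact M x m) = lact N x (\<phi> m)"
    proof (rule N.proj_ext)
      fix g h assume gh: "g \<in> carrier G" "h \<in> carrier G"
      define g' h' where "g' = inv\<^bsub>G\<^esub> x \<otimes>\<^bsub>G\<^esub> g" and "h' = inv\<^bsub>G\<^esub> x \<otimes>\<^bsub>G\<^esub> h"
      have e: "g = x \<otimes>\<^bsub>G\<^esub> g'" "h = x \<otimes>\<^bsub>G\<^esub> h'" and c: "g' \<in> carrier G" "h' \<in> carrier G"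
        using gh x by (simp_all add: g'_def h'_def flip: M.G.m_assoc)
      have "N.proj (x \<otimes>\<^bsub>G\<^esub> g') (x \<otimes>\<^bsub>G\<^esub> h') (\<phi> (lact M x m)) = N.proj (x \<otimes>\<^bsub>G\<^esub> g') (x \<otimes>\<^bsub>G\<^esub> h') (lact N x (\<phi> m))"
        using m x \<phi>c c by (simp add: \<phi> M.proj_lact N.proj_lact lact M.proj_part)
      then show "N.proj g h (\<phi> (lact M x m)) = N.proj g h (lact N x (\<phi> m))" unfolding e .
    qed (use m x \<phi>c in auto)
    show "\<phi> (ract M m x) = ract N (\<phi> m) x"
    proof (rule N.proj_ext)
      fix g h assume gh: "g \<in> carrier G" "h \<in> carrier G"
      define g' h' where "g' = g \<otimes>\<^bsub>G\<^esub> inv\<^bsub>G\<^esub> x" and "h' = h \<otimes>\<^bsub>G\<^esub> inv\<^bsub>G\<^esub> x"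
      have e: "g = g' \<otimes>\<^bsub>G\<^esub> x" "h = h' \<otimes>\<^bsub>G\<^esub> x" and c: "g' \<in> carrier G" "h' \<in> carrier G"
        using gh x by (simp_all add: g'_def h'_def M.G.m_assoc)
      have "N.proj (g' \<otimes>\<^bsub>G\<^esub> x) (h' \<otimes>\<^bsub>G\<^esub> x) (\<phi> (ract M m x)) = N.proj (g' \<otimes>\<^bsub>G\<^esub> x) (h' \<otimes>\<^bsub>G\<^esub> x) (ract N (\<phi> m) x)"
        using m x \<phi>c c by (simp add: \<phi> M.proj_ract N.proj_ract ract M.proj_part)
      then show "N.proj g h (\<phi> (ract M m x)) = N.proj g h (ract N (\<phi> m) x)" unfolding e .
    qed (use m x \<phi>c in auto)
  qed
  ultimately have hom: "\<phi> \<in> Majid_homs K G M N"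
    by (simp add: Majid_homs_def \<phi>_def)
  moreover have "\<phi> m = \<psi> g h m" if gh: "g \<in> carrier G" "h \<in> carrier G" and m: "m \<in> bigraded_part M g h" for g h m
  proof -
    have "\<phi> m \<in> bigraded_part N g h" by (rule Majid_hom_part[OF hom assms(1,2) gh m])
    then show ?thesis
      using \<phi>[OF M.partD[OF m] gh] M.proj_homogeneous[OF gh gh m] N.proj_homogeneous[OF gh gh] by simp
  qed
  ultimately show ?thesis by (rule that)
qed


lemma restrict_compose:
  "\<lbrakk>P \<subseteq> A; \<And>m. m \<in> P \<Longrightarrow> \<phi> m \<in> Q\<rbrakk> \<Longrightarrow>
    restrict (compose A \<psi> \<phi>) P = compose P (restrict \<psi> Q) (restrict \<phi> P)"
  by (auto simp: compose_def restrict_def fun_eq_iff)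

section \<open>Conjugacy classes and transversals\<close>

locale class_reps = three_cocycle K G \<Phi>
  for K :: "('k, 'r) ring_scheme" and G :: "('g, 's) monoid_scheme" (structure)
    and \<Phi> :: "'g \<Rightarrow> 'g \<Rightarrow> 'g \<Rightarrow> 'k" +
  fixes gC :: "'g set \<Rightarrow> 'g"
  assumes gC_in: "C \<in> conjugacy_classes G \<Longrightarrow> gC C \<in> C"
begin

definition conj_class where "conj_class x = orbit G (\<lambda>x. \<lambda>g\<in>carrier G. x \<otimes> g \<otimes> inv x) x"

lemma conj_class_eq: "x \<in> carrier G \<Longrightarrow> conj_class x = {a \<otimes> x \<otimes> inv a |a. a \<in> carrier G}"
  by (simp add: conj_class_def orbit_def)

lemma conjugacy_classes_eq: "conjugacy_classes G = conj_class ` carrier G"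
  by (auto simp: conjugacy_classes_def orbits_def conj_class_def[abs_def])

lemma conjugate_mult:
  "\<lbrakk>a \<in> carrier G; b \<in> carrier G; x \<in> carrier G\<rbrakk> \<Longrightarrow>
    a \<otimes> (b \<otimes> x \<otimes> inv b) \<otimes> inv a = a \<otimes> b \<otimes> x \<otimes> inv (a \<otimes> b)"
  by (simp add: G.inv_mult_group G.m_assoc)

lemma conj_class_conj:
  assumes [simp]: "e \<in> carrier G" "x \<in> carrier G"
  shows "conj_class (e \<otimes> x \<otimes> inv e) = conj_class x"
proof (intro equalityI subsetI)
  fix y assume "y \<in> conj_class (e \<otimes> x \<otimes> inv e)"
  then obtain a where "a \<in> carrier G" "y = a \<otimes> (e \<otimes> x \<otimes> inv e) \<otimes> inv a" by (auto simp: conj_class_eq)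
  then show "y \<in> conj_class x" using conjugate_mult[of a e x] by (auto simp: conj_class_eq intro!: exI[of _ "a \<otimes> e"])
next
  fix y assume "y \<in> conj_class x"
  then obtain a where a: "a \<in> carrier G" "y = a \<otimes> x \<otimes> inv a" by (auto simp: conj_class_eq)
  then have "y = a \<otimes> inv e \<otimes> (e \<otimes> x \<otimes> inv e) \<otimes> inv (a \<otimes> inv e)"
    using conjugate_mult[of "a \<otimes> inv e" e x] by (simp add: G.m_assoc)
  then show "y \<in> conj_class (e \<otimes> x \<otimes> inv e)" using a by (auto simp: conj_class_eq intro!: exI[of _ "a \<otimes> inv e"])
qed

definition class_rep where "class_rep x = gC (conj_class x)"

lemma class_rep_conj: "\<lbrakk>e \<in> carrier G; x \<in> carrier G\<rbrakk> \<Longrightarrow> class_rep (e \<otimes> x \<otimes> inv e) = class_rep x"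
  by (simp add: class_rep_def conj_class_conj)

lemma class_rep_exists:
  assumes "x \<in> carrier G" obtains a where "a \<in> carrier G" "class_rep x = a \<otimes> x \<otimes> inv a"
  using gC_in[of "conj_class x"] assms by (auto simp: conjugacy_classes_eq conj_class_eq class_rep_def)

lemma class_rep_closed [simp]: "x \<in> carrier G \<Longrightarrow> class_rep x \<in> carrier G"
  by (metis class_rep_exists G.m_closed G.inv_closed)

lemma gC_closed: "C \<in> conjugacy_classes G \<Longrightarrow> gC C \<in> carrier G"
  using class_rep_closed by (auto simp: conjugacy_classes_eq class_rep_def)

lemma conj_class_gC: "C \<in> conjugacy_classes G \<Longrightarrow> conj_class (gC C) = C"
proof -
  assume "C \<in> conjugacy_classes G"
  then obtain x where x: "x \<in> carrier G" "C = conj_class x" by (auto simp: conjugacy_classes_eq)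
  obtain a where "a \<in> carrier G" "class_rep x = a \<otimes> x \<otimes> inv a" by (rule class_rep_exists[OF x(1)])
  then show ?thesis using conj_class_conj[of a x] x by (simp add: class_rep_def)
qed

lemma class_rep_gC: "C \<in> conjugacy_classes G \<Longrightarrow> class_rep (gC C) = gC C"
  by (simp add: class_rep_def conj_class_gC)

text \<open>A transversal: \<open>transv x\<close> conjugates the representative of the class of \<open>x\<close> to \<open>x\<close>. The value \<open>\<one>\<close> at the
representatives themselves makes the translates of a fibre to its own bidegree the identity.\<close>

definition transv where
  "transv x = (if x = class_rep x then \<one> else (SOME a. a \<in> carrier G \<and> a \<otimes> class_rep x = x \<otimes> a))"

lemma transv:
  assumes x: "x \<in> carrier G"
  shows transv_closed [simp]: "transv x \<in> carrier G" and transv_class_rep: "transv x \<otimes> class_rep x = x \<otimes> transv x"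
proof -
  obtain a where a: "a \<in> carrier G" "class_rep x = a \<otimes> x \<otimes> inv a" by (rule class_rep_exists[OF x])
  then have "inv a \<in> carrier G \<and> inv a \<otimes> class_rep x = x \<otimes> inv a" using x by (simp flip: G.m_assoc)
  then have *: "transv x \<in> carrier G \<and> transv x \<otimes> class_rep x = x \<otimes> transv x"
    using someI[of "\<lambda>a. a \<in> carrier G \<and> a \<otimes> class_rep x = x \<otimes> a" "inv a"] x by (auto simp: transv_def)
  show "transv x \<in> carrier G" "transv x \<otimes> class_rep x = x \<otimes> transv x" using * by auto
qed

lemma transv_gC [simp]: "C \<in> conjugacy_classes G \<Longrightarrow> transv (gC C) = \<one>"
  by (simp add: transv_def class_rep_gC)

text \<open>The element of the centralizer that relates \<open>e\<close> times the transversal element of \<open>x\<close> to the transversal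
element of the conjugate of \<open>x\<close> by \<open>e\<close>.\<close>

definition transit where "transit e x = inv (transv (e \<otimes> x \<otimes> inv e)) \<otimes> e \<otimes> transv x"

lemma transit:
  assumes [simp]: "e \<in> carrier G" "x \<in> carrier G"
  shows transit_closed [simp]: "transit e x \<in> carrier G"
    and transit_eq: "e \<otimes> transv x = transv (e \<otimes> x \<otimes> inv e) \<otimes> transit e x"
    and transit_commute: "transit e x \<otimes> class_rep x = class_rep x \<otimes> transit e x"
proof -
  let ?y = "e \<otimes> x \<otimes> inv e"
  show 1: "transit e x \<in> carrier G" by (simp add: transit_def)
  show 2: "e \<otimes> transv x = transv ?y \<otimes> transit e x"
    by (simp add: transit_def flip: G.m_assoc)
  have "transv ?y \<otimes> (transit e x \<otimes> class_rep x) = e \<otimes> (transv x \<otimes> class_rep x)"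
    using 1 by (simp flip: G.m_assoc 2)
  also have "\<dots> = ?y \<otimes> (e \<otimes> transv x)" by (simp add: transv_class_rep G.m_assoc) (simp flip: G.m_assoc)
  also have "\<dots> = ?y \<otimes> transv ?y \<otimes> transit e x" using 1 by (simp add: 2 flip: G.m_assoc)
  also have "\<dots> = transv ?y \<otimes> (class_rep x \<otimes> transit e x)"
    using 1 transv_class_rep[of ?y] by (simp add: class_rep_conj flip: G.m_assoc)
  finally show "transit e x \<otimes> class_rep x = class_rep x \<otimes> transit e x" using 1 by simp
qed

lemma transit_mult:
  assumes [simp]: "e \<in> carrier G" "f \<in> carrier G" "x \<in> carrier G"
  shows "transit f (e \<otimes> x \<otimes> inv e) \<otimes> transit e x = transit (f \<otimes> e) x"
proof -
  define y where "y = e \<otimes> x \<otimes> inv e"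
  have y [simp]: "y \<in> carrier G" and fy: "f \<otimes> y \<otimes> inv f = f \<otimes> e \<otimes> x \<otimes> inv (f \<otimes> e)"
    by (simp_all add: y_def conjugate_mult)
  have "transit f y \<otimes> transit e x = inv (transv (f \<otimes> y \<otimes> inv f)) \<otimes> f \<otimes> (transv y \<otimes> transit e x)"
    unfolding transit_def[of f] by (simp add: G.m_assoc)
  also have "transv y \<otimes> transit e x = e \<otimes> transv x" by (simp add: transit_eq y_def)
  finally show ?thesis unfolding y_def[symmetric] fy transit_def[of "f \<otimes> e"] by (simp add: G.m_assoc)
qed

lemma transit_one: "x \<in> carrier G \<Longrightarrow> transit \<one> x = \<one>"
  by (simp add: transit_def)

lemma transit_centralizer:
  assumes C: "C \<in> conjugacy_classes G" and z: "z \<in> carrier G" "z \<otimes> gC C = gC C \<otimes> z"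
  shows "transit z (gC C) = z"
proof -
  have "z \<otimes> gC C \<otimes> inv z = gC C" unfolding z(2) using z(1) gC_closed[OF C] by (simp add: G.m_assoc)
  then show ?thesis using C z(1) by (simp add: transit_def)
qed

lemma transv_degree:
  assumes [simp]: "g \<in> carrier G" "h \<in> carrier G"
  shows "transv (g \<otimes> inv h) \<otimes> class_rep (g \<otimes> inv h) \<otimes> (inv (transv (g \<otimes> inv h)) \<otimes> h) = g"
    and "transv (g \<otimes> inv h) \<otimes> (inv (transv (g \<otimes> inv h)) \<otimes> h) = h"
  by (simp_all add: transv_class_rep flip: G.m_assoc) (simp_all add: G.m_assoc)

text \<open>In bidegree \<open>(g, h)\<close>, homogeneous elements correspond to elements of the fibre over the
representative of the class of \<open>g h\<inverse>\<close>, since both actions are bijective.\<close>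

lemma sandwich_bij_degree:
  assumes "homogeneous_action K G \<Phi> H sm l r" and gh [simp]: "g \<in> carrier G" "h \<in> carrier G"
  shows "bij_betw (\<lambda>m. homogeneous_action.sandwich l r m (transv (g \<otimes> inv h)) (inv (transv (g \<otimes> inv h)) \<otimes> h))
    (H (class_rep (g \<otimes> inv h)) \<one>) (H g h)"
  using homogeneous_action.sandwich_bij[OF assms(1), of "class_rep (g \<otimes> inv h)" "transv (g \<otimes> inv h)" "inv (transv (g \<otimes> inv h)) \<otimes> h"]
  by (simp add: transv_degree)

definition fibres where "fibres M = (\<lambda>C\<in>conjugacy_classes G. fibre_rep G M (gC C))"

definition fibres_arr :: "('k, 'v, 'g) majid_bimodule \<Rightarrow> ('k, 'v, 'g) majid_bimodule \<Rightarrow> ('v \<Rightarrow> 'v) \<Rightarrow> 'g set \<Rightarrow> 'v \<Rightarrow> 'v" where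
  "fibres_arr M N \<phi> = (\<lambda>C\<in>conjugacy_classes G. restrict \<phi> (bigraded_part M (gC C) \<one>))"

abbreviation reps_category :: "('g set \<Rightarrow> ('k, 'v, 'g) proj_rep, 'g set \<Rightarrow> 'v \<Rightarrow> 'v) cat" where
  "reps_category \<equiv> product_category (conjugacy_classes G)
     (\<lambda>C. proj_rep_category K (centralizer G (gC C)) (\<lambda>e f. Phi_tilde K G \<Phi> e f (gC C)))"

lemma majidI: "Majid_bimodule K M G \<Phi> \<Longrightarrow> majid K G \<Phi> M"
  by (intro majid.intro three_cocycle_axioms)

lemma fibre_hom:
  assumes \<phi>: "\<phi> \<in> Majid_homs K G M N" and M: "majid K G \<Phi> M" and N: "majid K G \<Phi> N"
    and g [simp]: "g \<in> carrier G"
  shows "restrict \<phi> (bigraded_part M g \<one>) \<in> proj_rep_homs K (centralizer G g) (fibre_rep G M g) (fibre_rep G N g)"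
proof -
  interpret M: majid K G \<Phi> M by fact
  interpret N: majid K G \<Phi> N by fact
  note h = Majid_homsD[OF \<phi>]
  have p: "\<phi> m \<in> bigraded_part N g \<one>" if "m \<in> bigraded_part M g \<one>" for m
    using Majid_hom_part[OF \<phi> M N g _ that] by simp
  have c: "ract M (lact M z m) (inv z) \<in> bigraded_part M g \<one>"
    if "z \<in> carrier G" "z \<otimes> g = g \<otimes> z" "m \<in> bigraded_part M g \<one>" for z m
    using M.act.ad_centralizer[OF g that] by (simp add: M.act.ad_def)
  have lin: "restrict \<phi> (bigraded_part M g \<one>) \<in> linear_maps K (fibre_rep G M g) (fibre_rep G N g)"
    unfolding linear_maps_def
    using p linear_maps_add[OF h(1)] linear_maps_smult[OF h(1)] M.partD[of _ g \<one>]
    by (auto simp: fibre_rep_def M.part_add M.part_smult)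
  moreover have "restrict \<phi> (bigraded_part M g \<one>) (ract M (lact M z m) (inv z)) =
      ract N (lact N z (restrict \<phi> (bigraded_part M g \<one>) m)) (inv z)"
    if "z \<in> carrier G" "z \<otimes> g = g \<otimes> z" "m \<in> bigraded_part M g \<one>" for z m
    using c[OF that] that M.partD[OF that(3)] by (simp add: h(5,6))
  ultimately show ?thesis
    unfolding proj_rep_homs_def by (simp add: fibre_rep_def centralizer_def)
qed

lemma fibres_functor:
  "is_functor (Majid_category K G \<Phi> :: (('k, 'v, 'g) majid_bimodule, 'v \<Rightarrow> 'v) cat) reps_category fibres fibres_arr"
  unfolding is_functor_def
proof (intro conjI ballI)
  fix M assume "M \<in> obj (Majid_category K G \<Phi>)"
  then have "majid K G \<Phi> M" by (simp add: Majid_category_def majidI)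
  then interpret M: majid K G \<Phi> M .
  show "fibres M \<in> obj reps_category"
    using M.projective_representation_fibre gC_closed
    by (auto simp: product_category_def fibres_def proj_rep_category_def)
  show "fibres_arr M M (ident (Majid_category K G \<Phi>) M) = ident reps_category (fibres M)"
    using M.partD by (auto simp: product_category_def fibres_def fibres_arr_def proj_rep_category_def
        Majid_category_def fibre_rep_def fun_eq_iff restrict_def)
next
  fix M N \<phi> assume "M \<in> obj (Majid_category K G \<Phi>)" "N \<in> obj (Majid_category K G \<Phi>)"
    and \<phi>: "\<phi> \<in> arr (Majid_category K G \<Phi>) M N"
  then have MN: "majid K G \<Phi> M" "majid K G \<Phi> N" by (simp_all add: Majid_category_def majidI)
  show "fibres_arr M N \<phi> \<in> arr reps_category (fibres M) (fibres N)"
    using \<phi> fibre_hom[OF _ MN gC_closed]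
    by (simp add: product_category_def fibres_def fibres_arr_def proj_rep_category_def Majid_category_def)
next
  fix L M N :: "('k, 'v, 'g) majid_bimodule" and \<phi> \<psi> :: "'v \<Rightarrow> 'v"
  assume "L \<in> obj (Majid_category K G \<Phi>)" "M \<in> obj (Majid_category K G \<Phi>)" "N \<in> obj (Majid_category K G \<Phi>)"
    and \<phi>: "\<phi> \<in> arr (Majid_category K G \<Phi>) L M"
  then have LM: "majid K G \<Phi> L" "majid K G \<Phi> M" by (simp_all add: Majid_category_def majidI)
  interpret L: majid K G \<Phi> L by fact
  have "\<phi> m \<in> bigraded_part M (gC C) \<one>" if "C \<in> conjugacy_classes G" "m \<in> bigraded_part L (gC C) \<one>" for C m
    using Majid_hom_part[OF _ LM gC_closed[OF that(1)] _ that(2), of \<phi>] \<phi> by (simp add: Majid_category_def)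
  then have "restrict (compose (carrier L) \<psi> \<phi>) (bigraded_part L (gC C) \<one>) =
      compose (bigraded_part L (gC C) \<one>) (restrict \<psi> (bigraded_part M (gC C) \<one>))
        (restrict \<phi> (bigraded_part L (gC C) \<one>))" if "C \<in> conjugacy_classes G" for C
    using L.partD that by (intro restrict_compose) auto
  then show "fibres_arr L N (cmp (Majid_category K G \<Phi>) L M N \<psi> \<phi>) =
      cmp reps_category (fibres L) (fibres M) (fibres N) (fibres_arr M N \<psi>) (fibres_arr L M \<phi>)"
    by (simp add: product_category_def fibres_def fibres_arr_def proj_rep_category_def
        Majid_category_def fibre_rep_def cong: restrict_cong)
qed

end

section \<open>Majid bimodules assembled from their homogeneous parts\<close>

definition fin_families ::
  "('g, 's) monoid_scheme \<Rightarrow> ('g \<Rightarrow> 'g \<Rightarrow> ('k, 'v, 'n) module_scheme) \<Rightarrow> ('g \<Rightarrow> 'g \<Rightarrow> 'v) set" where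
  "fin_families G W = {F. (\<forall>g\<in>carrier G. \<forall>h\<in>carrier G. F g h \<in> carrier (W g h)) \<and>
     finite {(g, h). g \<in> carrier G \<and> h \<in> carrier G \<and> F g h \<noteq> \<zero>\<^bsub>W g h\<^esub>}}"

text \<open>Families with the same values on \<open>G\<close> get the same encoding, and the encodings can be counted.\<close>

definition cut :: "('g, 's) monoid_scheme \<Rightarrow> ('g \<Rightarrow> 'g \<Rightarrow> 'v) \<Rightarrow> 'g \<times> 'g \<Rightarrow> 'v" where
  "cut G F = (\<lambda>(g, h)\<in>carrier G \<times> carrier G. F g h)"

text \<open>The components \<open>W g h\<close> with maps \<open>L\<close> and \<open>R\<close> between them are the homogeneous parts of a bimodule
whose elements would be finitely supported families. As the carrier must consist of elements of \<open>'v\<close>,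
an element is the code of a family under the injection \<open>J\<close>.\<close>

locale direct_sum_data = three_cocycle K G \<Phi>
  for K :: "('k, 'r) ring_scheme" and G :: "('g, 's) monoid_scheme" (structure)
    and \<Phi> :: "'g \<Rightarrow> 'g \<Rightarrow> 'g \<Rightarrow> 'k" +
  fixes W :: "'g \<Rightarrow> 'g \<Rightarrow> ('k, 'v, 'n) module_scheme"
    and L :: "'g \<Rightarrow> 'g \<Rightarrow> 'g \<Rightarrow> 'v \<Rightarrow> 'v" and R :: "'g \<Rightarrow> 'g \<Rightarrow> 'g \<Rightarrow> 'v \<Rightarrow> 'v"
    and J :: "('g \<times> 'g \<Rightarrow> 'v) \<Rightarrow> 'v"
  assumes W_module: "\<lbrakk>g \<in> carrier G; h \<in> carrier G\<rbrakk> \<Longrightarrow> module K (W g h)"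
    and L_linear: "\<lbrakk>e \<in> carrier G; g \<in> carrier G; h \<in> carrier G\<rbrakk> \<Longrightarrow>
      L e g h \<in> linear_maps K (W g h) (W (e \<otimes> g) (e \<otimes> h))"
    and R_linear: "\<lbrakk>e \<in> carrier G; g \<in> carrier G; h \<in> carrier G\<rbrakk> \<Longrightarrow>
      R e g h \<in> linear_maps K (W g h) (W (g \<otimes> e) (h \<otimes> e))"
    and L_one: "\<lbrakk>g \<in> carrier G; h \<in> carrier G; v \<in> carrier (W g h)\<rbrakk> \<Longrightarrow> L \<one> g h v = v"
    and R_one: "\<lbrakk>g \<in> carrier G; h \<in> carrier G; v \<in> carrier (W g h)\<rbrakk> \<Longrightarrow> R \<one> g h v = v"
    and L_L: "\<lbrakk>e \<in> carrier G; f \<in> carrier G; g \<in> carrier G; h \<in> carrier G; v \<in> carrier (W g h)\<rbrakk> \<Longrightarrow>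
      L e (f \<otimes> g) (f \<otimes> h) (L f g h v) =
      (\<Phi> e f g \<otimes>\<^bsub>K\<^esub> inv\<^bsub>K\<^esub> \<Phi> e f h) \<odot>\<^bsub>W (e \<otimes> f \<otimes> g) (e \<otimes> f \<otimes> h)\<^esub> L (e \<otimes> f) g h v"
    and R_R: "\<lbrakk>e \<in> carrier G; f \<in> carrier G; g \<in> carrier G; h \<in> carrier G; v \<in> carrier (W g h)\<rbrakk> \<Longrightarrow>
      R f (g \<otimes> e) (h \<otimes> e) (R e g h v) =
      (\<Phi> h e f \<otimes>\<^bsub>K\<^esub> inv\<^bsub>K\<^esub> \<Phi> g e f) \<odot>\<^bsub>W (g \<otimes> (e \<otimes> f)) (h \<otimes> (e \<otimes> f))\<^esub> R (e \<otimes> f) g h v"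
    and L_R: "\<lbrakk>e \<in> carrier G; f \<in> carrier G; g \<in> carrier G; h \<in> carrier G; v \<in> carrier (W g h)\<rbrakk> \<Longrightarrow>
      R f (e \<otimes> g) (e \<otimes> h) (L e g h v) =
      (\<Phi> e h f \<otimes>\<^bsub>K\<^esub> inv\<^bsub>K\<^esub> \<Phi> e g f) \<odot>\<^bsub>W (e \<otimes> g \<otimes> f) (e \<otimes> h \<otimes> f)\<^esub> L e (g \<otimes> f) (h \<otimes> f) (R f g h v)"
    and J_inj: "inj_on J (cut G ` fin_families G W)"
begin

abbreviation "fam F \<equiv> F \<in> fin_families G W"

definition assemble where "assemble F = J (cut G F)"

definition coord where "coord m g h = inv_into (cut G ` fin_families G W) J m (g, h)"

lemma fam_closed: "\<lbrakk>fam F; g \<in> carrier G; h \<in> carrier G\<rbrakk> \<Longrightarrow> F g h \<in> carrier (W g h)"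
  by (simp add: fin_families_def)

lemma fam_finite: "fam F \<Longrightarrow> finite {(g, h). g \<in> carrier G \<and> h \<in> carrier G \<and> F g h \<noteq> \<zero>\<^bsub>W g h\<^esub>}"
  by (simp add: fin_families_def)

lemma coord_assemble: "\<lbrakk>fam F; g \<in> carrier G; h \<in> carrier G\<rbrakk> \<Longrightarrow> coord (assemble F) g h = F g h"
  unfolding coord_def assemble_def by (simp add: inv_into_f_f[OF J_inj]) (simp add: cut_def)

lemma assemble_cong: "(\<And>g h. \<lbrakk>g \<in> carrier G; h \<in> carrier G\<rbrakk> \<Longrightarrow> F g h = F' g h) \<Longrightarrow> assemble F = assemble F'"
  unfolding assemble_def cut_def by (intro arg_cong[of _ _ J] restrict_ext) auto

definition sums where "sums = assemble ` fin_families G W"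

lemma assemble_sums [simp]: "fam F \<Longrightarrow> assemble F \<in> sums"
  by (simp add: sums_def)

lemma fam_cong:
  assumes "fam F" "\<And>g h. \<lbrakk>g \<in> carrier G; h \<in> carrier G\<rbrakk> \<Longrightarrow> F' g h = F g h"
  shows "fam F'"
proof -
  have "{(g, h). g \<in> carrier G \<and> h \<in> carrier G \<and> F' g h \<noteq> \<zero>\<^bsub>W g h\<^esub>} =
    {(g, h). g \<in> carrier G \<and> h \<in> carrier G \<and> F g h \<noteq> \<zero>\<^bsub>W g h\<^esub>}" using assms(2) by auto
  then show ?thesis using assms by (simp add: fin_families_def)
qed

lemma fam_coord: "m \<in> sums \<Longrightarrow> fam (coord m)"
  by (auto intro: fam_cong simp: coord_assemble sums_def)

lemma assemble_coord: "m \<in> sums \<Longrightarrow> assemble (coord m) = m"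
  by (auto intro: assemble_cong simp: coord_assemble sums_def)

lemma coord_closed [simp]: "\<lbrakk>m \<in> sums; g \<in> carrier G; h \<in> carrier G\<rbrakk> \<Longrightarrow> coord m g h \<in> carrier (W g h)"
  by (rule fam_closed[OF fam_coord])

lemma coord_ext:
  assumes "m \<in> sums" "n \<in> sums" "\<And>g h. \<lbrakk>g \<in> carrier G; h \<in> carrier G\<rbrakk> \<Longrightarrow> coord m g h = coord n g h"
  shows "m = n"
  using assemble_cong[of "coord m" "coord n"] assms(3) unfolding assemble_coord[OF assms(1)] assemble_coord[OF assms(2)] by blast

lemma famI:
  assumes "\<And>g h. \<lbrakk>g \<in> carrier G; h \<in> carrier G\<rbrakk> \<Longrightarrow> F g h \<in> carrier (W g h)" "finite S"
    "\<And>g h. \<lbrakk>g \<in> carrier G; h \<in> carrier G; (g, h) \<notin> S\<rbrakk> \<Longrightarrow> F g h = \<zero>\<^bsub>W g h\<^esub>"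
  shows "fam F"
proof -
  have "{(g, h). g \<in> carrier G \<and> h \<in> carrier G \<and> F g h \<noteq> \<zero>\<^bsub>W g h\<^esub>} \<subseteq> S" using assms(3) by auto
  then show ?thesis using assms(1) finite_subset[OF _ assms(2)] by (simp add: fin_families_def)
qed

definition supp where "supp F = {(g, h). g \<in> carrier G \<and> h \<in> carrier G \<and> F g h \<noteq> \<zero>\<^bsub>W g h\<^esub>}"

lemma supp_finite: "fam F \<Longrightarrow> finite (supp F)"
  using fam_finite by (simp add: supp_def)

lemma supp_outside: "\<lbrakk>g \<in> carrier G; h \<in> carrier G; (g, h) \<notin> supp F\<rbrakk> \<Longrightarrow> F g h = \<zero>\<^bsub>W g h\<^esub>"
  by (simp add: supp_def)

lemma W_ab: "\<lbrakk>g \<in> carrier G; h \<in> carrier G\<rbrakk> \<Longrightarrow> abelian_group (W g h)"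
  using W_module by (simp add: module_def)

lemma W_zero [simp]: "\<lbrakk>g \<in> carrier G; h \<in> carrier G\<rbrakk> \<Longrightarrow> \<zero>\<^bsub>W g h\<^esub> \<in> carrier (W g h)"
  using abelian_group.axioms(1)[OF W_ab] abelian_monoid.zero_closed by blast

lemma W_facts [simp]:
  assumes "g \<in> carrier G" "h \<in> carrier G"
  shows "\<lbrakk>x \<in> carrier (W g h); y \<in> carrier (W g h)\<rbrakk> \<Longrightarrow> x \<oplus>\<^bsub>W g h\<^esub> y \<in> carrier (W g h)"
    "x \<in> carrier (W g h) \<Longrightarrow> \<zero>\<^bsub>W g h\<^esub> \<oplus>\<^bsub>W g h\<^esub> x = x"
    "\<lbrakk>k \<in> carrier K; x \<in> carrier (W g h)\<rbrakk> \<Longrightarrow> k \<odot>\<^bsub>W g h\<^esub> x \<in> carrier (W g h)"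
    "k \<in> carrier K \<Longrightarrow> k \<odot>\<^bsub>W g h\<^esub> \<zero>\<^bsub>W g h\<^esub> = \<zero>\<^bsub>W g h\<^esub>"
    "x \<in> carrier (W g h) \<Longrightarrow> \<ominus>\<^bsub>W g h\<^esub> x \<in> carrier (W g h)"
    "x \<in> carrier (W g h) \<Longrightarrow> \<ominus>\<^bsub>W g h\<^esub> x \<oplus>\<^bsub>W g h\<^esub> x = \<zero>\<^bsub>W g h\<^esub>"
    "\<ominus>\<^bsub>W g h\<^esub> \<zero>\<^bsub>W g h\<^esub> = \<zero>\<^bsub>W g h\<^esub>"
    "x \<in> carrier (W g h) \<Longrightarrow> \<one>\<^bsub>K\<^esub> \<odot>\<^bsub>W g h\<^esub> x = x"
proof -
  interpret W: module K "W g h" using assms by (rule W_module)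
  show "\<lbrakk>x \<in> carrier (W g h); y \<in> carrier (W g h)\<rbrakk> \<Longrightarrow> x \<oplus>\<^bsub>W g h\<^esub> y \<in> carrier (W g h)"
    "x \<in> carrier (W g h) \<Longrightarrow> \<zero>\<^bsub>W g h\<^esub> \<oplus>\<^bsub>W g h\<^esub> x = x"
    "\<lbrakk>k \<in> carrier K; x \<in> carrier (W g h)\<rbrakk> \<Longrightarrow> k \<odot>\<^bsub>W g h\<^esub> x \<in> carrier (W g h)"
    "k \<in> carrier K \<Longrightarrow> k \<odot>\<^bsub>W g h\<^esub> \<zero>\<^bsub>W g h\<^esub> = \<zero>\<^bsub>W g h\<^esub>"
    "x \<in> carrier (W g h) \<Longrightarrow> \<ominus>\<^bsub>W g h\<^esub> x \<in> carrier (W g h)"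
    "x \<in> carrier (W g h) \<Longrightarrow> \<ominus>\<^bsub>W g h\<^esub> x \<oplus>\<^bsub>W g h\<^esub> x = \<zero>\<^bsub>W g h\<^esub>"
    "\<ominus>\<^bsub>W g h\<^esub> \<zero>\<^bsub>W g h\<^esub> = \<zero>\<^bsub>W g h\<^esub>"
    "x \<in> carrier (W g h) \<Longrightarrow> \<one>\<^bsub>K\<^esub> \<odot>\<^bsub>W g h\<^esub> x = x"
    by (simp_all add: W.M.l_neg W.M.add.inv_one)
qed

lemma fam_zero: "fam (\<lambda>g h. \<zero>\<^bsub>W g h\<^esub>)"
  by (rule famI[of _ "{}"]) simp_all

lemma fam_add: "\<lbrakk>fam F; fam F'\<rbrakk> \<Longrightarrow> fam (\<lambda>g h. F g h \<oplus>\<^bsub>W g h\<^esub> F' g h)"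
  by (rule famI[of _ "supp F \<union> supp F'"]) (simp_all add: fam_closed supp_finite supp_outside[of _ _ F] supp_outside[of _ _ F'])

lemma fam_smult: "\<lbrakk>fam F; k \<in> carrier K\<rbrakk> \<Longrightarrow> fam (\<lambda>g h. k \<odot>\<^bsub>W g h\<^esub> F g h)"
  by (rule famI[of _ "supp F"]) (simp_all add: fam_closed supp_finite supp_outside[of _ _ F])

lemma fam_minus: "fam F \<Longrightarrow> fam (\<lambda>g h. \<ominus>\<^bsub>W g h\<^esub> F g h)"
  by (rule famI[of _ "supp F"]) (simp_all add: fam_closed supp_finite supp_outside[of _ _ F])

lemma fam_if: "fam F \<Longrightarrow> fam (\<lambda>g h. if P g h then F g h else \<zero>\<^bsub>W g h\<^esub>)"
  by (rule famI[of _ "supp F"]) (simp_all add: fam_closed supp_finite supp_outside[of _ _ F])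

lemma fam_single:
  assumes "v \<in> carrier (W x y)"
  shows "fam (\<lambda>g h. if g = x \<and> h = y then v else \<zero>\<^bsub>W g h\<^esub>)"
  by (rule famI[of _ "{(x, y)}"]) (use assms in auto)

lemma L_closed [simp]:
  assumes "e \<in> carrier G" "g \<in> carrier G" "h \<in> carrier G" "v \<in> carrier (W g h)"
  shows "L e g h v \<in> carrier (W (e \<otimes> g) (e \<otimes> h))"
  using linear_maps_closed[OF L_linear] assms by simp

lemma R_closed [simp]:
  assumes "e \<in> carrier G" "g \<in> carrier G" "h \<in> carrier G" "v \<in> carrier (W g h)"
  shows "R e g h v \<in> carrier (W (g \<otimes> e) (h \<otimes> e))"
  using linear_maps_closed[OF R_linear] assms by simp

lemma L_zero [simp]:
  assumes "e \<in> carrier G" "g \<in> carrier G" "h \<in> carrier G"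
  shows "L e g h \<zero>\<^bsub>W g h\<^esub> = \<zero>\<^bsub>W (e \<otimes> g) (e \<otimes> h)\<^esub>"
  using linear_maps_zero[OF L_linear W_ab W_ab] assms by simp

lemma R_zero [simp]:
  assumes "e \<in> carrier G" "g \<in> carrier G" "h \<in> carrier G"
  shows "R e g h \<zero>\<^bsub>W g h\<^esub> = \<zero>\<^bsub>W (g \<otimes> e) (h \<otimes> e)\<^esub>"
  using linear_maps_zero[OF R_linear W_ab W_ab] assms by simp

lemma L_shift: "\<lbrakk>e \<in> carrier G; g \<in> carrier G\<rbrakk> \<Longrightarrow> e \<otimes> (inv e \<otimes> g) = g" "\<lbrakk>e \<in> carrier G; g \<in> carrier G\<rbrakk> \<Longrightarrow> inv e \<otimes> (e \<otimes> g) = g"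
  by (simp_all flip: G.m_assoc)

lemma R_shift: "\<lbrakk>e \<in> carrier G; g \<in> carrier G\<rbrakk> \<Longrightarrow> g \<otimes> inv e \<otimes> e = g" "\<lbrakk>e \<in> carrier G; g \<in> carrier G\<rbrakk> \<Longrightarrow> g \<otimes> e \<otimes> inv e = g"
  by (simp_all add: G.m_assoc)

definition shiftL where
  "shiftL e F g h = L e (inv e \<otimes> g) (inv e \<otimes> h) (F (inv e \<otimes> g) (inv e \<otimes> h))"

definition shiftR where
  "shiftR e F g h = R e (g \<otimes> inv e) (h \<otimes> inv e) (F (g \<otimes> inv e) (h \<otimes> inv e))"

lemma fam_shiftL:
  assumes F: "fam F" and e: "e \<in> carrier G"
  shows "fam (shiftL e F)"
proof (rule famI[of _ "(\<lambda>(g, h). (e \<otimes> g, e \<otimes> h)) ` supp F"])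
  fix g h assume gh: "g \<in> carrier G" "h \<in> carrier G"
  then show "shiftL e F g h \<in> carrier (W g h)"
    using L_closed[OF e, of "inv e \<otimes> g" "inv e \<otimes> h"] e fam_closed[OF F] by (simp add: shiftL_def L_shift)
  assume "(g, h) \<notin> (\<lambda>(g, h). (e \<otimes> g, e \<otimes> h)) ` supp F"
  then have "(inv e \<otimes> g, inv e \<otimes> h) \<notin> supp F" using gh e by (force simp: L_shift image_iff)
  then show "shiftL e F g h = \<zero>\<^bsub>W g h\<^esub>"
    using gh e L_zero[OF e, of "inv e \<otimes> g" "inv e \<otimes> h"] by (simp add: shiftL_def supp_outside[of _ _ F] L_shift)
qed (use supp_finite[OF F] in simp)

lemma fam_shiftR:
  assumes F: "fam F" and e: "e \<in> carrier G"
  shows "fam (shiftR e F)"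
proof (rule famI[of _ "(\<lambda>(g, h). (g \<otimes> e, h \<otimes> e)) ` supp F"])
  fix g h assume gh: "g \<in> carrier G" "h \<in> carrier G"
  then show "shiftR e F g h \<in> carrier (W g h)"
    using R_closed[OF e, of "g \<otimes> inv e" "h \<otimes> inv e"] e fam_closed[OF F] by (simp add: shiftR_def R_shift)
  assume "(g, h) \<notin> (\<lambda>(g, h). (g \<otimes> e, h \<otimes> e)) ` supp F"
  then have "(g \<otimes> inv e, h \<otimes> inv e) \<notin> supp F" using gh e by (force simp: R_shift image_iff)
  then show "shiftR e F g h = \<zero>\<^bsub>W g h\<^esub>"
    using gh e R_zero[OF e, of "g \<otimes> inv e" "h \<otimes> inv e"] by (simp add: shiftR_def supp_outside[of _ _ F] R_shift)
qed (use supp_finite[OF F] in simp)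

definition dsum :: "('k, 'v, 'g) majid_bimodule" where
  "dsum = \<lparr>carrier = sums, mult = undefined, one = undefined, ring.zero = assemble (\<lambda>g h. \<zero>\<^bsub>W g h\<^esub>),
     add = (\<lambda>m n. assemble (\<lambda>g h. coord m g h \<oplus>\<^bsub>W g h\<^esub> coord n g h)),
     smult = (\<lambda>k m. assemble (\<lambda>g h. k \<odot>\<^bsub>W g h\<^esub> coord m g h)),
     lcoact = (\<lambda>m x. assemble (\<lambda>g h. if g = x then coord m g h else \<zero>\<^bsub>W g h\<^esub>)),
     rcoact = (\<lambda>m x. assemble (\<lambda>g h. if h = x then coord m g h else \<zero>\<^bsub>W g h\<^esub>)),
     lact = (\<lambda>e m. assemble (shiftL e (coord m))), ract = (\<lambda>m e. assemble (shiftR e (coord m)))\<rparr>"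

lemma carrier_dsum [simp]: "carrier dsum = sums"
  by (simp add: dsum_def)

lemma dsum_closed [simp]:
  "\<zero>\<^bsub>dsum\<^esub> \<in> sums"
  "\<lbrakk>m \<in> sums; n \<in> sums\<rbrakk> \<Longrightarrow> m \<oplus>\<^bsub>dsum\<^esub> n \<in> sums"
  "\<lbrakk>k \<in> carrier K; m \<in> sums\<rbrakk> \<Longrightarrow> k \<odot>\<^bsub>dsum\<^esub> m \<in> sums"
  "m \<in> sums \<Longrightarrow> lcoact dsum m x \<in> sums" "m \<in> sums \<Longrightarrow> rcoact dsum m x \<in> sums"
  "\<lbrakk>m \<in> sums; e \<in> carrier G\<rbrakk> \<Longrightarrow> lact dsum e m \<in> sums" "\<lbrakk>m \<in> sums; e \<in> carrier G\<rbrakk> \<Longrightarrow> ract dsum m e \<in> sums"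
  unfolding dsum_def
  by (simp_all add: fam_zero fam_add fam_smult fam_if fam_shiftL fam_shiftR fam_coord)

lemma coord_dsum [simp]:
  assumes gh [simp]: "g \<in> carrier G" "h \<in> carrier G"
  shows "coord \<zero>\<^bsub>dsum\<^esub> g h = \<zero>\<^bsub>W g h\<^esub>"
    "\<lbrakk>m \<in> sums; n \<in> sums\<rbrakk> \<Longrightarrow> coord (m \<oplus>\<^bsub>dsum\<^esub> n) g h = coord m g h \<oplus>\<^bsub>W g h\<^esub> coord n g h"
    "\<lbrakk>k \<in> carrier K; m \<in> sums\<rbrakk> \<Longrightarrow> coord (k \<odot>\<^bsub>dsum\<^esub> m) g h = k \<odot>\<^bsub>W g h\<^esub> coord m g h"
    "m \<in> sums \<Longrightarrow> coord (lcoact dsum m x) g h = (if g = x then coord m g h else \<zero>\<^bsub>W g h\<^esub>)"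
    "m \<in> sums \<Longrightarrow> coord (rcoact dsum m x) g h = (if h = x then coord m g h else \<zero>\<^bsub>W g h\<^esub>)"
    "\<lbrakk>m \<in> sums; e \<in> carrier G\<rbrakk> \<Longrightarrow> coord (lact dsum e m) g h = shiftL e (coord m) g h"
    "\<lbrakk>m \<in> sums; e \<in> carrier G\<rbrakk> \<Longrightarrow> coord (ract dsum m e) g h = shiftR e (coord m) g h"
  unfolding dsum_def
  by (simp_all add: coord_assemble fam_zero fam_add fam_smult fam_if fam_shiftL fam_shiftR fam_coord)

lemma module_dsum: "module K dsum"
proof (rule moduleI)
  show "abelian_group dsum"
  proof (rule abelian_groupI)
    fix x y z assume xyz: "x \<in> carrier dsum" "y \<in> carrier dsum" "z \<in> carrier dsum"
    show "x \<oplus>\<^bsub>dsum\<^esub> y \<oplus>\<^bsub>dsum\<^esub> z = x \<oplus>\<^bsub>dsum\<^esub> (y \<oplus>\<^bsub>dsum\<^esub> z)"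
      by (rule coord_ext) (use xyz abelian_monoid.a_assoc[OF abelian_group.axioms(1)[OF W_ab]] in simp_all)
  next
    fix x y assume xy: "x \<in> carrier dsum" "y \<in> carrier dsum"
    show "x \<oplus>\<^bsub>dsum\<^esub> y = y \<oplus>\<^bsub>dsum\<^esub> x"
      by (rule coord_ext) (use xy abelian_monoid.a_comm[OF abelian_group.axioms(1)[OF W_ab]] in simp_all)
  next
    fix x assume x: "x \<in> carrier dsum"
    show "\<zero>\<^bsub>dsum\<^esub> \<oplus>\<^bsub>dsum\<^esub> x = x" by (rule coord_ext) (use x in simp_all)
    let ?y = "assemble (\<lambda>g h. \<ominus>\<^bsub>W g h\<^esub> coord x g h)"
    have y: "?y \<in> sums" "\<And>g h. \<lbrakk>g \<in> carrier G; h \<in> carrier G\<rbrakk> \<Longrightarrow> coord ?y g h = \<ominus>\<^bsub>W g h\<^esub> coord x g h"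
      using x by (simp_all add: fam_minus fam_coord coord_assemble)
    have "?y \<oplus>\<^bsub>dsum\<^esub> x = \<zero>\<^bsub>dsum\<^esub>" by (rule coord_ext) (use x y in simp_all)
    then show "\<exists>y\<in>carrier dsum. y \<oplus>\<^bsub>dsum\<^esub> x = \<zero>\<^bsub>dsum\<^esub>" using y(1) by (intro bexI[of _ ?y]) simp_all
  qed simp_all
next
  fix a b x assume "a \<in> carrier K" "b \<in> carrier K" "x \<in> carrier dsum"
  note abx = this[simplified]
  show "(a \<oplus>\<^bsub>K\<^esub> b) \<odot>\<^bsub>dsum\<^esub> x = a \<odot>\<^bsub>dsum\<^esub> x \<oplus>\<^bsub>dsum\<^esub> b \<odot>\<^bsub>dsum\<^esub> x"
    by (rule coord_ext) (use abx module.smult_l_distr[OF W_module] in simp_all)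
  show "(a \<otimes>\<^bsub>K\<^esub> b) \<odot>\<^bsub>dsum\<^esub> x = a \<odot>\<^bsub>dsum\<^esub> (b \<odot>\<^bsub>dsum\<^esub> x)"
    by (rule coord_ext) (use abx module.smult_assoc1[OF W_module] in simp_all)
next
  fix a x y assume "a \<in> carrier K" "x \<in> carrier dsum" "y \<in> carrier dsum"
  note axy = this[simplified]
  show "a \<odot>\<^bsub>dsum\<^esub> (x \<oplus>\<^bsub>dsum\<^esub> y) = a \<odot>\<^bsub>dsum\<^esub> x \<oplus>\<^bsub>dsum\<^esub> a \<odot>\<^bsub>dsum\<^esub> y"
    by (rule coord_ext) (use axy module.smult_r_distr[OF W_module] in simp_all)
next
  fix x assume x: "x \<in> carrier dsum"
  show "\<one>\<^bsub>K\<^esub> \<odot>\<^bsub>dsum\<^esub> x = x" by (rule coord_ext) (use x in simp_all)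
qed (simp_all add: K.is_cring)

lemma coord_linear: "\<lbrakk>g \<in> carrier G; h \<in> carrier G\<rbrakk> \<Longrightarrow> (\<lambda>m. coord m g h) \<in> linear_maps K dsum (W g h)"
  by (simp add: linear_maps_def)

lemma coact_outside_dsum:
  "\<lbrakk>x \<notin> carrier G\<rbrakk> \<Longrightarrow> lcoact dsum m x = \<zero>\<^bsub>dsum\<^esub>" "\<lbrakk>x \<notin> carrier G\<rbrakk> \<Longrightarrow> rcoact dsum m x = \<zero>\<^bsub>dsum\<^esub>"
  by (auto simp: dsum_def intro!: assemble_cong)

text \<open>Both coactions of the direct sum are of the form treated here, with \<open>p\<close> the left or the right degree.\<close>

lemma dsum_coactionI:
  assumes closed: "\<And>m x. m \<in> sums \<Longrightarrow> \<delta> m x \<in> sums"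
    and coord: "\<And>m x g h. \<lbrakk>m \<in> sums; g \<in> carrier G; h \<in> carrier G\<rbrakk> \<Longrightarrow>
      coord (\<delta> m x) g h = (if p g h = x then coord m g h else \<zero>\<^bsub>W g h\<^esub>)"
    and p: "\<And>g h. \<lbrakk>g \<in> carrier G; h \<in> carrier G\<rbrakk> \<Longrightarrow> p g h \<in> carrier G"
    and out: "\<And>m x. x \<notin> carrier G \<Longrightarrow> \<delta> m x = \<zero>\<^bsub>dsum\<^esub>"
  shows "kG_coaction K G dsum \<delta>"
  unfolding kG_coaction_def
proof (intro conjI ballI)
  interpret D: module K dsum by (rule module_dsum)
  fix m assume "m \<in> carrier dsum"
  then have m: "m \<in> sums" by simp
  have "{x. \<delta> m x \<noteq> \<zero>\<^bsub>dsum\<^esub>} \<subseteq> (\<lambda>(g, h). p g h) ` supp (coord m)"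
  proof (rule subsetI, rule ccontr)
    fix x assume x: "x \<in> {x. \<delta> m x \<noteq> \<zero>\<^bsub>dsum\<^esub>}" "x \<notin> (\<lambda>(g, h). p g h) ` supp (coord m)"
    have "\<delta> m x = \<zero>\<^bsub>dsum\<^esub>"
    proof (rule coord_ext)
      fix g h assume gh: "g \<in> carrier G" "h \<in> carrier G"
      have "(g, h) \<notin> supp (coord m)" if "p g h = x" using x(2) that by force
      then show "coord (\<delta> m x) g h = coord \<zero>\<^bsub>dsum\<^esub> g h" using gh m by (simp add: coord supp_outside[of _ _ "coord m"])
    qed (use m closed in simp_all)
    then show False using x(1) by simp
  qed
  then have fin: "finite {x. \<delta> m x \<noteq> \<zero>\<^bsub>dsum\<^esub>}"
    by (rule finite_subset) (use supp_finite[OF fam_coord[OF m]] in simp)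
  then show "\<delta> m \<in> tensor_kG G dsum"
    using closed[OF m] out by (simp add: tensor_kG_def)
  let ?S = "{x \<in> carrier G. \<delta> m x \<noteq> \<zero>\<^bsub>dsum\<^esub>}"
  have S: "finite ?S" "\<delta> m \<in> ?S \<rightarrow> carrier dsum" using fin closed[OF m] by simp_all
  show "finsum dsum (\<delta> m) ?S = m"
  proof (rule coord_ext)
    show "finsum dsum (\<delta> m) ?S \<in> sums" using D.M.finsum_closed[OF S(2)] by simp
    fix g h assume gh: "g \<in> carrier G" "h \<in> carrier G"
    interpret W: module K "W g h" using gh by (rule W_module)
    have "coord (finsum dsum (\<delta> m) ?S) g h = finsum (W g h) (\<lambda>x. coord (\<delta> m x) g h) ?S"
      by (rule linear_maps_finsum[OF coord_linear[OF gh] D.M.abelian_group_axioms W.M.abelian_group_axioms S])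
    also have "\<dots> = finsum (W g h) (\<lambda>x. if p g h = x then coord m g h else \<zero>\<^bsub>W g h\<^esub>) ?S"
      using gh m by (intro W.M.finsum_cong') (auto simp: coord)
    also have "\<dots> = coord m g h"
    proof (cases "p g h \<in> ?S")
      case True
      then show ?thesis using W.M.finsum_singleton[OF True S(1), of "\<lambda>_. coord m g h"] gh m by simp
    next
      case False
      then have "\<delta> m (p g h) = \<zero>\<^bsub>dsum\<^esub>" using p[OF gh] by simp
      then have "coord m g h = \<zero>\<^bsub>W g h\<^esub>" using coord[OF m gh, of "p g h"] gh by simp
      then have "(\<lambda>x. if p g h = x then coord m g h else \<zero>\<^bsub>W g h\<^esub>) = (\<lambda>x. \<zero>\<^bsub>W g h\<^esub>)" by auto
      then show ?thesis using \<open>coord m g h = _\<close> by (simp add: W.M.finsum_zero)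
    qed
    finally show "coord (finsum dsum (\<delta> m) ?S) g h = coord m g h" .
  qed (rule m)
  fix x assume x: "x \<in> carrier G"
  show "\<delta> (\<delta> m x) = pure_tensor dsum x (\<delta> m x)"
  proof
    fix y
    have "\<delta> (\<delta> m x) y = (if y = x then \<delta> m x else \<zero>\<^bsub>dsum\<^esub>)"
      by (rule coord_ext) (use m closed in \<open>simp_all add: coord\<close>)
    then show "\<delta> (\<delta> m x) y = pure_tensor dsum x (\<delta> m x) y" by (simp add: pure_tensor_def)
  qed
next
  fix x assume x: "x \<in> carrier G"
  show "(\<lambda>m. \<delta> m x) \<in> linear_maps K dsum dsum"
    unfolding linear_maps_def
  proof (intro CollectI conjI ballI)
    fix m n assume mn: "m \<in> carrier dsum" "n \<in> carrier dsum"
    show "\<delta> (m \<oplus>\<^bsub>dsum\<^esub> n) x = \<delta> m x \<oplus>\<^bsub>dsum\<^esub> \<delta> n x"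
      by (rule coord_ext) (use mn closed in \<open>simp_all add: coord\<close>)
  next
    fix k m assume mn: "k \<in> carrier K" "m \<in> carrier dsum"
    show "\<delta> (k \<odot>\<^bsub>dsum\<^esub> m) x = k \<odot>\<^bsub>dsum\<^esub> \<delta> m x"
      by (rule coord_ext) (use mn closed in \<open>simp_all add: coord\<close>)
  qed (use closed in simp)
qed

lemma bigraded_part_dsum:
  assumes [simp]: "x \<in> carrier G" "y \<in> carrier G"
  shows "m \<in> bigraded_part dsum x y \<longleftrightarrow> m \<in> sums \<and>
    (\<forall>g\<in>carrier G. \<forall>h\<in>carrier G. g = x \<and> h = y \<or> coord m g h = \<zero>\<^bsub>W g h\<^esub>)" (is "?l \<longleftrightarrow> ?r")
proof
  assume ?l
  then have m: "m \<in> sums" and "lcoact dsum m x = m" "rcoact dsum m y = m"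
    by (simp_all add: bigraded_part_def pure_tensor_def)
  then have "coord m g h = (if g = x then coord m g h else \<zero>\<^bsub>W g h\<^esub>)"
    "coord m g h = (if h = y then coord m g h else \<zero>\<^bsub>W g h\<^esub>)" if "g \<in> carrier G" "h \<in> carrier G" for g h
    using coord_dsum(4)[OF that m, of x] coord_dsum(5)[OF that m, of y] by simp_all
  then show ?r using m by metis
next
  assume r: ?r
  then have m: "m \<in> sums" by simp
  have z: "coord m g h = \<zero>\<^bsub>W g h\<^esub>" if "g \<in> carrier G" "h \<in> carrier G" "\<not> (g = x \<and> h = y)" for g h
    using r that by blast
  have l: "lcoact dsum m u = (if u = x then m else \<zero>\<^bsub>dsum\<^esub>)" for u
    by (rule coord_ext) (use m in \<open>auto simp: z\<close>)
  have "rcoact dsum m u = (if u = y then m else \<zero>\<^bsub>dsum\<^esub>)" for u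
    by (rule coord_ext) (use m in \<open>auto simp: z\<close>)
  with l show ?l using m by (auto simp: bigraded_part_def pure_tensor_def fun_eq_iff)
qed

lemma shiftL_at:
  "\<lbrakk>e \<in> carrier G; a \<in> carrier G; b \<in> carrier G\<rbrakk> \<Longrightarrow> shiftL e F (e \<otimes> a) (e \<otimes> b) = L e a b (F a b)"
  by (simp add: shiftL_def L_shift)

lemma shiftR_at:
  "\<lbrakk>e \<in> carrier G; a \<in> carrier G; b \<in> carrier G\<rbrakk> \<Longrightarrow> shiftR e F (a \<otimes> e) (b \<otimes> e) = R e a b (F a b)"
  by (simp add: shiftR_def R_shift)

lemma coord_ext_L:
  assumes "m \<in> sums" "n \<in> sums" "e \<in> carrier G"
    "\<And>g h. \<lbrakk>g \<in> carrier G; h \<in> carrier G\<rbrakk> \<Longrightarrow> coord m (e \<otimes> g) (e \<otimes> h) = coord n (e \<otimes> g) (e \<otimes> h)"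
  shows "m = n"
proof (rule coord_ext[OF assms(1,2)])
  fix g h assume "g \<in> carrier G" "h \<in> carrier G"
  then show "coord m g h = coord n g h" using assms(4)[of "inv e \<otimes> g" "inv e \<otimes> h"] assms(3) by (simp add: L_shift)
qed

lemma coord_ext_R:
  assumes "m \<in> sums" "n \<in> sums" "e \<in> carrier G"
    "\<And>g h. \<lbrakk>g \<in> carrier G; h \<in> carrier G\<rbrakk> \<Longrightarrow> coord m (g \<otimes> e) (h \<otimes> e) = coord n (g \<otimes> e) (h \<otimes> e)"
  shows "m = n"
proof (rule coord_ext[OF assms(1,2)])
  fix g h assume "g \<in> carrier G" "h \<in> carrier G"
  then show "coord m g h = coord n g h" using assms(4)[of "g \<otimes> inv e" "h \<otimes> inv e"] assms(3) by (simp add: R_shift)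
qed

lemma dsum_lact_linear:
  assumes e [simp]: "e \<in> carrier G"
  shows "lact dsum e \<in> linear_maps K dsum dsum"
  unfolding linear_maps_def
proof (intro CollectI conjI ballI)
  fix m n assume mn: "m \<in> carrier dsum" "n \<in> carrier dsum"
  show "lact dsum e (m \<oplus>\<^bsub>dsum\<^esub> n) = lact dsum e m \<oplus>\<^bsub>dsum\<^esub> lact dsum e n"
    by (rule coord_ext_L[OF _ _ e]) (use mn in \<open>simp_all add: shiftL_at linear_maps_add[OF L_linear]\<close>)
next
  fix k m assume mn: "k \<in> carrier K" "m \<in> carrier dsum"
  show "lact dsum e (k \<odot>\<^bsub>dsum\<^esub> m) = k \<odot>\<^bsub>dsum\<^esub> lact dsum e m"
    by (rule coord_ext_L[OF _ _ e]) (use mn in \<open>simp_all add: shiftL_at linear_maps_smult[OF L_linear]\<close>)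
qed simp

lemma dsum_ract_linear:
  assumes e [simp]: "e \<in> carrier G"
  shows "(\<lambda>m. ract dsum m e) \<in> linear_maps K dsum dsum"
  unfolding linear_maps_def
proof (intro CollectI conjI ballI)
  fix m n assume mn: "m \<in> carrier dsum" "n \<in> carrier dsum"
  show "ract dsum (m \<oplus>\<^bsub>dsum\<^esub> n) e = ract dsum m e \<oplus>\<^bsub>dsum\<^esub> ract dsum n e"
    by (rule coord_ext_R[OF _ _ e]) (use mn in \<open>simp_all add: shiftR_at linear_maps_add[OF R_linear]\<close>)
next
  fix k m assume mn: "k \<in> carrier K" "m \<in> carrier dsum"
  show "ract dsum (k \<odot>\<^bsub>dsum\<^esub> m) e = k \<odot>\<^bsub>dsum\<^esub> ract dsum m e"
    by (rule coord_ext_R[OF _ _ e]) (use mn in \<open>simp_all add: shiftR_at linear_maps_smult[OF R_linear]\<close>)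
qed simp

lemma Majid_bimodule_dsum: "Majid_bimodule K dsum G \<Phi>"
proof (intro Majid_bimodule.intro module_dsum Majid_bimodule_axioms.intro dsum_lact_linear dsum_ract_linear)
  show "kG_coaction K G dsum (lcoact dsum)"
    by (rule dsum_coactionI[where p = "\<lambda>g h. g"]) (simp_all add: coact_outside_dsum)
  show "kG_coaction K G dsum (rcoact dsum)"
    by (rule dsum_coactionI[where p = "\<lambda>g h. h"]) (simp_all add: coact_outside_dsum)
next
  fix m x y assume m: "m \<in> carrier dsum" and xy [simp]: "x \<in> carrier G" "y \<in> carrier G"
  show "rcoact dsum (lcoact dsum m x) y = lcoact dsum (rcoact dsum m y) x"
    by (rule coord_ext) (use m in simp_all)
  show "lcoact dsum (lact dsum x m) (x \<otimes> y) = lact dsum x (lcoact dsum m y)"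
    by (rule coord_ext_L[OF _ _ xy(1)]) (use m in \<open>simp_all add: shiftL_at\<close>)
  show "rcoact dsum (lact dsum x m) (x \<otimes> y) = lact dsum x (rcoact dsum m y)"
    by (rule coord_ext_L[OF _ _ xy(1)]) (use m in \<open>simp_all add: shiftL_at\<close>)
  show "lcoact dsum (ract dsum m x) (y \<otimes> x) = ract dsum (lcoact dsum m y) x"
    by (rule coord_ext_R[OF _ _ xy(1)]) (use m in \<open>simp_all add: shiftR_at\<close>)
  show "rcoact dsum (ract dsum m x) (y \<otimes> x) = ract dsum (rcoact dsum m y) x"
    by (rule coord_ext_R[OF _ _ xy(1)]) (use m in \<open>simp_all add: shiftR_at\<close>)
next
  fix m assume m: "m \<in> carrier dsum"
  show "lact dsum \<one> m = m" by (rule coord_ext) (use m in \<open>simp_all add: shiftL_def L_one\<close>)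
  show "ract dsum m \<one> = m" by (rule coord_ext) (use m in \<open>simp_all add: shiftR_def R_one\<close>)
next
  fix e f x y m assume efxy [simp]: "e \<in> carrier G" "f \<in> carrier G" "x \<in> carrier G" "y \<in> carrier G"
    and "m \<in> bigraded_part dsum x y"
  then have m [simp]: "m \<in> sums"
    and z: "\<And>g h. \<lbrakk>g \<in> carrier G; h \<in> carrier G; \<not> (g = x \<and> h = y)\<rbrakk> \<Longrightarrow> coord m g h = \<zero>\<^bsub>W g h\<^esub>"
    by (auto simp: bigraded_part_dsum)
  note [simp] = shiftL_at shiftR_at
  show "lact dsum e (lact dsum f m) = (\<Phi> e f x \<otimes>\<^bsub>K\<^esub> inv\<^bsub>K\<^esub> \<Phi> e f y) \<odot>\<^bsub>dsum\<^esub> lact dsum (e \<otimes> f) m"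
  proof (rule coord_ext_L[of _ _ "e \<otimes> f"])
    fix g h assume [simp]: "g \<in> carrier G" "h \<in> carrier G"
    have "coord (lact dsum e (lact dsum f m)) (e \<otimes> (f \<otimes> g)) (e \<otimes> (f \<otimes> h)) = L e (f \<otimes> g) (f \<otimes> h) (L f g h (coord m g h))"
      by simp
    also have "\<dots> = (\<Phi> e f x \<otimes>\<^bsub>K\<^esub> inv\<^bsub>K\<^esub> \<Phi> e f y) \<odot>\<^bsub>W (e \<otimes> f \<otimes> g) (e \<otimes> f \<otimes> h)\<^esub> L (e \<otimes> f) g h (coord m g h)"
    proof (cases "g = x \<and> h = y")
      case True
      then show ?thesis using L_L[of e f x y "coord m x y"] by simp
    next
      case False
      then show ?thesis by (simp add: z) (simp add: G.m_assoc)
    qed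
    also have "\<dots> = coord ((\<Phi> e f x \<otimes>\<^bsub>K\<^esub> inv\<^bsub>K\<^esub> \<Phi> e f y) \<odot>\<^bsub>dsum\<^esub> lact dsum (e \<otimes> f) m) (e \<otimes> f \<otimes> g) (e \<otimes> f \<otimes> h)"
      by simp
    finally show "coord (lact dsum e (lact dsum f m)) (e \<otimes> f \<otimes> g) (e \<otimes> f \<otimes> h) = \<dots>" by (simp add: G.m_assoc)
  qed simp_all
  show "ract dsum (ract dsum m e) f = (\<Phi> y e f \<otimes>\<^bsub>K\<^esub> inv\<^bsub>K\<^esub> \<Phi> x e f) \<odot>\<^bsub>dsum\<^esub> ract dsum m (e \<otimes> f)"
  proof (rule coord_ext_R[of _ _ "e \<otimes> f"])
    fix g h assume [simp]: "g \<in> carrier G" "h \<in> carrier G"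
    have "coord (ract dsum (ract dsum m e) f) (g \<otimes> e \<otimes> f) (h \<otimes> e \<otimes> f) = R f (g \<otimes> e) (h \<otimes> e) (R e g h (coord m g h))"
      by simp
    also have "\<dots> = (\<Phi> y e f \<otimes>\<^bsub>K\<^esub> inv\<^bsub>K\<^esub> \<Phi> x e f) \<odot>\<^bsub>W (g \<otimes> (e \<otimes> f)) (h \<otimes> (e \<otimes> f))\<^esub> R (e \<otimes> f) g h (coord m g h)"
    proof (cases "g = x \<and> h = y")
      case True
      then show ?thesis using R_R[of e f x y "coord m x y"] by simp
    next
      case False
      then show ?thesis by (simp add: z) (simp add: G.m_assoc)
    qed
    also have "\<dots> = coord ((\<Phi> y e f \<otimes>\<^bsub>K\<^esub> inv\<^bsub>K\<^esub> \<Phi> x e f) \<odot>\<^bsub>dsum\<^esub> ract dsum m (e \<otimes> f)) (g \<otimes> (e \<otimes> f)) (h \<otimes> (e \<otimes> f))"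
      by simp
    finally show "coord (ract dsum (ract dsum m e) f) (g \<otimes> (e \<otimes> f)) (h \<otimes> (e \<otimes> f)) = \<dots>" by (simp add: G.m_assoc)
  qed simp_all
  show "ract dsum (lact dsum e m) f = (\<Phi> e y f \<otimes>\<^bsub>K\<^esub> inv\<^bsub>K\<^esub> \<Phi> e x f) \<odot>\<^bsub>dsum\<^esub> lact dsum e (ract dsum m f)"
  proof (rule coord_ext)
    fix g' h' assume [simp]: "g' \<in> carrier G" "h' \<in> carrier G"
    define g h where "g = inv e \<otimes> g' \<otimes> inv f" and "h = inv e \<otimes> h' \<otimes> inv f"
    have [simp]: "g \<in> carrier G" "h \<in> carrier G" by (simp_all add: g_def h_def)
    have g': "g' = e \<otimes> g \<otimes> f" "h' = e \<otimes> h \<otimes> f" by (simp_all add: g_def h_def G.m_assoc L_shift)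
    have "coord (ract dsum (lact dsum e m) f) (e \<otimes> g \<otimes> f) (e \<otimes> h \<otimes> f) = R f (e \<otimes> g) (e \<otimes> h) (L e g h (coord m g h))"
      by simp
    also have "\<dots> = (\<Phi> e y f \<otimes>\<^bsub>K\<^esub> inv\<^bsub>K\<^esub> \<Phi> e x f) \<odot>\<^bsub>W (e \<otimes> g \<otimes> f) (e \<otimes> h \<otimes> f)\<^esub> L e (g \<otimes> f) (h \<otimes> f) (R f g h (coord m g h))"
    proof (cases "g = x \<and> h = y")
      case True
      then show ?thesis using L_R[of e f x y "coord m x y"] by simp
    next
      case False
      then show ?thesis by (simp add: z) (simp add: G.m_assoc)
    qed
    also have "\<dots> = (\<Phi> e y f \<otimes>\<^bsub>K\<^esub> inv\<^bsub>K\<^esub> \<Phi> e x f) \<odot>\<^bsub>W (e \<otimes> g \<otimes> f) (e \<otimes> h \<otimes> f)\<^esub>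
        coord (lact dsum e (ract dsum m f)) (e \<otimes> (g \<otimes> f)) (e \<otimes> (h \<otimes> f))"
      by simp
    also have "\<dots> = coord ((\<Phi> e y f \<otimes>\<^bsub>K\<^esub> inv\<^bsub>K\<^esub> \<Phi> e x f) \<odot>\<^bsub>dsum\<^esub> lact dsum e (ract dsum m f)) (e \<otimes> g \<otimes> f) (e \<otimes> h \<otimes> f)"
      by (simp add: G.m_assoc)
    finally show "coord (ract dsum (lact dsum e m) f) g' h' = coord ((\<Phi> e y f \<otimes>\<^bsub>K\<^esub> inv\<^bsub>K\<^esub> \<Phi> e x f) \<odot>\<^bsub>dsum\<^esub> lact dsum e (ract dsum m f)) g' h'"
      unfolding g' .
  qed simp_all
qed

lemma coord_bij:
  assumes [simp]: "x \<in> carrier G" "y \<in> carrier G"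
  shows "bij_betw (\<lambda>m. coord m x y) (bigraded_part dsum x y) (carrier (W x y))"
proof (rule bij_betwI')
  fix m n assume mn: "m \<in> bigraded_part dsum x y" "n \<in> bigraded_part dsum x y"
  then have m: "m \<in> sums" "n \<in> sums" by (simp_all add: bigraded_part_dsum)
  have z: "coord m g h = coord n g h" if "g \<in> carrier G" "h \<in> carrier G" "\<not> (g = x \<and> h = y)" for g h
  proof -
    have "coord m g h = \<zero>\<^bsub>W g h\<^esub>" "coord n g h = \<zero>\<^bsub>W g h\<^esub>"
      using mn that by (auto simp: bigraded_part_dsum)
    then show ?thesis by simp
  qed
  show "coord m x y = coord n x y \<longleftrightarrow> m = n"
    using coord_ext[OF m] z by metis
next
  fix m assume "m \<in> bigraded_part dsum x y"
  then show "coord m x y \<in> carrier (W x y)" by (simp add: bigraded_part_dsum)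
next
  fix v assume v: "v \<in> carrier (W x y)"
  note f = fam_single[OF v]
  show "\<exists>m\<in>bigraded_part dsum x y. v = coord m x y"
    by (rule bexI[of _ "assemble (\<lambda>g h. if g = x \<and> h = y then v else \<zero>\<^bsub>W g h\<^esub>)"])
      (auto simp: bigraded_part_dsum coord_assemble[OF f] f)
qed

end

section \<open>The functor is an equivalence\<close>

lemma Majid_hom_sandwich:
  assumes "\<phi> \<in> Majid_homs K G M N" "majid K G \<Phi> M" "majid K G \<Phi> N" "a \<in> carrier G" "b \<in> carrier G" "m \<in> carrier M"
  shows "\<phi> (ract M (lact M a m) b) = ract N (lact N a (\<phi> m)) b"
proof -
  interpret M: majid K G \<Phi> M by fact
  show ?thesis using Majid_homsD(5,6)[OF assms(1)] assms by simp
qed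

context class_reps
begin

text \<open>The scalars by which the actions differ from transport, relative to the transversal.\<close>

definition lact_scalar where
  "lact_scalar e x h = transport_scalar (class_rep x) e (transv x) (inv (transv x) \<otimes> h) (transv (e \<otimes> x \<otimes> inv e)) (transit e x)"

definition ract_scalar where
  "ract_scalar x h c = right_scalar (class_rep x) (transv x) (inv (transv x) \<otimes> h) c"

lemma lact_scalar_Units [simp]:
  "\<lbrakk>e \<in> carrier G; x \<in> carrier G; h \<in> carrier G\<rbrakk> \<Longrightarrow> lact_scalar e x h \<in> Units K"
  and ract_scalar_Units [simp]:
  "\<lbrakk>x \<in> carrier G; h \<in> carrier G; c \<in> carrier G\<rbrakk> \<Longrightarrow> ract_scalar x h c \<in> Units K"
  by (simp_all add: lact_scalar_def ract_scalar_def)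

lemma transit_shift:
  assumes [simp]: "e \<in> carrier G" "x \<in> carrier G" "h \<in> carrier G"
  shows "transit e x \<otimes> (inv (transv x) \<otimes> h) = inv (transv (e \<otimes> x \<otimes> inv e)) \<otimes> (e \<otimes> h)"
proof -
  have "transv x \<otimes> (inv (transv x) \<otimes> h) = h" by (simp flip: G.m_assoc)
  then show ?thesis by (simp add: transit_def G.m_assoc)
qed

lemma l_translate:
  assumes H: "homogeneous_action K G \<Phi> H sm l r"
    and [simp]: "e \<in> carrier G" "x \<in> carrier G" "h \<in> carrier G" and m: "m \<in> H (class_rep x) \<one>"
  shows "l e (homogeneous_action.sandwich l r m (transv x) (inv (transv x) \<otimes> h)) =
    sm (lact_scalar e x h) (homogeneous_action.sandwich l r (homogeneous_action.ad G l r (transit e x) m)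
      (transv (e \<otimes> x \<otimes> inv e)) (inv (transv (e \<otimes> x \<otimes> inv e)) \<otimes> (e \<otimes> h)))"
  using homogeneous_action.l_sandwich_ad[OF H _ _ _ _ _ _ transit_eq[OF assms(2,3)] m, of "inv (transv x) \<otimes> h"]
  by (simp add: lact_scalar_def transit_shift)

lemma r_translate:
  assumes H: "homogeneous_action K G \<Phi> H sm l r"
    and [simp]: "c \<in> carrier G" "x \<in> carrier G" "h \<in> carrier G" and m: "m \<in> H (class_rep x) \<one>"
  shows "r (homogeneous_action.sandwich l r m (transv x) (inv (transv x) \<otimes> h)) c =
    sm (ract_scalar x h c) (homogeneous_action.sandwich l r m (transv x) (inv (transv x) \<otimes> (h \<otimes> c)))"
  using homogeneous_action.r_sandwich[OF H _ _ _ _ m, of "transv x" "inv (transv x) \<otimes> h" c]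
  by (simp add: ract_scalar_def G.m_assoc)

lemma degree_quotient:
  assumes [simp]: "e \<in> carrier G" "g \<in> carrier G" "h \<in> carrier G"
  shows "e \<otimes> g \<otimes> inv (e \<otimes> h) = e \<otimes> (g \<otimes> inv h) \<otimes> inv e" and "g \<otimes> e \<otimes> inv (h \<otimes> e) = g \<otimes> inv h"
proof -
  show "e \<otimes> g \<otimes> inv (e \<otimes> h) = e \<otimes> (g \<otimes> inv h) \<otimes> inv e"
    by (simp add: G.inv_mult_group G.m_assoc)
  have "e \<otimes> (inv e \<otimes> inv h) = inv h" by (simp flip: G.m_assoc)
  then show "g \<otimes> e \<otimes> inv (h \<otimes> e) = g \<otimes> inv h" by (simp add: G.inv_mult_group G.m_assoc)
qed

context
  fixes M N :: "('k, 'v, 'g) majid_bimodule"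
  assumes M: "majid K G \<Phi> M" and N: "majid K G \<Phi> N"
begin

interpretation M: majid K G \<Phi> M by (rule M)
interpretation N: majid K G \<Phi> N by (rule N)

lemma homogeneous_translate:
  assumes gh: "g \<in> carrier G" "h \<in> carrier G" and m: "m \<in> bigraded_part M g h"
  obtains v where "v \<in> bigraded_part M (class_rep (g \<otimes> inv h)) \<one>"
    "m = M.act.sandwich v (transv (g \<otimes> inv h)) (inv (transv (g \<otimes> inv h)) \<otimes> h)"
  using sandwich_bij_degree[OF M.act.homogeneous_action_axioms gh] m that
  unfolding bij_betw_def by blast

text \<open>A morphism is determined on homogeneous elements, and these are translates of elements of fibres.\<close>

lemma fibres_arr_inj:
  assumes \<phi>: "\<phi> \<in> Majid_homs K G M N" and \<psi>: "\<psi> \<in> Majid_homs K G M N"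
    and eq: "fibres_arr M N \<phi> = fibres_arr M N \<psi>"
  shows "\<phi> = \<psi>"
proof (rule Majid_hom_eqI[OF \<phi> \<psi> M N])
  fix g h m assume gh: "g \<in> carrier G" "h \<in> carrier G" and m: "m \<in> bigraded_part M g h"
  let ?x = "g \<otimes> inv h"
  obtain v where v: "v \<in> bigraded_part M (class_rep ?x) \<one>"
    "m = M.act.sandwich v (transv ?x) (inv (transv ?x) \<otimes> h)"
    by (rule homogeneous_translate[OF gh m])
  have "conj_class ?x \<in> conjugacy_classes G" using gh by (simp add: conjugacy_classes_eq)
  then have "\<phi> v = \<psi> v"
    using fun_cong[OF fun_cong[OF eq, of "conj_class ?x"], of v] v(1) by (simp add: fibres_arr_def class_rep_def)
  then show "\<phi> m = \<psi> m"
    using Majid_hom_sandwich[OF \<phi> M N _ _ M.partD[OF v(1)], of "transv ?x" "inv (transv ?x) \<otimes> h"]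
      Majid_hom_sandwich[OF \<psi> M N _ _ M.partD[OF v(1)], of "transv ?x" "inv (transv ?x) \<otimes> h"] gh
    by (simp add: v(2) M.act.sandwich_def)
qed

text \<open>The extension sends \<open>(t.v).b\<close> to \<open>(t.(u v)).b\<close>. It commutes with the actions because \<open>u\<close> commutes with
the adjoint action of the centralizer and because the transport scalars for \<open>M\<close> and \<open>N\<close> agree.\<close>

lemma fibres_arr_surj:
  assumes u: "\<And>C. C \<in> conjugacy_classes G \<Longrightarrow>
      u C \<in> proj_rep_homs K (centralizer G (gC C)) (fibre_rep G M (gC C)) (fibre_rep G N (gC C))"
  obtains \<phi> where "\<phi> \<in> Majid_homs K G M N"
    "\<And>C v. \<lbrakk>C \<in> conjugacy_classes G; v \<in> bigraded_part M (gC C) \<one>\<rbrakk> \<Longrightarrow> \<phi> v = u C v"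
proof -
  define f where "f x = u (conj_class x)" for x
  have cx: "conj_class x \<in> conjugacy_classes G" if "x \<in> carrier G" for x using that by (simp add: conjugacy_classes_eq)
  have f_conj: "f (e \<otimes> x \<otimes> inv e) = f x" if "e \<in> carrier G" "x \<in> carrier G" for e x
    using that by (simp add: f_def conj_class_conj)
  have fl: "f x \<in> linear_maps K (fibre_rep G M (class_rep x)) (fibre_rep G N (class_rep x))"
    and fz: "\<lbrakk>z \<in> carrier G; z \<otimes> class_rep x = class_rep x \<otimes> z; v \<in> bigraded_part M (class_rep x) \<one>\<rbrakk> \<Longrightarrow>
      f x (M.act.ad z v) = N.act.ad z (f x v)" if "x \<in> carrier G" for x z v
    using u[OF cx[OF that]] unfolding proj_rep_homs_def
    by (auto simp: f_def class_rep_def fibre_rep_def centralizer_def M.act.ad_def N.act.ad_def)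
  have fc: "f x v \<in> bigraded_part N (class_rep x) \<one>" if "x \<in> carrier G" "v \<in> bigraded_part M (class_rep x) \<one>" for x v
    using linear_maps_closed[OF fl[OF that(1)], of v] that by (simp add: fibre_rep_def)
  have fadd: "f x (v \<oplus>\<^bsub>M\<^esub> w) = f x v \<oplus>\<^bsub>N\<^esub> f x w"
    if "x \<in> carrier G" "v \<in> bigraded_part M (class_rep x) \<one>" "w \<in> bigraded_part M (class_rep x) \<one>" for x v w
    using linear_maps_add[OF fl[OF that(1)], of v w] that by (simp add: fibre_rep_def)
  have fsm: "f x (k \<odot>\<^bsub>M\<^esub> v) = k \<odot>\<^bsub>N\<^esub> f x v"
    if "x \<in> carrier G" "v \<in> bigraded_part M (class_rep x) \<one>" "k \<in> carrier K" for x v k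
    using linear_maps_smult[OF fl[OF that(1)], of k v] that by (simp add: fibre_rep_def)
  define tr where "tr h x v = M.act.sandwich v (transv x) (inv (transv x) \<otimes> h)" for h x v
  define tr' where "tr' h x v = N.act.sandwich v (transv x) (inv (transv x) \<otimes> h)" for h x v
  \<comment> \<open>\<open>tr h x v\<close> is the translate of \<open>v\<close> to right degree \<open>h\<close> over \<open>x\<close>; undo it in \<open>M\<close>, apply \<open>f x\<close>, redo it
    in \<open>N\<close>.\<close>
  define \<psi> where "\<psi> g h m = tr' h (g \<otimes> inv h) (f (g \<otimes> inv h)
      (inv_into (bigraded_part M (class_rep (g \<otimes> inv h)) \<one>) (tr h (g \<otimes> inv h)) m))" for g h m
  have \<psi>: "\<psi> g h (tr h (g \<otimes> inv h) v) = tr' h (g \<otimes> inv h) (f (g \<otimes> inv h) v)"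
    if gh: "g \<in> carrier G" "h \<in> carrier G" and v: "v \<in> bigraded_part M (class_rep (g \<otimes> inv h)) \<one>" for g h v
  proof -
    have "bij_betw (tr h (g \<otimes> inv h)) (bigraded_part M (class_rep (g \<otimes> inv h)) \<one>) (bigraded_part M g h)"
      unfolding tr_def[abs_def] by (rule sandwich_bij_degree[OF M.act.homogeneous_action_axioms gh])
    then show ?thesis by (simp add: \<psi>_def inv_into_f_f[OF bij_betw_imp_inj_on v])
  qed
  have ex: "\<exists>v. v \<in> bigraded_part M (class_rep (g \<otimes> inv h)) \<one> \<and> m = tr h (g \<otimes> inv h) v"
    if "g \<in> carrier G" "h \<in> carrier G" "m \<in> bigraded_part M g h" for g h m
    using homogeneous_translate[OF that] unfolding tr_def by metis
  have tr_add: "tr h x (v \<oplus>\<^bsub>M\<^esub> w) = tr h x v \<oplus>\<^bsub>M\<^esub> tr h x w" "tr h x (k \<odot>\<^bsub>M\<^esub> v) = k \<odot>\<^bsub>M\<^esub> tr h x v"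
    if "h \<in> carrier G" "x \<in> carrier G" "v \<in> carrier M" "w \<in> carrier M" "k \<in> carrier K" for h x v w k
    unfolding tr_def using that
    by (simp_all add: linear_maps_add[OF M.sandwich_linear] linear_maps_smult[OF M.sandwich_linear])
  have tr'_add: "tr' h x (v \<oplus>\<^bsub>N\<^esub> w) = tr' h x v \<oplus>\<^bsub>N\<^esub> tr' h x w" "tr' h x (k \<odot>\<^bsub>N\<^esub> v) = k \<odot>\<^bsub>N\<^esub> tr' h x v"
    if "h \<in> carrier G" "x \<in> carrier G" "v \<in> carrier N" "w \<in> carrier N" "k \<in> carrier K" for h x v w k
    unfolding tr'_def using that
    by (simp_all add: linear_maps_add[OF N.sandwich_linear] linear_maps_smult[OF N.sandwich_linear])
  obtain \<phi> where \<phi>: "\<phi> \<in> Majid_homs K G M N"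
    and \<phi>\<psi>: "\<And>g h m. \<lbrakk>g \<in> carrier G; h \<in> carrier G; m \<in> bigraded_part M g h\<rbrakk> \<Longrightarrow> \<phi> m = \<psi> g h m"
  proof (rule Majid_hom_extend[OF M N, of \<psi>])
    fix g h m assume gh [simp]: "g \<in> carrier G" "h \<in> carrier G" and m: "m \<in> bigraded_part M g h"
    let ?x = "g \<otimes> inv h"
    have x [simp]: "?x \<in> carrier G" by simp
    obtain v where v: "v \<in> bigraded_part M (class_rep ?x) \<one>" "m = tr h ?x v" using ex[OF gh m] by auto
    note vc = M.partD[OF v(1)] and fv = fc[OF x v(1)]
    note fvc = N.partD[OF fv]
    show "\<psi> g h m \<in> bigraded_part N g h"
      using bij_betwE[OF sandwich_bij_degree[OF N.act.homogeneous_action_axioms gh]] fv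
      by (simp add: v(2) \<psi>[OF gh v(1)] tr'_def)
    show "\<psi> g h (m \<oplus>\<^bsub>M\<^esub> n) = \<psi> g h m \<oplus>\<^bsub>N\<^esub> \<psi> g h n" if n: "n \<in> bigraded_part M g h" for n
    proof -
      obtain w where w: "w \<in> bigraded_part M (class_rep ?x) \<one>" "n = tr h ?x w" using ex[OF gh n] by auto
      have "m \<oplus>\<^bsub>M\<^esub> n = tr h ?x (v \<oplus>\<^bsub>M\<^esub> w)"
        using tr_add(1)[OF gh(2) x vc M.partD[OF w(1)], of "\<one>\<^bsub>K\<^esub>"] v w by simp
      moreover have "v \<oplus>\<^bsub>M\<^esub> w \<in> bigraded_part M (class_rep ?x) \<one>" using M.part_add v(1) w(1) by simp
      ultimately show ?thesis
        using tr'_add(1)[OF gh(2) x fvc N.partD[OF fc[OF x w(1)]], of "\<one>\<^bsub>K\<^esub>"]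
        by (simp add: v(2) w(2) \<psi> v(1) w(1) fadd)
    qed
    show "\<psi> g h (k \<odot>\<^bsub>M\<^esub> m) = k \<odot>\<^bsub>N\<^esub> \<psi> g h m" if k: "k \<in> carrier K" for k
    proof -
      have "k \<odot>\<^bsub>M\<^esub> m = tr h ?x (k \<odot>\<^bsub>M\<^esub> v)" using tr_add(2)[OF gh(2) x vc vc k] v by simp
      moreover have "k \<odot>\<^bsub>M\<^esub> v \<in> bigraded_part M (class_rep ?x) \<one>" using M.part_smult v(1) k by simp
      ultimately show ?thesis
        using tr'_add(2)[OF gh(2) x fvc fvc k] k by (simp add: v(2) \<psi> v(1) fsm)
    qed
    fix e assume e [simp]: "e \<in> carrier G"
    note q = degree_quotient[OF e gh]
    show "\<psi> (e \<otimes> g) (e \<otimes> h) (lact M e m) = lact N e (\<psi> g h m)"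
    proof -
      have cv: "M.act.ad (transit e ?x) v \<in> bigraded_part M (class_rep ?x) \<one>"
        using M.act.ad_centralizer[OF _ _ transit_commute v(1)] by simp
      have cv': "lact_scalar e ?x h \<odot>\<^bsub>M\<^esub> M.act.ad (transit e ?x) v \<in> bigraded_part M (class_rep ?x) \<one>"
        using M.part_smult[OF _ _ cv] by simp
      have "lact M e m = lact_scalar e ?x h \<odot>\<^bsub>M\<^esub> tr (e \<otimes> h) (e \<otimes> ?x \<otimes> inv e) (M.act.ad (transit e ?x) v)"
        unfolding v(2) tr_def using l_translate[OF M.act.homogeneous_action_axioms e x gh(2) v(1)] .
      also have "\<dots> = tr (e \<otimes> h) (e \<otimes> g \<otimes> inv (e \<otimes> h)) (lact_scalar e ?x h \<odot>\<^bsub>M\<^esub> M.act.ad (transit e ?x) v)"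
        unfolding q using tr_add(2)[of "e \<otimes> h" "e \<otimes> ?x \<otimes> inv e", OF _ _ M.partD[OF cv] M.partD[OF cv], of "lact_scalar e ?x h"] by simp
      finally have "\<psi> (e \<otimes> g) (e \<otimes> h) (lact M e m) =
          tr' (e \<otimes> h) (e \<otimes> ?x \<otimes> inv e) (f ?x (lact_scalar e ?x h \<odot>\<^bsub>M\<^esub> M.act.ad (transit e ?x) v))"
        using \<psi>[of "e \<otimes> g" "e \<otimes> h" "lact_scalar e ?x h \<odot>\<^bsub>M\<^esub> M.act.ad (transit e ?x) v"] cv'
        unfolding q by (simp add: class_rep_conj f_conj)
      also have "f ?x (lact_scalar e ?x h \<odot>\<^bsub>M\<^esub> M.act.ad (transit e ?x) v) = lact_scalar e ?x h \<odot>\<^bsub>N\<^esub> N.act.ad (transit e ?x) (f ?x v)"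
        using fsm[OF x cv, of "lact_scalar e ?x h"] fz[OF x _ transit_commute v(1)] by simp
      also have "tr' (e \<otimes> h) (e \<otimes> ?x \<otimes> inv e) \<dots> =
          lact_scalar e ?x h \<odot>\<^bsub>N\<^esub> tr' (e \<otimes> h) (e \<otimes> ?x \<otimes> inv e) (N.act.ad (transit e ?x) (f ?x v))"
        using fc[OF x cv] fz[OF x _ transit_commute v(1)] N.partD
        by (intro tr'_add(2)) auto
      also have "\<dots> = lact N e (tr' h ?x (f ?x v))"
        unfolding tr'_def using l_translate[OF N.act.homogeneous_action_axioms e x gh(2) fv] by simp
      finally show ?thesis by (simp add: v(2) \<psi>[OF gh v(1)])
    qed
    show "\<psi> (g \<otimes> e) (h \<otimes> e) (ract M m e) = ract N (\<psi> g h m) e"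
    proof -
      have cv': "ract_scalar ?x h e \<odot>\<^bsub>M\<^esub> v \<in> bigraded_part M (class_rep ?x) \<one>"
        using M.part_smult[OF _ _ v(1)] by simp
      have "ract M m e = ract_scalar ?x h e \<odot>\<^bsub>M\<^esub> tr (h \<otimes> e) ?x v"
        unfolding v(2) tr_def using r_translate[OF M.act.homogeneous_action_axioms e x gh(2) v(1)] .
      also have "\<dots> = tr (h \<otimes> e) (g \<otimes> e \<otimes> inv (h \<otimes> e)) (ract_scalar ?x h e \<odot>\<^bsub>M\<^esub> v)"
        unfolding q using tr_add(2)[of "h \<otimes> e" ?x, OF _ _ vc vc, of "ract_scalar ?x h e"] by simp
      finally have "\<psi> (g \<otimes> e) (h \<otimes> e) (ract M m e) = tr' (h \<otimes> e) ?x (f ?x (ract_scalar ?x h e \<odot>\<^bsub>M\<^esub> v))"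
        using \<psi>[of "g \<otimes> e" "h \<otimes> e" "ract_scalar ?x h e \<odot>\<^bsub>M\<^esub> v"] cv' unfolding q by simp
      also have "f ?x (ract_scalar ?x h e \<odot>\<^bsub>M\<^esub> v) = ract_scalar ?x h e \<odot>\<^bsub>N\<^esub> f ?x v"
        using fsm[OF x v(1), of "ract_scalar ?x h e"] by simp
      also have "tr' (h \<otimes> e) ?x \<dots> = ract_scalar ?x h e \<odot>\<^bsub>N\<^esub> tr' (h \<otimes> e) ?x (f ?x v)"
        using fvc by (intro tr'_add(2)) auto
      also have "\<dots> = ract N (tr' h ?x (f ?x v)) e"
        unfolding tr'_def using r_translate[OF N.act.homogeneous_action_axioms e x gh(2) fv] by simp
      finally show ?thesis by (simp add: v(2) \<psi>[OF gh v(1)])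
    qed
  qed (rule that)
  have "\<phi> v = u C v" if C: "C \<in> conjugacy_classes G" and v: "v \<in> bigraded_part M (gC C) \<one>" for C v
  proof -
    note g [simp] = gC_closed[OF C]
    have t: "tr \<one> (gC C) v = v" "tr' \<one> (gC C) (u C v) = u C v"
      using M.act.sandwich_one[OF g v] N.act.sandwich_one[OF g fc[OF g, of v, unfolded class_rep_gC[OF C]]] v C
      by (simp_all add: tr_def tr'_def class_rep_gC f_def conj_class_gC)
    have "\<phi> v = \<psi> (gC C) \<one> (tr \<one> (gC C) v)" using \<phi>\<psi>[OF g _ v] t(1) by simp
    then show ?thesis
      using \<psi>[of "gC C" \<one> v] v C t(2) by (simp add: class_rep_gC f_def conj_class_gC)
  qed
  with \<phi> show ?thesis by (rule that)
qed

lemma fibres_fully_faithful: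
  "bij_betw (fibres_arr M N) (Majid_homs K G M N) (arr reps_category (fibres M) (fibres N))"
proof (rule bij_betwI')
  fix \<phi> \<psi> assume "\<phi> \<in> Majid_homs K G M N" "\<psi> \<in> Majid_homs K G M N"
  then show "fibres_arr M N \<phi> = fibres_arr M N \<psi> \<longleftrightarrow> \<phi> = \<psi>" using fibres_arr_inj by blast
next
  fix \<phi> assume "\<phi> \<in> Majid_homs K G M N"
  then show "fibres_arr M N \<phi> \<in> arr reps_category (fibres M) (fibres N)"
    using fibre_hom[OF _ M N gC_closed]
    by (simp add: product_category_def fibres_def fibres_arr_def proj_rep_category_def)
next
  fix u assume "u \<in> arr reps_category (fibres M) (fibres N)"
  then have u: "u C \<in> proj_rep_homs K (centralizer G (gC C)) (fibre_rep G M (gC C)) (fibre_rep G N (gC C))"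
    if "C \<in> conjugacy_classes G" for C
    using that by (auto simp: product_category_def fibres_def proj_rep_category_def PiE_iff)
  have ue: "u \<in> extensional (conjugacy_classes G)"
    using \<open>u \<in> arr _ _ _\<close> by (auto simp: product_category_def PiE_iff)
  obtain \<phi> where \<phi>: "\<phi> \<in> Majid_homs K G M N"
    "\<And>C v. \<lbrakk>C \<in> conjugacy_classes G; v \<in> bigraded_part M (gC C) \<one>\<rbrakk> \<Longrightarrow> \<phi> v = u C v"
    using fibres_arr_surj[OF u] by blast
  have "u = fibres_arr M N \<phi>"
  proof (rule extensionalityI[OF ue])
    fix C assume C: "C \<in> conjugacy_classes G"
    have "u C = restrict \<phi> (bigraded_part M (gC C) \<one>)"
    proof (rule extensionalityI)
      show "u C \<in> extensional (bigraded_part M (gC C) \<one>)"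
        using u[OF C] by (simp add: proj_rep_homs_def fibre_rep_def)
    qed (use \<phi>(2)[OF C] in simp_all)
    then show "u C = fibres_arr M N \<phi> C" using C by (simp add: fibres_arr_def)
  qed (simp add: fibres_arr_def)
  then show "\<exists>\<phi>\<in>Majid_homs K G M N. u = fibres_arr M N \<phi>" using \<phi>(1) by blast
qed

end

end

lemma linear_maps_inverse:
  assumes M: "module R M" and f: "f \<in> linear_maps R M N" and b: "bij_betw f (carrier M) (carrier N)"
  shows "restrict (inv_into (carrier M) f) (carrier N) \<in> linear_maps R N M"
proof -
  interpret M: module R M by fact
  let ?g = "inv_into (carrier M) f"
  have gc: "?g y \<in> carrier M" "f (?g y) = y" if "y \<in> carrier N" for y
    using that b by (auto simp: bij_betw_def inv_into_into f_inv_into_f)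
  have gf: "?g y = x" if "x \<in> carrier M" "f x = y" for x y
    using that b by (auto simp: bij_betw_def)
  have "?g (x \<oplus>\<^bsub>N\<^esub> y) = ?g x \<oplus>\<^bsub>M\<^esub> ?g y" "x \<oplus>\<^bsub>N\<^esub> y \<in> carrier N" if "x \<in> carrier N" "y \<in> carrier N" for x y
  proof -
    have *: "f (?g x \<oplus>\<^bsub>M\<^esub> ?g y) = x \<oplus>\<^bsub>N\<^esub> y" using linear_maps_add[OF f] gc that by simp
    show "?g (x \<oplus>\<^bsub>N\<^esub> y) = ?g x \<oplus>\<^bsub>M\<^esub> ?g y" using gf[OF _ *] gc that by simp
    show "x \<oplus>\<^bsub>N\<^esub> y \<in> carrier N" using linear_maps_closed[OF f, of "?g x \<oplus>\<^bsub>M\<^esub> ?g y"] * gc that by simp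
  qed
  moreover have "?g (k \<odot>\<^bsub>N\<^esub> y) = k \<odot>\<^bsub>M\<^esub> ?g y" "k \<odot>\<^bsub>N\<^esub> y \<in> carrier N" if "k \<in> carrier R" "y \<in> carrier N" for k y
  proof -
    have *: "f (k \<odot>\<^bsub>M\<^esub> ?g y) = k \<odot>\<^bsub>N\<^esub> y" using linear_maps_smult[OF f] gc that by simp
    show "?g (k \<odot>\<^bsub>N\<^esub> y) = k \<odot>\<^bsub>M\<^esub> ?g y" using gf[OF _ *] gc that by simp
    show "k \<odot>\<^bsub>N\<^esub> y \<in> carrier N" using linear_maps_closed[OF f, of "k \<odot>\<^bsub>M\<^esub> ?g y"] * gc that by simp
  qed
  ultimately show ?thesis using gc(1) by (simp add: linear_maps_def)
qed

lemma compose_inverse: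
  assumes "bij_betw f A B"
  shows "compose A (restrict (inv_into A f) B) f = restrict id A"
    and "compose B f (restrict (inv_into A f) B) = restrict id B"
proof -
  have "f ` A = B" "inj_on f A" using assms by (auto simp: bij_betw_def)
  then show "compose A (restrict (inv_into A f) B) f = restrict id A"
    "compose B f (restrict (inv_into A f) B) = restrict id B"
    by (auto simp: compose_def fun_eq_iff f_inv_into_f)
qed

lemma is_iso_proj_rep:
  assumes V: "projective_representation K V Z \<alpha>"
    and f: "f \<in> proj_rep_homs K Z V V'" and b: "bij_betw f (carrier V) (carrier V')"
  shows "is_iso (proj_rep_category K Z \<alpha>) V V' f"
proof -
  interpret V: projective_representation K V Z \<alpha> by fact
  let ?g = "restrict (inv_into (carrier V) f) (carrier V')"
  have fl: "f \<in> linear_maps K V V'" and fz: "\<And>z v. \<lbrakk>z \<in> carrier Z; v \<in> carrier V\<rbrakk> \<Longrightarrow> f (rho V z v) = rho V' z (f v)"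
    using f by (auto simp: proj_rep_homs_def)
  have rho_c: "rho V z v \<in> carrier V" if "z \<in> carrier Z" "v \<in> carrier V" for z v
    using V.rho_GL[OF that(1)] that(2) by (auto simp: GL_def linear_maps_def)
  have "?g (rho V' z w) = rho V z (?g w)" if z: "z \<in> carrier Z" and w: "w \<in> carrier V'" for z w
  proof -
    obtain v where v: "v \<in> carrier V" "w = f v" using w b by (auto simp: bij_betw_def)
    have "rho V' z w = f (rho V z v)" using fz z v by simp
    moreover have "f (rho V z v) \<in> carrier V'" using linear_maps_closed[OF fl rho_c[OF z v(1)]] .
    ultimately show ?thesis using v w rho_c[OF z v(1)] b by (simp add: bij_betw_def)
  qed
  then have "?g \<in> proj_rep_homs K Z V' V"
    using linear_maps_inverse[OF V.module_axioms fl b] by (simp add: proj_rep_homs_def)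
  then show ?thesis
    unfolding is_iso_def using f compose_inverse[OF b]
    by (intro conjI bexI[of _ ?g]) (simp_all add: proj_rep_category_def)
qed

context class_reps
begin

context
  fixes V :: "'g set \<Rightarrow> ('k, 'v, 'g) proj_rep"
  assumes V: "\<And>C. C \<in> conjugacy_classes G \<Longrightarrow>
    projective_representation K (V C) (centralizer G (gC C)) (\<lambda>e f. Phi_tilde K G \<Phi> e f (gC C))"
begin

text \<open>The data of the bimodule with prescribed fibres: an element \<open>v\<close> of the component in bidegree \<open>(g, h)\<close>
stands for \<open>(t.v).(t\<inverse> h)\<close> with \<open>t = transv (g h\<inverse>)\<close>, and the actions are copied from \<open>l_translate\<close> and
\<open>r_translate\<close>, with the representation in place of the adjoint action.\<close>

definition ind_W where "ind_W g h = V (conj_class (g \<otimes> inv h))"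

definition ind_L where
  "ind_L e g h v = lact_scalar e (g \<otimes> inv h) h \<odot>\<^bsub>ind_W g h\<^esub> rho (ind_W g h) (transit e (g \<otimes> inv h)) v"

definition ind_R where
  "ind_R c g h v = ract_scalar (g \<otimes> inv h) h c \<odot>\<^bsub>ind_W g h\<^esub> v"

lemma ind_rep:
  assumes "g \<in> carrier G" "h \<in> carrier G"
  shows "projective_representation K (ind_W g h) (centralizer G (class_rep (g \<otimes> inv h)))
    (\<lambda>e f. Phi_tilde K G \<Phi> e f (class_rep (g \<otimes> inv h)))"
  using V[of "conj_class (g \<otimes> inv h)"] assms by (simp add: ind_W_def class_rep_def conjugacy_classes_eq)

lemma ind_W_shift:
  "\<lbrakk>e \<in> carrier G; g \<in> carrier G; h \<in> carrier G\<rbrakk> \<Longrightarrow> ind_W (e \<otimes> g) (e \<otimes> h) = ind_W g h"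
  "\<lbrakk>e \<in> carrier G; g \<in> carrier G; h \<in> carrier G\<rbrakk> \<Longrightarrow> ind_W (g \<otimes> e) (h \<otimes> e) = ind_W g h"
  by (simp_all add: ind_W_def degree_quotient conj_class_conj)

lemma ind_rho:
  assumes gh: "g \<in> carrier G" "h \<in> carrier G" and z: "z \<in> carrier G" "z \<otimes> class_rep (g \<otimes> inv h) = class_rep (g \<otimes> inv h) \<otimes> z"
  shows "rho (ind_W g h) z \<in> linear_maps K (ind_W g h) (ind_W g h)"
  using projective_representation.rho_GL[OF ind_rep[OF gh], of z] z by (simp add: centralizer_def GL_def)

lemma lact_scalar_mult:
  assumes [simp]: "e \<in> carrier G" "f \<in> carrier G" "g \<in> carrier G" "h \<in> carrier G"
  defines "x \<equiv> g \<otimes> inv h"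
  shows "lact_scalar e (f \<otimes> x \<otimes> inv f) (f \<otimes> h) \<otimes>\<^bsub>K\<^esub> lact_scalar f x h \<otimes>\<^bsub>K\<^esub> Phi_tilde K G \<Phi> (transit e (f \<otimes> x \<otimes> inv f)) (transit f x) (class_rep x) =
    \<Phi> e f g \<otimes>\<^bsub>K\<^esub> inv\<^bsub>K\<^esub> \<Phi> e f h \<otimes>\<^bsub>K\<^esub> lact_scalar (e \<otimes> f) x h"
proof -
  let ?y = "f \<otimes> x \<otimes> inv f"
  have x [simp]: "x \<in> carrier G" by (simp add: x_def)
  have "transport_scalar (class_rep x) f (transv x) (inv (transv x) \<otimes> h) (transv ?y) (transit f x) \<otimes>\<^bsub>K\<^esub>
      transport_scalar (class_rep x) e (transv ?y) (transit f x \<otimes> (inv (transv x) \<otimes> h)) (transv (e \<otimes> ?y \<otimes> inv e)) (transit e ?y) \<otimes>\<^bsub>K\<^esub>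
      Phi_tilde K G \<Phi> (transit e ?y) (transit f x) (class_rep x) =
      \<Phi> e f (transv x \<otimes> class_rep x \<otimes> (inv (transv x) \<otimes> h)) \<otimes>\<^bsub>K\<^esub> inv\<^bsub>K\<^esub> \<Phi> e f (transv x \<otimes> (inv (transv x) \<otimes> h)) \<otimes>\<^bsub>K\<^esub>
      transport_scalar (class_rep x) (e \<otimes> f) (transv x) (inv (transv x) \<otimes> h) (transv (e \<otimes> ?y \<otimes> inv e)) (transit e ?y \<otimes> transit f x)"
    by (rule transport_scalar_mult) (use transit_eq[of f x] transit_eq[of e ?y] transit_commute[of f x] transit_commute[of e ?y] in \<open>simp_all add: class_rep_conj\<close>)
  then show ?thesis
    using transv_degree[of g h] transit_mult[of f e x] conjugate_mult[of e f x]
    by (simp add: lact_scalar_def x_def[symmetric] class_rep_conj transit_shift K.m_comm[of "transport_scalar _ f _ _ _ _"])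
qed

lemma lact_ract_scalar:
  assumes [simp]: "e \<in> carrier G" "c \<in> carrier G" "g \<in> carrier G" "h \<in> carrier G"
  defines "x \<equiv> g \<otimes> inv h"
  shows "ract_scalar (e \<otimes> x \<otimes> inv e) (e \<otimes> h) c \<otimes>\<^bsub>K\<^esub> lact_scalar e x h =
    \<Phi> e h c \<otimes>\<^bsub>K\<^esub> inv\<^bsub>K\<^esub> \<Phi> e g c \<otimes>\<^bsub>K\<^esub> (lact_scalar e x (h \<otimes> c) \<otimes>\<^bsub>K\<^esub> ract_scalar x h c)"
proof -
  let ?y = "e \<otimes> x \<otimes> inv e"
  have x [simp]: "x \<in> carrier G" by (simp add: x_def)
  have "transport_scalar (class_rep x) e (transv x) (inv (transv x) \<otimes> h) (transv ?y) (transit e x) \<otimes>\<^bsub>K\<^esub> right_scalar (class_rep x) (transv ?y) (transit e x \<otimes> (inv (transv x) \<otimes> h)) c =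
    \<Phi> e (transv x \<otimes> (inv (transv x) \<otimes> h)) c \<otimes>\<^bsub>K\<^esub> inv\<^bsub>K\<^esub> \<Phi> e (transv x \<otimes> class_rep x \<otimes> (inv (transv x) \<otimes> h)) c \<otimes>\<^bsub>K\<^esub>
    (right_scalar (class_rep x) (transv x) (inv (transv x) \<otimes> h) c \<otimes>\<^bsub>K\<^esub> transport_scalar (class_rep x) e (transv x) (inv (transv x) \<otimes> h \<otimes> c) (transv ?y) (transit e x))"
    by (rule transport_right_scalar) (use transit_eq[of e x] transit_commute[of e x] in simp_all)
  then show ?thesis
    using transv_degree[of g h] class_rep_conj[of e x]
    by (simp add: lact_scalar_def ract_scalar_def x_def[symmetric] transit_shift K.m_comm G.m_assoc)
qed

lemma ract_scalar_mult:
  assumes [simp]: "c \<in> carrier G" "d \<in> carrier G" "g \<in> carrier G" "h \<in> carrier G"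
  defines "x \<equiv> g \<otimes> inv h"
  shows "ract_scalar x (h \<otimes> c) d \<otimes>\<^bsub>K\<^esub> ract_scalar x h c =
    \<Phi> h c d \<otimes>\<^bsub>K\<^esub> inv\<^bsub>K\<^esub> \<Phi> g c d \<otimes>\<^bsub>K\<^esub> ract_scalar x h (c \<otimes> d)"
proof -
  have x [simp]: "x \<in> carrier G" by (simp add: x_def)
  show ?thesis
    using right_scalar_mult[of "class_rep x" "transv x" "inv (transv x) \<otimes> h" c d] transv_degree[of g h]
    by (simp add: ract_scalar_def x_def[symmetric] K.m_comm G.m_assoc)
qed

lemma direct_sum_data_ind:
  fixes J :: "('g \<times> 'g \<Rightarrow> 'v) \<Rightarrow> 'v"
  assumes J: "inj_on J (cut G ` fin_families G ind_W)"
  shows "direct_sum_data K G \<Phi> ind_W ind_L ind_R J"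
proof (intro direct_sum_data.intro three_cocycle_axioms direct_sum_data_axioms.intro J)
  fix g h assume gh [simp]: "g \<in> carrier G" "h \<in> carrier G"
  let ?x = "g \<otimes> inv h"
  interpret W: projective_representation K "ind_W g h" "centralizer G (class_rep ?x)"
    "\<lambda>e f. Phi_tilde K G \<Phi> e f (class_rep ?x)" by (rule ind_rep[OF gh])
  have x [simp]: "?x \<in> carrier G" by simp
  have rl: "rho (ind_W g h) (transit e ?x) \<in> linear_maps K (ind_W g h) (ind_W g h)" if "e \<in> carrier G" for e
    using that by (intro ind_rho[OF gh] transit_commute) auto
  note [simp] = linear_maps_closed[OF rl]
  show "module K (ind_W g h)" by (rule W.module_axioms)
  fix e assume e [simp]: "e \<in> carrier G"
  have rs: "rho (ind_W g h) (transit e ?x) (k \<odot>\<^bsub>ind_W g h\<^esub> v) = k \<odot>\<^bsub>ind_W g h\<^esub> rho (ind_W g h) (transit e ?x) v"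
    if "k \<in> carrier K" "v \<in> carrier (ind_W g h)" for k v
    using linear_maps_smult[OF rl] that by simp
  show "ind_L e g h \<in> linear_maps K (ind_W g h) (ind_W (e \<otimes> g) (e \<otimes> h))"
    unfolding ind_W_shift(1)[OF e gh] linear_maps_def ind_L_def
    by (auto simp: linear_maps_add[OF rl] W.smult_r_distr rs W.smult_assoc1[symmetric] K.m_comm)
  show "ind_R e g h \<in> linear_maps K (ind_W g h) (ind_W (g \<otimes> e) (h \<otimes> e))"
    unfolding ind_W_shift(2)[OF e gh] linear_maps_def ind_R_def
    by (auto simp: W.smult_r_distr W.smult_assoc1[symmetric] K.m_comm)
  fix v assume v [simp]: "v \<in> carrier (ind_W g h)"
  show "ind_L \<one> g h v = v"
    using W.rho_one[OF v] by (simp add: ind_L_def lact_scalar_def transit_one) (simp add: centralizer_def)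
  show "ind_R \<one> g h v = v" by (simp add: ind_R_def ract_scalar_def)
  fix f assume f [simp]: "f \<in> carrier G"
  note q = degree_quotient[OF e gh] degree_quotient[OF f gh] ind_W_shift[OF e gh] ind_W_shift[OF f gh]
  show "ind_L e (f \<otimes> g) (f \<otimes> h) (ind_L f g h v) =
      (\<Phi> e f g \<otimes>\<^bsub>K\<^esub> inv\<^bsub>K\<^esub> \<Phi> e f h) \<odot>\<^bsub>ind_W (e \<otimes> f \<otimes> g) (e \<otimes> f \<otimes> h)\<^esub> ind_L (e \<otimes> f) g h v"
  proof -
    let ?y = "f \<otimes> ?x \<otimes> inv f"
    have zc: "transit e ?y \<in> carrier (centralizer G (class_rep ?x))" "transit f ?x \<in> carrier (centralizer G (class_rep ?x))"
      using transit_commute[of e ?y] transit_commute[of f ?x] by (simp_all add: centralizer_def class_rep_conj)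
    have zl: "rho (ind_W g h) (transit e ?y) \<in> linear_maps K (ind_W g h) (ind_W g h)"
      using W.rho_GL[OF zc(1)] by (simp add: GL_def)
    have "ind_L e (f \<otimes> g) (f \<otimes> h) (ind_L f g h v) =
        lact_scalar e ?y (f \<otimes> h) \<odot>\<^bsub>ind_W g h\<^esub> rho (ind_W g h) (transit e ?y) (lact_scalar f ?x h \<odot>\<^bsub>ind_W g h\<^esub> rho (ind_W g h) (transit f ?x) v)"
      unfolding ind_L_def q ..
    also have "rho (ind_W g h) (transit e ?y) (lact_scalar f ?x h \<odot>\<^bsub>ind_W g h\<^esub> rho (ind_W g h) (transit f ?x) v) =
        lact_scalar f ?x h \<odot>\<^bsub>ind_W g h\<^esub> (rho (ind_W g h) (transit e ?y) (rho (ind_W g h) (transit f ?x) v))"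
      by (rule linear_maps_smult[OF zl]) simp_all
    also have "rho (ind_W g h) (transit e ?y) (rho (ind_W g h) (transit f ?x) v) =
        Phi_tilde K G \<Phi> (transit e ?y) (transit f ?x) (class_rep ?x) \<odot>\<^bsub>ind_W g h\<^esub> rho (ind_W g h) (transit (e \<otimes> f) ?x) v"
      using W.rho_mult[OF zc v] transit_mult[of f e ?x] by (simp add: centralizer_def)
    finally have "ind_L e (f \<otimes> g) (f \<otimes> h) (ind_L f g h v) =
        (lact_scalar e ?y (f \<otimes> h) \<otimes>\<^bsub>K\<^esub> lact_scalar f ?x h \<otimes>\<^bsub>K\<^esub> Phi_tilde K G \<Phi> (transit e ?y) (transit f ?x) (class_rep ?x)) \<odot>\<^bsub>ind_W g h\<^esub>
        rho (ind_W g h) (transit (e \<otimes> f) ?x) v"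
      by (simp add: W.smult_assoc1 K.m_assoc)
    also have "\<dots> = (\<Phi> e f g \<otimes>\<^bsub>K\<^esub> inv\<^bsub>K\<^esub> \<Phi> e f h) \<odot>\<^bsub>ind_W g h\<^esub> ind_L (e \<otimes> f) g h v"
      unfolding lact_scalar_mult[OF e f gh] by (simp add: ind_L_def W.smult_assoc1)
    also have "ind_W g h = ind_W (e \<otimes> f \<otimes> g) (e \<otimes> f \<otimes> h)"
      using ind_W_shift(1)[of "e \<otimes> f" g h] by simp
    finally show ?thesis .
  qed
  show "ind_R f (g \<otimes> e) (h \<otimes> e) (ind_R e g h v) =
      (\<Phi> h e f \<otimes>\<^bsub>K\<^esub> inv\<^bsub>K\<^esub> \<Phi> g e f) \<odot>\<^bsub>ind_W (g \<otimes> (e \<otimes> f)) (h \<otimes> (e \<otimes> f))\<^esub> ind_R (e \<otimes> f) g h v"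
    using ract_scalar_mult[OF e f gh] ind_W_shift(2)[of "e \<otimes> f" g h]
    by (simp add: ind_R_def q W.smult_assoc1[symmetric])
  show "ind_R f (e \<otimes> g) (e \<otimes> h) (ind_L e g h v) =
      (\<Phi> e h f \<otimes>\<^bsub>K\<^esub> inv\<^bsub>K\<^esub> \<Phi> e g f) \<odot>\<^bsub>ind_W (e \<otimes> g \<otimes> f) (e \<otimes> h \<otimes> f)\<^esub> ind_L e (g \<otimes> f) (h \<otimes> f) (ind_R f g h v)"
    using lact_ract_scalar[OF e f gh] ind_W_shift(2)[of f "e \<otimes> g" "e \<otimes> h"]
    by (simp add: ind_R_def ind_L_def q rs W.smult_assoc1[symmetric] K.m_assoc)
qed

text \<open>The isomorphism reads off the coordinate in bidegree \<open>(g(C), \<one>)\<close>. For \<open>z\<close> in the centralizer, the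
adjoint action on this coordinate is the representation up to a product of two scalars, which is \<open>\<one>\<close>
by \<open>transport_right_scalar_one\<close>.\<close>

lemma fibres_ess_surj:
  fixes J :: "('g \<times> 'g \<Rightarrow> 'v) \<Rightarrow> 'v"
  assumes J: "inj_on J (cut G ` fin_families G ind_W)" and Ve: "V \<in> extensional (conjugacy_classes G)"
  shows "\<exists>M\<in>obj (Majid_category K G \<Phi>). \<exists>f. is_iso reps_category (fibres M) V f"
proof -
  interpret D: direct_sum_data K G \<Phi> ind_W ind_L ind_R J by (rule direct_sum_data_ind[OF J])
  have Mb: "Majid_bimodule K D.dsum G \<Phi>" by (rule D.Majid_bimodule_dsum)
  then interpret M: majid K G \<Phi> D.dsum by (rule majidI)
  define \<theta> where "\<theta> = (\<lambda>C\<in>conjugacy_classes G. restrict (\<lambda>m. D.coord m (gC C) \<one>) (bigraded_part D.dsum (gC C) \<one>))"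
  have "is_iso reps_category (fibres D.dsum) V \<theta>"
  proof (rule is_iso_product)
    fix C assume C: "C \<in> conjugacy_classes G"
    note g [simp] = gC_closed[OF C]
    have W: "ind_W (gC C) \<one> = V C" using C by (simp add: ind_W_def conj_class_gC)
    interpret V: projective_representation K "V C" "centralizer G (gC C)" "\<lambda>e f. Phi_tilde K G \<Phi> e f (gC C)"
      by (rule V[OF C])
    have rep: "projective_representation K (fibre_rep G D.dsum (gC C)) (centralizer G (gC C))
        (\<lambda>e f. Phi_tilde K G \<Phi> e f (gC C))"
      by (rule M.projective_representation_fibre[OF g])
    have b: "bij_betw (\<lambda>m. D.coord m (gC C) \<one>) (bigraded_part D.dsum (gC C) \<one>) (carrier (V C))"
      using D.coord_bij[OF g, of \<one>] W by simp
    have sums: "m \<in> D.sums" if "m \<in> bigraded_part D.dsum (gC C) \<one>" for m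
      using M.partD[OF that] by simp
    have lin: "\<theta> C \<in> linear_maps K (fibre_rep G D.dsum (gC C)) (V C)"
      using C sums bij_betwE[OF b] W by (simp add: \<theta>_def linear_maps_def fibre_rep_def M.part_add M.part_smult)
    have "\<theta> C (ract D.dsum (lact D.dsum z m) (inv z)) = rho (V C) z (\<theta> C m)"
      if z: "z \<in> carrier G" "z \<otimes> gC C = gC C \<otimes> z" and m: "m \<in> bigraded_part D.dsum (gC C) \<one>" for z m
    proof -
      note [simp] = z(1) sums[OF m]
      have zc: "z \<in> carrier (centralizer G (gC C))" using z by (simp add: centralizer_def)
      have zg: "z \<otimes> gC C \<otimes> inv z = gC C" unfolding z(2) by (simp add: G.m_assoc)
      have zm: "ract D.dsum (lact D.dsum z m) (inv z) \<in> bigraded_part D.dsum (gC C) \<one>"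
        using M.act.ad_centralizer[OF g z m] by (simp add: M.act.ad_def)
      have cm: "D.coord m (gC C) \<one> \<in> carrier (V C)" using bij_betwE[OF b] m by simp
      have rm: "rho (V C) z (D.coord m (gC C) \<one>) \<in> carrier (V C)"
        using V.rho_GL[OF zc] cm by (auto simp: GL_def linear_maps_def)
      have rz: "class_rep (gC C) = gC C" "transit z (gC C) = z" using class_rep_gC[OF C] transit_centralizer[OF C z] by auto
      have "D.coord (ract D.dsum (lact D.dsum z m) (inv z)) (z \<otimes> gC C \<otimes> inv z) (z \<otimes> inv z) =
          D.shiftR (inv z) (D.coord (lact D.dsum z m)) (z \<otimes> gC C \<otimes> inv z) (z \<otimes> inv z)"
        by (rule D.coord_dsum(7)) simp_all
      also have "\<dots> = ind_R (inv z) (z \<otimes> gC C) z (D.coord (lact D.dsum z m) (z \<otimes> gC C) z)"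
        by (rule D.shiftR_at) simp_all
      also have "D.coord (lact D.dsum z m) (z \<otimes> gC C) z = ind_L z (gC C) \<one> (D.coord m (gC C) \<one>)"
        using D.shiftL_at[of z "gC C" \<one> "D.coord m"] by simp
      also have "ind_R (inv z) (z \<otimes> gC C) z (ind_L z (gC C) \<one> (D.coord m (gC C) \<one>)) = ract_scalar (gC C) z (inv z) \<odot>\<^bsub>V C\<^esub> (lact_scalar z (gC C) \<one> \<odot>\<^bsub>V C\<^esub> rho (V C) z (D.coord m (gC C) \<one>))"
        unfolding ind_R_def ind_L_def using ind_W_shift(1)[OF z(1) g, of \<one>]
        by (simp add: W rz zg)
      also have "\<dots> = (lact_scalar z (gC C) \<one> \<otimes>\<^bsub>K\<^esub> ract_scalar (gC C) z (inv z)) \<odot>\<^bsub>V C\<^esub> rho (V C) z (D.coord m (gC C) \<one>)"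
        using rm by (simp add: V.smult_assoc1[symmetric] K.m_comm)
      also have "lact_scalar z (gC C) \<one> \<otimes>\<^bsub>K\<^esub> ract_scalar (gC C) z (inv z) = \<one>\<^bsub>K\<^esub>"
        using transport_right_scalar_one[OF g z] C by (simp add: lact_scalar_def ract_scalar_def rz zg)
      finally show ?thesis using C m zm rm by (simp add: \<theta>_def zg)
    qed
    note eq = this
    have "\<theta> C \<in> proj_rep_homs K (centralizer G (gC C)) (fibre_rep G D.dsum (gC C)) (V C)"
      unfolding proj_rep_homs_def
    proof (intro CollectI conjI IntI ballI lin)
      show "\<theta> C \<in> extensional (carrier (fibre_rep G D.dsum (gC C)))"
        using C by (simp add: \<theta>_def fibre_rep_def)
      fix z v assume "z \<in> carrier (centralizer G (gC C))" "v \<in> carrier (fibre_rep G D.dsum (gC C))"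
      then show "\<theta> C (rho (fibre_rep G D.dsum (gC C)) z v) = rho (V C) z (\<theta> C v)"
        using eq[of z v] by (simp add: fibre_rep_def centralizer_def)
    qed
    moreover have "bij_betw (\<theta> C) (carrier (fibre_rep G D.dsum (gC C))) (carrier (V C))"
    proof -
      have "bij_betw (\<theta> C) (bigraded_part D.dsum (gC C) \<one>) (carrier (V C))"
        by (rule iffD1[OF bij_betw_cong b]) (use C in \<open>simp add: \<theta>_def\<close>)
      then show ?thesis by (simp add: fibre_rep_def)
    qed
    ultimately show "is_iso (proj_rep_category K (centralizer G (gC C)) (\<lambda>e f. Phi_tilde K G \<Phi> e f (gC C)))
        (fibres D.dsum C) (V C) (\<theta> C)"
      using is_iso_proj_rep[OF rep] C by (simp add: fibres_def)
  qed (simp_all add: fibres_def \<theta>_def)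
  then show ?thesis using Mb by (intro bexI[of _ D.dsum]) (auto simp: Majid_category_def)
qed

end

end

section \<open>Cardinality of the direct sum\<close>

text \<open>A finitely supported family is determined by its graph over the support, a finite subset of
\<open>(G \<times> G) \<times> 'v\<close>; for infinite \<open>'v\<close> with at least as many elements as \<open>G\<close>, there are no more of these
than elements of \<open>'v\<close>.\<close>

lemma ex_inj_fin_families:
  fixes G :: "('g, 's) monoid_scheme" and W :: "'g \<Rightarrow> 'g \<Rightarrow> ('k, 'v, 'n) module_scheme"
  assumes inf: "infinite (UNIV :: 'v set)" and small: "carrier G \<lesssim> (UNIV :: 'v set)"
  obtains J :: "('g \<times> 'g \<Rightarrow> 'v) \<Rightarrow> 'v" where "inj_on J (cut G ` fin_families G W)"
proof -
  let ?P = "carrier G \<times> carrier G" and ?U = "UNIV :: 'v set"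
  define k where "k = cut G (\<lambda>g h. \<zero>\<^bsub>W g h\<^esub>)"
  have sq: "?U \<times> ?U \<lesssim> ?U"
    using card_of_Times_same_infinite[OF inf] unfolding eqpoll_iff_card_of_ordIso[symmetric]
    by (rule eqpoll_imp_lepoll)
  have "?P \<lesssim> ?U" using times_lepoll_mono[OF small small] sq by (rule lepoll_trans)
  then have PU: "?P \<times> ?U \<lesssim> ?U"
    by (rule lepoll_trans[OF times_lepoll_mono[OF _ lepoll_refl] sq])
  have "cut G ` fin_families G W \<lesssim> {f. f ` ?P \<subseteq> ?U \<and> {x. f x \<noteq> k x} \<subseteq> ?P \<and> finite {x. f x \<noteq> k x}}"
  proof (rule subset_imp_lepoll, rule subsetI)
    fix f assume "f \<in> cut G ` fin_families G W"
    then obtain F where F: "F \<in> fin_families G W" "f = cut G F" by auto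
    have "{x. f x \<noteq> k x} = {(g, h). g \<in> carrier G \<and> h \<in> carrier G \<and> F g h \<noteq> \<zero>\<^bsub>W g h\<^esub>}"
      by (auto simp: F(2) k_def cut_def restrict_def)
    then show "f \<in> {f. f ` ?P \<subseteq> ?U \<and> {x. f x \<noteq> k x} \<subseteq> ?P \<and> finite {x. f x \<noteq> k x}}"
      using F(1) by (auto simp: fin_families_def)
  qed
  also have "\<dots> \<lesssim> Fpow (?P \<times> ?U)" by (rule lepoll_restricted_funspace)
  also have "\<dots> \<lesssim> Fpow ?U"
  proof -
    obtain j where "inj_on j (?P \<times> ?U)" "j ` (?P \<times> ?U) \<subseteq> ?U"
      using PU unfolding lepoll_def by blast
    then show ?thesis unfolding lepoll_def
      by (intro exI[of _ "image j"] conjI inj_on_image_Fpow image_Fpow_mono)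
  qed
  also have "\<dots> \<lesssim> ?U" using eqpoll_Fpow[OF inf] by (rule eqpoll_imp_lepoll)
  finally obtain J :: "('g \<times> 'g \<Rightarrow> 'v) \<Rightarrow> 'v" where "inj_on J (cut G ` fin_families G W)"
    unfolding lepoll_def by blast
  then show ?thesis by (rule that)
qed

lemma (in class_reps) Majid_equivalent_reps:
  assumes "infinite (UNIV :: 'v set)" "carrier G \<lesssim> (UNIV :: 'v set)"
  shows "equivalent_categories (Majid_category K G \<Phi> :: (('k, 'v, 'g) majid_bimodule, 'v \<Rightarrow> 'v) cat)
    (reps_category :: ('g set \<Rightarrow> ('k, 'v, 'g) proj_rep, 'g set \<Rightarrow> 'v \<Rightarrow> 'v) cat)"
proof (rule ff_ess_surj_imp_equivalent)
  show "category (Majid_category K G \<Phi> :: (('k, 'v, 'g) majid_bimodule, 'v \<Rightarrow> 'v) cat)"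
    by (rule category_Majid)
  show "category (reps_category :: ('g set \<Rightarrow> ('k, 'v, 'g) proj_rep, 'g set \<Rightarrow> 'v \<Rightarrow> 'v) cat)"
    by (rule category_product[OF category_proj_rep])
  show "ff_ess_surj (Majid_category K G \<Phi> :: (('k, 'v, 'g) majid_bimodule, 'v \<Rightarrow> 'v) cat) reps_category fibres fibres_arr"
    unfolding ff_ess_surj_def
  proof (intro conjI ballI fibres_functor)
    fix M N :: "('k, 'v, 'g) majid_bimodule"
    assume "M \<in> obj (Majid_category K G \<Phi>)" "N \<in> obj (Majid_category K G \<Phi>)"
    then show "bij_betw (fibres_arr M N) (arr (Majid_category K G \<Phi>) M N) (arr reps_category (fibres M) (fibres N))"
      using fibres_fully_faithful[OF majidI majidI] by (simp add: Majid_category_def)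
  next
    fix V :: "'g set \<Rightarrow> ('k, 'v, 'g) proj_rep"
    assume "V \<in> obj reps_category"
    then have V: "\<And>C. C \<in> conjugacy_classes G \<Longrightarrow>
        projective_representation K (V C) (centralizer G (gC C)) (\<lambda>e f. Phi_tilde K G \<Phi> e f (gC C))"
      and Ve: "V \<in> extensional (conjugacy_classes G)"
      by (auto simp: product_category_def proj_rep_category_def PiE_iff)
    obtain J :: "('g \<times> 'g \<Rightarrow> 'v) \<Rightarrow> 'v" where "inj_on J (cut G ` fin_families G (ind_W V))"
      using ex_inj_fin_families[OF assms] by blast
    then show "\<exists>M\<in>obj (Majid_category K G \<Phi>). \<exists>f. is_iso reps_category (fibres M) V f"
      using fibres_ess_surj[OF V _ Ve] by blast
  qed
qed

section \<open>Modules over the twisted group algebra\<close>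

locale two_cocycle = K: field K + Z: group Z
  for K :: "('k, 'r) ring_scheme" and Z :: "('g, 's) monoid_scheme" (structure) and \<alpha> :: "'g \<Rightarrow> 'g \<Rightarrow> 'k" +
  assumes alpha_closed [simp]: "\<lbrakk>x \<in> carrier Z; y \<in> carrier Z\<rbrakk> \<Longrightarrow> \<alpha> x y \<in> Units K"
    and alpha_one [simp]: "x \<in> carrier Z \<Longrightarrow> \<alpha> \<one> x = \<one>\<^bsub>K\<^esub>" "x \<in> carrier Z \<Longrightarrow> \<alpha> x \<one> = \<one>\<^bsub>K\<^esub>"
    and alpha_cocycle: "\<lbrakk>x \<in> carrier Z; y \<in> carrier Z; z \<in> carrier Z\<rbrakk> \<Longrightarrow>
      \<alpha> x y \<otimes>\<^bsub>K\<^esub> \<alpha> (x \<otimes> y) z = \<alpha> x (y \<otimes> z) \<otimes>\<^bsub>K\<^esub> \<alpha> y z"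

context abelian_monoid
begin

lemma finsum_swap:
  assumes "finite A" "finite B" "\<And>a b. \<lbrakk>a \<in> A; b \<in> B\<rbrakk> \<Longrightarrow> f a b \<in> carrier G"
  shows "(\<Oplus>a\<in>A. \<Oplus>b\<in>B. f a b) = (\<Oplus>b\<in>B. \<Oplus>a\<in>A. f a b)"
  using assms(1,3)
proof (induction A rule: finite_induct)
  case empty
  then show ?case by (simp add: finsum_zero)
next
  case (insert x A)
  have "(\<Oplus>b\<in>B. \<Oplus>a\<in>insert x A. f a b) = (\<Oplus>b\<in>B. f x b \<oplus> (\<Oplus>a\<in>A. f a b))"
    using insert by (intro finsum_cong') (auto simp: Pi_iff intro!: finsum_closed)
  also have "\<dots> = (\<Oplus>b\<in>B. f x b) \<oplus> (\<Oplus>b\<in>B. \<Oplus>a\<in>A. f a b)"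
    using insert by (intro finsum_addf) (auto intro!: finsum_closed)
  finally show ?case using insert by (simp add: Pi_iff finsum_closed)
qed

lemma finsum_Times:
  assumes "finite A" "finite B" "\<And>a b. \<lbrakk>a \<in> A; b \<in> B\<rbrakk> \<Longrightarrow> f (a, b) \<in> carrier G"
  shows "finsum G f (A \<times> B) = (\<Oplus>a\<in>A. \<Oplus>b\<in>B. f (a, b))"
  using assms(1,3)
proof (induction A rule: finite_induct)
  case empty
  then show ?case by simp
next
  case (insert x A)
  have 1: "insert x A \<times> B = Pair x ` B \<union> A \<times> B" by auto
  have "finsum G f (insert x A \<times> B) = finsum G f (Pair x ` B) \<oplus> finsum G f (A \<times> B)"
    unfolding 1 using insert assms(2) by (intro finsum_Un_disjoint) auto
  also have "finsum G f (Pair x ` B) = (\<Oplus>b\<in>B. f (x, b))"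
    using insert by (intro finsum_reindex) (auto simp: inj_on_def)
  finally show ?case using insert by (simp add: Pi_iff finsum_closed)
qed

lemma finsum_superset:
  assumes "finite B" "A \<subseteq> B" "\<And>i. i \<in> B - A \<Longrightarrow> f i = \<zero>" "\<And>i. i \<in> A \<Longrightarrow> f i \<in> carrier G"
  shows "finsum G f A = finsum G f B"
  using assms by (intro add.finprod_mono_neutral_cong_left) (auto, metis DiffI zero_closed)

lemma finsum_delta:
  assumes "finite A" "i \<in> A \<Longrightarrow> c \<in> carrier G"
  shows "(\<Oplus>j\<in>A. if i = j then c else \<zero>) = (if i \<in> A then c else \<zero>)"
proof (cases "i \<in> A")
  case True
  then show ?thesis using finsum_singleton[OF True assms(1), of "\<lambda>_. c"] assms(2) by simp
next
  case False
  then have "(\<Oplus>j\<in>A. if i = j then c else \<zero>) = (\<Oplus>j\<in>A. \<zero>)" by (intro finsum_cong') auto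
  then show ?thesis using False by (simp add: finsum_zero)
qed

end

context two_cocycle
begin

abbreviation "TA \<equiv> twisted_group_algebra K Z \<alpha>"

definition single where "single k x = (\<lambda>z. if z = x then k else \<zero>\<^bsub>K\<^esub>)"

definition support where "support a = {z. a z \<noteq> \<zero>\<^bsub>K\<^esub>}"

lemma TA_carrier: "a \<in> carrier TA \<longleftrightarrow> (\<forall>z\<in>carrier Z. a z \<in> carrier K) \<and> (\<forall>z. z \<notin> carrier Z \<longrightarrow> a z = \<zero>\<^bsub>K\<^esub>) \<and> finite (support a)"
  by (simp add: twisted_group_algebra_def support_def)

lemma TA_closed [simp]: "a \<in> carrier TA \<Longrightarrow> a z \<in> carrier K"
  by (cases "z \<in> carrier Z") (simp_all add: TA_carrier)

lemma TA_support: "a \<in> carrier TA \<Longrightarrow> finite (support a)" "a \<in> carrier TA \<Longrightarrow> support a \<subseteq> carrier Z"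
  by (auto simp: TA_carrier support_def)

lemma support_in: "\<lbrakk>a \<in> carrier TA; x \<in> support a\<rbrakk> \<Longrightarrow> x \<in> carrier Z"
  using TA_support(2) by auto

lemma alpha_K [simp]: "\<lbrakk>x \<in> carrier Z; y \<in> carrier Z\<rbrakk> \<Longrightarrow> \<alpha> x y \<in> carrier K"
  by (rule K.Units_closed) simp

lemma TA_ops:
  "\<zero>\<^bsub>TA\<^esub> = (\<lambda>z. \<zero>\<^bsub>K\<^esub>)" "a \<oplus>\<^bsub>TA\<^esub> b = (\<lambda>z. a z \<oplus>\<^bsub>K\<^esub> b z)" "\<one>\<^bsub>TA\<^esub> = single \<one>\<^bsub>K\<^esub> \<one>"
  unfolding twisted_group_algebra_def single_def[abs_def]
  by (simp_all only: ring.simps monoid.simps)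

lemma single_closed [simp]: "\<lbrakk>k \<in> carrier K; x \<in> carrier Z\<rbrakk> \<Longrightarrow> single k x \<in> carrier TA"
proof -
  assume "k \<in> carrier K" "x \<in> carrier Z"
  moreover have "finite (support (single k x))"
    by (rule finite_subset[of _ "{x}"]) (auto simp: support_def single_def)
  ultimately show ?thesis by (auto simp: TA_carrier single_def)
qed

lemma TA_add_closed: "\<lbrakk>a \<in> carrier TA; b \<in> carrier TA\<rbrakk> \<Longrightarrow> (\<lambda>z. a z \<oplus>\<^bsub>K\<^esub> b z) \<in> carrier TA"
proof -
  assume ab: "a \<in> carrier TA" "b \<in> carrier TA"
  have "support (\<lambda>z. a z \<oplus>\<^bsub>K\<^esub> b z) \<subseteq> support a \<union> support b" by (auto simp: support_def)
  then have "finite (support (\<lambda>z. a z \<oplus>\<^bsub>K\<^esub> b z))"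
    by (rule finite_subset) (use ab in \<open>simp add: TA_support(1)\<close>)
  then show ?thesis using ab by (simp add: TA_carrier)
qed

text \<open>The product as a sum over the whole rectangle of supports; as the index set no longer depends on \<open>z\<close>,
summations can be interchanged.\<close>

lemma TA_mult:
  assumes a: "a \<in> carrier TA" and b: "b \<in> carrier TA"
  shows "(a \<otimes>\<^bsub>TA\<^esub> b) z = finsum K (\<lambda>p. if fst p \<otimes> snd p = z then a (fst p) \<otimes>\<^bsub>K\<^esub> b (snd p) \<otimes>\<^bsub>K\<^esub> \<alpha> (fst p) (snd p) else \<zero>\<^bsub>K\<^esub>)
    (support a \<times> support b)"
proof -
  let ?S = "{(x, y). x \<in> carrier Z \<and> y \<in> carrier Z \<and> a x \<noteq> \<zero>\<^bsub>K\<^esub> \<and> b y \<noteq> \<zero>\<^bsub>K\<^esub> \<and> x \<otimes> y = z}"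
  have S: "?S = {p \<in> support a \<times> support b. fst p \<otimes> snd p = z}"
    using TA_support(2)[OF a] TA_support(2)[OF b] by (auto simp: support_def)
  have c: "a x \<otimes>\<^bsub>K\<^esub> b y \<otimes>\<^bsub>K\<^esub> \<alpha> x y \<in> carrier K" if "x \<in> support a" "y \<in> support b" for x y
    using a b support_in[OF a that(1)] support_in[OF b that(2)] by simp
  have "(a \<otimes>\<^bsub>TA\<^esub> b) z = finsum K (\<lambda>(x, y). a x \<otimes>\<^bsub>K\<^esub> b y \<otimes>\<^bsub>K\<^esub> \<alpha> x y) ?S"
    by (simp only: twisted_group_algebra_def ring.simps monoid.simps)
  also have "\<dots> = finsum K (\<lambda>p. if fst p \<otimes> snd p = z then a (fst p) \<otimes>\<^bsub>K\<^esub> b (snd p) \<otimes>\<^bsub>K\<^esub> \<alpha> (fst p) (snd p) else \<zero>\<^bsub>K\<^esub>) ?S"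
    unfolding S using c by (intro K.finsum_cong') auto
  also have "\<dots> = finsum K (\<lambda>p. if fst p \<otimes> snd p = z then a (fst p) \<otimes>\<^bsub>K\<^esub> b (snd p) \<otimes>\<^bsub>K\<^esub> \<alpha> (fst p) (snd p) else \<zero>\<^bsub>K\<^esub>)
    (support a \<times> support b)"
    unfolding S using c TA_support(1)[OF a] TA_support(1)[OF b] by (intro K.finsum_superset) auto
  finally show ?thesis .
qed

lemma TA_mult_closed:
  assumes a: "a \<in> carrier TA" and b: "b \<in> carrier TA"
  shows "a \<otimes>\<^bsub>TA\<^esub> b \<in> carrier TA"
    and "support (a \<otimes>\<^bsub>TA\<^esub> b) \<subseteq> (\<lambda>p. fst p \<otimes> snd p) ` (support a \<times> support b)"
proof -
  let ?S = "(\<lambda>p. fst p \<otimes> snd p) ` (support a \<times> support b)"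
  have SZ: "?S \<subseteq> carrier Z" "finite ?S" using TA_support(1)[OF a] TA_support(1)[OF b] by (auto simp: support_in[OF a] support_in[OF b])
  have z: "(a \<otimes>\<^bsub>TA\<^esub> b) z = \<zero>\<^bsub>K\<^esub>" if "z \<notin> ?S" for z
  proof -
    have "(a \<otimes>\<^bsub>TA\<^esub> b) z = finsum K (\<lambda>p. \<zero>\<^bsub>K\<^esub>) (support a \<times> support b)"
      unfolding TA_mult[OF a b] using that by (intro K.finsum_cong') auto
    then show ?thesis by (simp add: K.finsum_zero)
  qed
  then show "support (a \<otimes>\<^bsub>TA\<^esub> b) \<subseteq> ?S" by (auto simp: support_def)
  then have "finite (support (a \<otimes>\<^bsub>TA\<^esub> b))" using SZ(2) by (rule finite_subset)
  moreover have "(a \<otimes>\<^bsub>TA\<^esub> b) z \<in> carrier K" for z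
    unfolding TA_mult[OF a b]
    using a b by (intro K.finsum_closed) (auto simp: support_in[OF a] support_in[OF b])
  ultimately show "a \<otimes>\<^bsub>TA\<^esub> b \<in> carrier TA" using z SZ(1) by (auto simp: TA_carrier)
qed

end

text \<open>The laws that are needed to let the twisted group algebra act. They hold both for projective
representations and for the regular representation, which is used to show that the twisted group
algebra is a ring.\<close>

locale twisted_rep = two_cocycle K Z \<alpha> + V: module K V
  for K :: "('k, 'r) ring_scheme" and Z :: "('g, 's) monoid_scheme" (structure) and \<alpha> :: "'g \<Rightarrow> 'g \<Rightarrow> 'k"
    and V :: "('k, 'v, 'n) module_scheme" +
  fixes \<rho> :: "'g \<Rightarrow> 'v \<Rightarrow> 'v"
  assumes rho_linear: "z \<in> carrier Z \<Longrightarrow> \<rho> z \<in> linear_maps K V V"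
    and rho_unit: "v \<in> carrier V \<Longrightarrow> \<rho> \<one> v = v"
    and rho_mult: "\<lbrakk>x \<in> carrier Z; y \<in> carrier Z; v \<in> carrier V\<rbrakk> \<Longrightarrow>
      \<rho> x (\<rho> y v) = \<alpha> x y \<odot>\<^bsub>V\<^esub> \<rho> (x \<otimes> y) v"
begin

lemma rho_closed [simp]: "\<lbrakk>z \<in> carrier Z; v \<in> carrier V\<rbrakk> \<Longrightarrow> \<rho> z v \<in> carrier V"
  using linear_maps_closed[OF rho_linear] .

definition act where "act a v = finsum V (\<lambda>z. a z \<odot>\<^bsub>V\<^esub> \<rho> z v) (support a)"

lemma finsum_smult_rdistr:
  assumes "finite S" "v \<in> carrier V" "h \<in> S \<rightarrow> carrier K"
  shows "finsum K h S \<odot>\<^bsub>V\<^esub> v = finsum V (\<lambda>s. h s \<odot>\<^bsub>V\<^esub> v) S"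
  by (rule additive_finsum[where f = "\<lambda>k. k \<odot>\<^bsub>V\<^esub> v" and M = K])
    (use assms in \<open>simp_all add: V.smult_l_distr K.abelian_group_axioms V.M.abelian_group_axioms\<close>)

lemma act_superset:
  assumes "a \<in> carrier TA" "v \<in> carrier V" "finite S" "support a \<subseteq> S" "S \<subseteq> carrier Z"
  shows "act a v = finsum V (\<lambda>z. a z \<odot>\<^bsub>V\<^esub> \<rho> z v) S"
  unfolding act_def using assms by (intro V.M.finsum_superset) (auto simp: support_def)

lemma act_closed:
  assumes "a \<in> carrier TA" "v \<in> carrier V" shows "act a v \<in> carrier V"
  unfolding act_def using assms by (intro V.M.finsum_closed) (auto simp: support_in[OF assms(1)])

lemma act_add_right:
  assumes a: "a \<in> carrier TA" and v: "v \<in> carrier V" "w \<in> carrier V"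
  shows "act a (v \<oplus>\<^bsub>V\<^esub> w) = act a v \<oplus>\<^bsub>V\<^esub> act a w"
proof -
  have "act a (v \<oplus>\<^bsub>V\<^esub> w) = finsum V (\<lambda>z. a z \<odot>\<^bsub>V\<^esub> \<rho> z v \<oplus>\<^bsub>V\<^esub> a z \<odot>\<^bsub>V\<^esub> \<rho> z w) (support a)"
    unfolding act_def using a v
    by (intro V.M.finsum_cong') (auto simp: support_in[OF a] linear_maps_add[OF rho_linear] V.smult_r_distr)
  also have "\<dots> = act a v \<oplus>\<^bsub>V\<^esub> act a w"
    unfolding act_def using a v by (intro V.M.finsum_addf) (auto simp: support_in[OF a])
  finally show ?thesis .
qed

lemma act_add_left:
  assumes a: "a \<in> carrier TA" and b: "b \<in> carrier TA" and v: "v \<in> carrier V"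
  shows "act (a \<oplus>\<^bsub>TA\<^esub> b) v = act a v \<oplus>\<^bsub>V\<^esub> act b v"
proof -
  let ?S = "support a \<union> support b"
  have S: "finite ?S" "?S \<subseteq> carrier Z" using TA_support[OF a] TA_support[OF b] by simp_all
  have "support (a \<oplus>\<^bsub>TA\<^esub> b) \<subseteq> ?S" using a b by (auto simp: TA_ops support_def)
  then have "act (a \<oplus>\<^bsub>TA\<^esub> b) v = finsum V (\<lambda>z. (a z \<oplus>\<^bsub>K\<^esub> b z) \<odot>\<^bsub>V\<^esub> \<rho> z v) ?S"
    using act_superset[of "a \<oplus>\<^bsub>TA\<^esub> b" v ?S] TA_add_closed[OF a b] v S by (simp add: TA_ops)
  also have "\<dots> = finsum V (\<lambda>z. a z \<odot>\<^bsub>V\<^esub> \<rho> z v \<oplus>\<^bsub>V\<^esub> b z \<odot>\<^bsub>V\<^esub> \<rho> z v) ?S"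
    using a b v by (intro V.M.finsum_cong') (auto simp: support_in[OF a] support_in[OF b] V.smult_l_distr)
  also have "\<dots> = finsum V (\<lambda>z. a z \<odot>\<^bsub>V\<^esub> \<rho> z v) ?S \<oplus>\<^bsub>V\<^esub> finsum V (\<lambda>z. b z \<odot>\<^bsub>V\<^esub> \<rho> z v) ?S"
    using a b v by (intro V.M.finsum_addf) (auto simp: support_in[OF a] support_in[OF b])
  finally show ?thesis
    using act_superset[OF a v S(1) _ S(2)] act_superset[OF b v S(1) _ S(2)] by simp
qed

lemma act_single:
  assumes "k \<in> carrier K" "x \<in> carrier Z" "v \<in> carrier V"
  shows "act (single k x) v = k \<odot>\<^bsub>V\<^esub> \<rho> x v"
proof -
  have "act (single k x) v = finsum V (\<lambda>z. single k x z \<odot>\<^bsub>V\<^esub> \<rho> z v) {x}"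
    using assms by (intro act_superset single_closed) (auto simp: support_def single_def)
  then show ?thesis using assms by (simp add: single_def)
qed

text \<open>Expanding the product and summing over the products \<open>x y\<close> first leaves, on both sides, the sum over
all pairs \<open>(x, y)\<close> of the coefficients times \<open>\<alpha> x y\<close> times \<open>\<rho> (x y) v\<close>.\<close>

lemma act_mult:
  assumes a: "a \<in> carrier TA" and b: "b \<in> carrier TA" and v: "v \<in> carrier V"
  shows "act (a \<otimes>\<^bsub>TA\<^esub> b) v = act a (act b v)"
proof -
  let ?P = "support a \<times> support b"
  let ?m = "\<lambda>p. fst p \<otimes> snd p"
  let ?S = "?m ` ?P"
  let ?c = "\<lambda>p. a (fst p) \<otimes>\<^bsub>K\<^esub> b (snd p) \<otimes>\<^bsub>K\<^esub> \<alpha> (fst p) (snd p)"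
  have fin: "finite ?P" "finite ?S" using TA_support(1)[OF a] TA_support(1)[OF b] by auto
  have sa: "x \<in> support a \<Longrightarrow> x \<in> carrier Z" and sb: "y \<in> support b \<Longrightarrow> y \<in> carrier Z" for x y
    using TA_support(2)[OF a] TA_support(2)[OF b] by auto
  have SZ: "?S \<subseteq> carrier Z" using sa sb by auto
  have al: "\<alpha> x y \<in> carrier K" if "x \<in> carrier Z" "y \<in> carrier Z" for x y
    using K.Units_closed[OF alpha_closed[OF that]] .
  have c: "?c p \<in> carrier K" if "p \<in> ?P" for p using that a b sa sb al by auto
  have m: "?m p \<in> carrier Z" if "p \<in> ?P" for p using that sa sb by auto
  have "act (a \<otimes>\<^bsub>TA\<^esub> b) v = finsum V (\<lambda>z. (a \<otimes>\<^bsub>TA\<^esub> b) z \<odot>\<^bsub>V\<^esub> \<rho> z v) ?S"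
    by (rule act_superset[OF TA_mult_closed(1)[OF a b] v fin(2) TA_mult_closed(2)[OF a b] SZ])
  also have "\<dots> = finsum V (\<lambda>z. finsum V (\<lambda>p. if ?m p = z then ?c p \<odot>\<^bsub>V\<^esub> \<rho> (?m p) v else \<zero>\<^bsub>V\<^esub>) ?P) ?S"
  proof (rule V.M.finsum_cong')
    fix z assume z: "z \<in> ?S"
    then have zZ: "z \<in> carrier Z" using SZ by auto
    have "(a \<otimes>\<^bsub>TA\<^esub> b) z \<odot>\<^bsub>V\<^esub> \<rho> z v = finsum V (\<lambda>p. (if ?m p = z then ?c p else \<zero>\<^bsub>K\<^esub>) \<odot>\<^bsub>V\<^esub> \<rho> z v) ?P"
      unfolding TA_mult[OF a b] using zZ v c
      by (intro finsum_smult_rdistr fin) auto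
    also have "\<dots> = finsum V (\<lambda>p. if ?m p = z then ?c p \<odot>\<^bsub>V\<^esub> \<rho> (?m p) v else \<zero>\<^bsub>V\<^esub>) ?P"
      using zZ v c m by (intro V.M.finsum_cong') auto
    finally show "(a \<otimes>\<^bsub>TA\<^esub> b) z \<odot>\<^bsub>V\<^esub> \<rho> z v = \<dots>" .
  qed (use v c m in \<open>auto intro!: V.M.finsum_closed\<close>)
  also have "\<dots> = finsum V (\<lambda>p. finsum V (\<lambda>z. if ?m p = z then ?c p \<odot>\<^bsub>V\<^esub> \<rho> (?m p) v else \<zero>\<^bsub>V\<^esub>) ?S) ?P"
    using v c m by (intro V.M.finsum_swap fin) auto
  also have "\<dots> = finsum V (\<lambda>p. ?c p \<odot>\<^bsub>V\<^esub> \<rho> (?m p) v) ?P"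
    using v c m by (intro V.M.finsum_cong') (auto simp: V.M.finsum_delta[OF fin(2)])
  also have "\<dots> = finsum V (\<lambda>x. finsum V (\<lambda>y. ?c (x, y) \<odot>\<^bsub>V\<^esub> \<rho> (?m (x, y)) v) (support b)) (support a)"
    using v c m TA_support(1)[OF a] TA_support(1)[OF b] by (intro V.M.finsum_Times) auto
  also have "\<dots> = finsum V (\<lambda>x. a x \<odot>\<^bsub>V\<^esub> \<rho> x (act b v)) (support a)"
  proof (rule V.M.finsum_cong')
    fix x assume x: "x \<in> support a"
    have lin: "(\<lambda>w. a x \<odot>\<^bsub>V\<^esub> \<rho> x w) \<in> linear_maps K V V"
      using a sa[OF x] linear_maps_add[OF rho_linear[OF sa[OF x]]] linear_maps_smult[OF rho_linear[OF sa[OF x]]]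
      by (auto simp: linear_maps_def V.smult_r_distr V.smult_assoc1[symmetric] K.m_comm)
    have "a x \<odot>\<^bsub>V\<^esub> \<rho> x (act b v) = finsum V (\<lambda>y. a x \<odot>\<^bsub>V\<^esub> \<rho> x (b y \<odot>\<^bsub>V\<^esub> \<rho> y v)) (support b)"
      unfolding act_def using b v sb TA_support(1)[OF b]
      by (intro linear_maps_finsum[OF lin] V.M.abelian_group_axioms) auto
    also have "\<dots> = finsum V (\<lambda>y. ?c (x, y) \<odot>\<^bsub>V\<^esub> \<rho> (?m (x, y)) v) (support b)"
    proof (rule V.M.finsum_cong')
      fix y assume y: "y \<in> support b"
      note xy [simp] = sa[OF x] sb[OF y] al[OF sa[OF x] sb[OF y]]
      have "\<rho> x (b y \<odot>\<^bsub>V\<^esub> \<rho> y v) = b y \<odot>\<^bsub>V\<^esub> (\<alpha> x y \<odot>\<^bsub>V\<^esub> \<rho> (x \<otimes> y) v)"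
        using b v linear_maps_smult[OF rho_linear[OF sa[OF x]]] by (simp add: rho_mult)
      then show "a x \<odot>\<^bsub>V\<^esub> \<rho> x (b y \<odot>\<^bsub>V\<^esub> \<rho> y v) = ?c (x, y) \<odot>\<^bsub>V\<^esub> \<rho> (?m (x, y)) v"
        using a b v by (simp add: V.smult_assoc1)
    qed (use c m x v in auto)
    finally show "finsum V (\<lambda>y. ?c (x, y) \<odot>\<^bsub>V\<^esub> \<rho> (?m (x, y)) v) (support b) = a x \<odot>\<^bsub>V\<^esub> \<rho> x (act b v)" ..
  qed (use a sa act_closed[OF b v] in auto)
  finally show ?thesis unfolding act_def[of a] .
qed

end

context two_cocycle
begin

definition regular :: "('k, 'g \<Rightarrow> 'k) module" where
  "regular = \<lparr>carrier = carrier TA, mult = undefined, one = undefined, ring.zero = \<zero>\<^bsub>TA\<^esub>,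
     add = (\<lambda>a b. a \<oplus>\<^bsub>TA\<^esub> b), smult = (\<lambda>k a z. k \<otimes>\<^bsub>K\<^esub> a z)\<rparr>"

text \<open>Left multiplication by the basis vector at \<open>x\<close>.\<close>

definition translate where
  "translate x b z = (if z \<in> carrier Z then \<alpha> x (inv x \<otimes> z) \<otimes>\<^bsub>K\<^esub> b (inv x \<otimes> z) else \<zero>\<^bsub>K\<^esub>)"

lemma regular_simps:
  "carrier regular = carrier TA" "\<zero>\<^bsub>regular\<^esub> = (\<lambda>z. \<zero>\<^bsub>K\<^esub>)" "a \<oplus>\<^bsub>regular\<^esub> b = (\<lambda>z. a z \<oplus>\<^bsub>K\<^esub> b z)"
  "k \<odot>\<^bsub>regular\<^esub> a = (\<lambda>z. k \<otimes>\<^bsub>K\<^esub> a z)"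
  unfolding regular_def TA_ops by simp_all

lemma TA_smult_closed: "\<lbrakk>k \<in> carrier K; a \<in> carrier TA\<rbrakk> \<Longrightarrow> (\<lambda>z. k \<otimes>\<^bsub>K\<^esub> a z) \<in> carrier TA"
proof -
  assume ka: "k \<in> carrier K" "a \<in> carrier TA"
  have "support (\<lambda>z. k \<otimes>\<^bsub>K\<^esub> a z) \<subseteq> support a" using ka by (auto simp: support_def)
  then have "finite (support (\<lambda>z. k \<otimes>\<^bsub>K\<^esub> a z))" by (rule finite_subset) (rule TA_support(1)[OF ka(2)])
  then show ?thesis using ka by (simp add: TA_carrier)
qed

lemma translate_closed:
  assumes x: "x \<in> carrier Z" and b: "b \<in> carrier TA"
  shows "translate x b \<in> carrier TA"
proof -
  have "support (translate x b) \<subseteq> (\<lambda>y. x \<otimes> y) ` support b"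
  proof
    fix z assume z: "z \<in> support (translate x b)"
    then have zZ: "z \<in> carrier Z" by (auto simp: support_def translate_def split: if_splits)
    then have "inv x \<otimes> z \<in> support b" using z x by (auto simp: support_def translate_def)
    moreover have "z = x \<otimes> (inv x \<otimes> z)" using x zZ by (simp flip: Z.m_assoc)
    ultimately show "z \<in> (\<lambda>y. x \<otimes> y) ` support b" by (rule rev_image_eqI)
  qed
  then have "finite (support (translate x b))"
    by (rule finite_subset) (use TA_support(1)[OF b] in simp)
  then show ?thesis using x b by (auto simp: TA_carrier[of "translate x b"] translate_def)
qed

lemma abelian_group_regular: "abelian_group regular"
proof (rule abelian_groupI)
  fix a assume a: "a \<in> carrier regular"
  let ?b = "\<lambda>z. (\<ominus>\<^bsub>K\<^esub> \<one>\<^bsub>K\<^esub>) \<otimes>\<^bsub>K\<^esub> a z"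
  have "?b \<in> carrier regular" using a TA_smult_closed[of "\<ominus>\<^bsub>K\<^esub> \<one>\<^bsub>K\<^esub>" a] by (simp add: regular_simps)
  moreover have "?b \<oplus>\<^bsub>regular\<^esub> a = \<zero>\<^bsub>regular\<^esub>"
    using a by (simp add: regular_simps K.l_minus K.l_neg)
  ultimately show "\<exists>b\<in>carrier regular. b \<oplus>\<^bsub>regular\<^esub> a = \<zero>\<^bsub>regular\<^esub>" by (rule rev_bexI[of ?b])
next
  show "\<zero>\<^bsub>regular\<^esub> \<in> carrier regular" by (simp add: regular_simps TA_carrier support_def)
qed (simp_all add: regular_simps TA_add_closed K.a_ac)

lemma module_regular: "module K regular"
  by (rule moduleI)
    (simp_all add: K.is_cring abelian_group_regular regular_simps TA_smult_closed K.l_distr K.r_distr K.m_assoc)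

lemma twisted_rep_regular: "twisted_rep K Z \<alpha> regular translate"
proof (intro twisted_rep.intro two_cocycle_axioms module_regular twisted_rep_axioms.intro)
  fix x assume x: "x \<in> carrier Z"
  show "translate x \<in> linear_maps K regular regular"
    using x translate_closed[OF x]
    by (auto simp: linear_maps_def regular_simps translate_def[abs_def] fun_eq_iff K.r_distr K.m_lcomm)
next
  fix b assume "b \<in> carrier regular"
  then show "translate \<one> b = b"
    by (auto simp: translate_def fun_eq_iff regular_simps TA_carrier)
next
  fix x y b assume xy [simp]: "x \<in> carrier Z" "y \<in> carrier Z" and "b \<in> carrier regular"
  then have b [simp]: "b z \<in> carrier K" for z by (simp add: regular_simps)
  show "translate x (translate y b) = \<alpha> x y \<odot>\<^bsub>regular\<^esub> translate (x \<otimes> y) b"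
  proof (unfold regular_simps, rule ext)
    fix z
    show "translate x (translate y b) z = \<alpha> x y \<otimes>\<^bsub>K\<^esub> translate (x \<otimes> y) b z"
    proof (cases "z \<in> carrier Z")
      case True
      define w where "w = inv y \<otimes> (inv x \<otimes> z)"
      have w [simp]: "w \<in> carrier Z" and yw: "inv x \<otimes> z = y \<otimes> w"
        and xyw: "inv (x \<otimes> y) \<otimes> z = w" and yyw: "inv y \<otimes> (y \<otimes> w) = w"
        using True by (simp_all add: w_def Z.inv_mult_group Z.m_assoc) (simp_all flip: Z.m_assoc)
      have "translate x (translate y b) z = (\<alpha> x (y \<otimes> w) \<otimes>\<^bsub>K\<^esub> \<alpha> y w) \<otimes>\<^bsub>K\<^esub> b w"
        using True by (simp add: translate_def yw yyw K.m_assoc)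
      also have "\<dots> = \<alpha> x y \<otimes>\<^bsub>K\<^esub> translate (x \<otimes> y) b z"
        using True by (simp add: translate_def xyw K.m_assoc flip: alpha_cocycle)
      finally show ?thesis .
    qed (simp add: translate_def)
  qed
qed

lemma regular_act:
  assumes a: "a \<in> carrier TA" and b: "b \<in> carrier TA"
  shows "twisted_rep.act K regular translate a b = a \<otimes>\<^bsub>TA\<^esub> b"
proof
  interpret R: twisted_rep K Z \<alpha> regular translate by (rule twisted_rep_regular)
  note b' = b[folded regular_simps(1)]
  fix z
  show "R.act a b z = (a \<otimes>\<^bsub>TA\<^esub> b) z"
  proof (cases "z \<in> carrier Z")
    case False
    then show ?thesis
      using R.act_closed[OF a b'] TA_mult_closed(1)[OF a b] by (simp add: regular_simps TA_carrier)
  next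
    case True
    have ev: "(\<lambda>b. b z) (finsum regular h S) = finsum K (\<lambda>s. h s z) S"
      if "finite S" "h \<in> S \<rightarrow> carrier regular" for h S
      by (rule additive_finsum[OF _ _ abelian_group_regular K.abelian_group_axioms that])
        (simp_all add: regular_simps)
    have "R.act a b z = finsum K (\<lambda>x. (a x \<odot>\<^bsub>regular\<^esub> translate x b) z) (support a)"
      unfolding R.act_def using a b TA_support(1)[OF a] support_in[OF a]
      by (intro ev) (auto simp: regular_simps translate_closed TA_smult_closed)
    also have "\<dots> = finsum K (\<lambda>x. finsum K (\<lambda>y. if x \<otimes> y = z then a x \<otimes>\<^bsub>K\<^esub> b y \<otimes>\<^bsub>K\<^esub> \<alpha> x y else \<zero>\<^bsub>K\<^esub>) (support b)) (support a)"
    proof (rule K.finsum_cong')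
      fix x assume "x \<in> support a"
      then have x: "x \<in> carrier Z" by (rule support_in[OF a])
      let ?w = "inv x \<otimes> z"
      have xw: "x \<otimes> y = z \<longleftrightarrow> ?w = y" if "y \<in> carrier Z" for y
        using x True that by (auto simp flip: Z.m_assoc)
      have "finsum K (\<lambda>y. if x \<otimes> y = z then a x \<otimes>\<^bsub>K\<^esub> b y \<otimes>\<^bsub>K\<^esub> \<alpha> x y else \<zero>\<^bsub>K\<^esub>) (support b) =
          finsum K (\<lambda>y. if ?w = y then a x \<otimes>\<^bsub>K\<^esub> b ?w \<otimes>\<^bsub>K\<^esub> \<alpha> x ?w else \<zero>\<^bsub>K\<^esub>) (support b)"
        using a b x True support_in[OF b] by (intro K.finsum_cong') (auto simp: xw)
      also have "\<dots> = (if ?w \<in> support b then a x \<otimes>\<^bsub>K\<^esub> b ?w \<otimes>\<^bsub>K\<^esub> \<alpha> x ?w else \<zero>\<^bsub>K\<^esub>)"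
        using a b x True by (intro K.finsum_delta TA_support(1)) auto
      also have "\<dots> = (a x \<odot>\<^bsub>regular\<^esub> translate x b) z"
        using a b x True by (auto simp: regular_simps translate_def support_def K.m_ac)
      finally show "(a x \<odot>\<^bsub>regular\<^esub> translate x b) z =
        finsum K (\<lambda>y. if x \<otimes> y = z then a x \<otimes>\<^bsub>K\<^esub> b y \<otimes>\<^bsub>K\<^esub> \<alpha> x y else \<zero>\<^bsub>K\<^esub>) (support b)" ..
    qed (use a b support_in[OF a] support_in[OF b] in \<open>auto intro!: K.finsum_closed\<close>)
    also have "\<dots> = (a \<otimes>\<^bsub>TA\<^esub> b) z"
      unfolding TA_mult[OF a b] using a b support_in[OF a] support_in[OF b]
      by (subst K.finsum_Times) (auto simp: TA_support(1) cong: if_cong)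
    finally show ?thesis .
  qed
qed

text \<open>Associativity and distributivity are the module laws for the regular representation, since its action
is multiplication by \<open>regular_act\<close>.\<close>

lemma ring_TA: "ring TA"
proof -
  interpret R: twisted_rep K Z \<alpha> regular translate by (rule twisted_rep_regular)
  note rs = regular_simps(1)[symmetric]
  have one: "\<one>\<^bsub>TA\<^esub> \<in> carrier TA" by (simp add: TA_ops)
  have add: "a \<oplus>\<^bsub>regular\<^esub> b = a \<oplus>\<^bsub>TA\<^esub> b" for a b by (simp only: regular_simps TA_ops)
  show ?thesis
  proof (rule ringI)
    show "abelian_group TA"
    proof (rule abelian_groupI)
      fix a assume "a \<in> carrier TA"
      then show "\<exists>b\<in>carrier TA. b \<oplus>\<^bsub>TA\<^esub> a = \<zero>\<^bsub>TA\<^esub>"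
        using R.V.M.l_neg[of a] R.V.M.a_inv_closed[of a]
        by (intro bexI[of _ "\<ominus>\<^bsub>regular\<^esub> a"]) (simp_all add: TA_ops regular_simps)
    qed (use R.V.M.zero_closed in \<open>simp_all add: TA_ops regular_simps TA_add_closed K.a_ac\<close>)
    show "Group.monoid TA"
    proof
      fix a b c assume abc: "a \<in> carrier TA" "b \<in> carrier TA" "c \<in> carrier TA"
      show "a \<otimes>\<^bsub>TA\<^esub> b \<in> carrier TA" by (rule TA_mult_closed(1)[OF abc(1,2)])
      show "a \<otimes>\<^bsub>TA\<^esub> b \<otimes>\<^bsub>TA\<^esub> c = a \<otimes>\<^bsub>TA\<^esub> (b \<otimes>\<^bsub>TA\<^esub> c)"
        using R.act_mult[OF abc(1,2), of c] abc by (simp add: regular_act TA_mult_closed(1) regular_simps(1))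
    next
      fix a assume a: "a \<in> carrier TA"
      have ar: "a \<in> carrier regular" using a by (simp only: regular_simps(1))
      have "\<one>\<^bsub>TA\<^esub> \<otimes>\<^bsub>TA\<^esub> a = R.act \<one>\<^bsub>TA\<^esub> a" by (rule regular_act[OF one a, symmetric])
      also have "\<dots> = \<one>\<^bsub>K\<^esub> \<odot>\<^bsub>regular\<^esub> translate \<one> a"
        unfolding TA_ops(3) by (rule R.act_single[OF K.one_closed Z.one_closed ar])
      also have "\<dots> = a" unfolding R.rho_unit[OF ar] by (rule R.V.smult_one[OF ar])
      finally show "\<one>\<^bsub>TA\<^esub> \<otimes>\<^bsub>TA\<^esub> a = a" .
      show "a \<otimes>\<^bsub>TA\<^esub> \<one>\<^bsub>TA\<^esub> = a"
      proof
        fix z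
        have s1: "support \<one>\<^bsub>TA\<^esub> = {\<one>}" by (auto simp: support_def TA_ops single_def)
        have "(a \<otimes>\<^bsub>TA\<^esub> \<one>\<^bsub>TA\<^esub>) z = finsum K (\<lambda>x. if z = x then a z else \<zero>\<^bsub>K\<^esub>) (support a)"
          unfolding TA_mult[OF a one] s1 using a one support_in[OF a]
          by (subst K.finsum_Times) (auto simp: TA_support(1) TA_ops(3) single_def intro!: K.finsum_cong')
        also have "\<dots> = (if z \<in> support a then a z else \<zero>\<^bsub>K\<^esub>)"
          using a by (intro K.finsum_delta TA_support(1)) auto
        finally show "(a \<otimes>\<^bsub>TA\<^esub> \<one>\<^bsub>TA\<^esub>) z = a z" by (auto simp: support_def)
      qed
    qed (rule one)
    fix a b c assume abc: "a \<in> carrier TA" "b \<in> carrier TA" "c \<in> carrier TA"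
    note ab_add = TA_add_closed[OF abc(1,2), folded TA_ops(2)]
    show "(a \<oplus>\<^bsub>TA\<^esub> b) \<otimes>\<^bsub>TA\<^esub> c = a \<otimes>\<^bsub>TA\<^esub> c \<oplus>\<^bsub>TA\<^esub> b \<otimes>\<^bsub>TA\<^esub> c"
      using R.act_add_left[OF abc(1,2), of c] abc ab_add
      by (simp only: regular_act regular_simps(1) add)
    show "c \<otimes>\<^bsub>TA\<^esub> (a \<oplus>\<^bsub>TA\<^esub> b) = c \<otimes>\<^bsub>TA\<^esub> a \<oplus>\<^bsub>TA\<^esub> c \<otimes>\<^bsub>TA\<^esub> b"
      using R.act_add_right[OF abc(3), of a b] abc ab_add
      by (simp only: regular_act regular_simps(1) add)
  qed
qed

end

section \<open>Projective representations as modules\<close>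

definition algebra_module :: "('k, 'r) ring_scheme \<Rightarrow> ('k, 'v, 'g) proj_rep \<Rightarrow> ('g \<Rightarrow> 'k, 'v) module" where
  "algebra_module K V = \<lparr>carrier = carrier V, mult = monoid.mult V, one = monoid.one V, ring.zero = ring.zero V,
     add = ring.add V, smult = (\<lambda>a v. finsum V (\<lambda>z. a z \<odot>\<^bsub>V\<^esub> rho V z v) {z. a z \<noteq> \<zero>\<^bsub>K\<^esub>})\<rparr>"

lemma algebra_module_simps [simp]:
  "carrier (algebra_module K V) = carrier V" "\<zero>\<^bsub>algebra_module K V\<^esub> = \<zero>\<^bsub>V\<^esub>"
  "v \<oplus>\<^bsub>algebra_module K V\<^esub> w = v \<oplus>\<^bsub>V\<^esub> w"
  by (simp_all add: algebra_module_def)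

context two_cocycle
begin

lemma projective_twisted_rep:
  assumes "projective_representation K V Z \<alpha>"
  shows "twisted_rep K Z \<alpha> V (rho V)"
proof -
  interpret projective_representation K V Z \<alpha> by fact
  show ?thesis
    using rho_GL rho_one rho_mult
    by (intro twisted_rep.intro two_cocycle_axioms module_axioms twisted_rep_axioms.intro) (simp_all add: GL_def)
qed

lemma algebra_module_smult:
  assumes "projective_representation K V Z \<alpha>"
  shows "a \<odot>\<^bsub>algebra_module K V\<^esub> v = twisted_rep.act K V (rho V) a v"
  unfolding twisted_rep.act_def[OF projective_twisted_rep[OF assms]] support_def by (simp add: algebra_module_def)

lemma left_module_algebra_module:
  assumes V: "projective_representation K V Z \<alpha>"
  shows "left_module TA (algebra_module K V)"
proof -
  interpret V: twisted_rep K Z \<alpha> V "rho V" by (rule projective_twisted_rep[OF V])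
  have ab: "abelian_group (algebra_module K V)"
  proof (rule abelian_groupI)
    fix x assume "x \<in> carrier (algebra_module K V)"
    then show "\<exists>y\<in>carrier (algebra_module K V). y \<oplus>\<^bsub>algebra_module K V\<^esub> x = \<zero>\<^bsub>algebra_module K V\<^esub>"
      by (intro bexI[of _ "\<ominus>\<^bsub>V\<^esub> x"]) (simp_all add: V.V.M.l_neg)
  qed (simp_all add: V.V.M.a_ac)
  have "\<one>\<^bsub>TA\<^esub> \<odot>\<^bsub>algebra_module K V\<^esub> v = v" if "v \<in> carrier V" for v
    using V.act_single[of "\<one>\<^bsub>K\<^esub>" "\<one>" v] that
    by (simp add: algebra_module_smult[OF V] TA_ops(3) V.rho_unit)
  then show ?thesis
    by (intro left_module.intro ring_TA ab left_module_axioms.intro)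
      (simp_all add: algebra_module_smult[OF V] V.act_closed V.act_add_left V.act_add_right V.act_mult)
qed

text \<open>Scalars and group elements act through multiples of basis vectors, and conversely every element of the
algebra is a finite sum of such multiples.\<close>

lemma algebra_module_homs:
  assumes V: "projective_representation K V Z \<alpha>" and W: "projective_representation K W Z \<alpha>"
  shows "linear_maps TA (algebra_module K V) (algebra_module K W) \<inter> extensional (carrier V) = proj_rep_homs K Z V W"
proof (intro equalityI subsetI)
  interpret V: twisted_rep K Z \<alpha> V "rho V" by (rule projective_twisted_rep[OF V])
  interpret W: twisted_rep K Z \<alpha> W "rho W" by (rule projective_twisted_rep[OF W])
  {
    fix f assume "f \<in> linear_maps TA (algebra_module K V) (algebra_module K W) \<inter> extensional (carrier V)"
    then have f: "f \<in> linear_maps TA (algebra_module K V) (algebra_module K W)" and fe: "f \<in> extensional (carrier V)"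
      by auto
    have fc: "f v \<in> carrier W" if "v \<in> carrier V" for v using linear_maps_closed[OF f, of v] that by simp
    have fa: "f (V.act a v) = W.act a (f v)" if "a \<in> carrier TA" "v \<in> carrier V" for a v
      using linear_maps_smult[OF f, of a v] that by (simp add: algebra_module_smult[OF V] algebra_module_smult[OF W])
    have "f (k \<odot>\<^bsub>V\<^esub> v) = k \<odot>\<^bsub>W\<^esub> f v" if "k \<in> carrier K" "v \<in> carrier V" for k v
      using fa[of "single k \<one>" v] that fc by (simp add: V.act_single W.act_single V.rho_unit W.rho_unit)
    moreover have "f (rho V z v) = rho W z (f v)" if "z \<in> carrier Z" "v \<in> carrier V" for z v
      using fa[of "single \<one>\<^bsub>K\<^esub> z" v] that fc by (simp add: V.act_single W.act_single)
    ultimately show "f \<in> proj_rep_homs K Z V W"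
      using fc fe linear_maps_add[OF f] by (simp add: proj_rep_homs_def linear_maps_def)
  }
  fix f assume f: "f \<in> proj_rep_homs K Z V W"
  have fl: "f \<in> linear_maps K V W" and fz: "\<And>z v. \<lbrakk>z \<in> carrier Z; v \<in> carrier V\<rbrakk> \<Longrightarrow> f (rho V z v) = rho W z (f v)"
    using f by (auto simp: proj_rep_homs_def)
  note fc = linear_maps_closed[OF fl]
  have "f (V.act a v) = W.act a (f v)" if a: "a \<in> carrier TA" and v: "v \<in> carrier V" for a v
  proof -
    have "f (V.act a v) = finsum W (\<lambda>z. f (a z \<odot>\<^bsub>V\<^esub> rho V z v)) (support a)"
      unfolding V.act_def using a v support_in[OF a]
      by (intro linear_maps_finsum[OF fl] V.V.M.abelian_group_axioms W.V.M.abelian_group_axioms TA_support(1)) auto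
    also have "\<dots> = W.act a (f v)"
      unfolding W.act_def using a v support_in[OF a] fc
      by (intro W.V.M.finsum_cong') (auto simp: linear_maps_smult[OF fl] fz)
    finally show ?thesis .
  qed
  then show "f \<in> linear_maps TA (algebra_module K V) (algebra_module K W) \<inter> extensional (carrier V)"
    using f fc linear_maps_add[OF fl]
    by (simp add: linear_maps_def proj_rep_homs_def algebra_module_smult[OF V] algebra_module_smult[OF W])
qed

lemma single_mult:
  assumes "k \<in> carrier K" "l \<in> carrier K" "x \<in> carrier Z" "y \<in> carrier Z"
  shows "single k x \<otimes>\<^bsub>TA\<^esub> single l y = single (k \<otimes>\<^bsub>K\<^esub> l \<otimes>\<^bsub>K\<^esub> \<alpha> x y) (x \<otimes> y)"
proof -
  interpret R: twisted_rep K Z \<alpha> regular translate by (rule twisted_rep_regular)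
  have "single k x \<otimes>\<^bsub>TA\<^esub> single l y = R.act (single k x) (single l y)"
    by (rule regular_act[symmetric]) (use assms in simp_all)
  also have "\<dots> = k \<odot>\<^bsub>regular\<^esub> translate x (single l y)"
    using assms by (intro R.act_single) (simp_all add: regular_simps)
  also have "\<dots> = single (k \<otimes>\<^bsub>K\<^esub> l \<otimes>\<^bsub>K\<^esub> \<alpha> x y) (x \<otimes> y)"
  proof
    fix z
    have "inv x \<otimes> z = y \<longleftrightarrow> z = x \<otimes> y" if "z \<in> carrier Z"
      using assms that by (auto simp flip: Z.m_assoc)
    then show "(k \<odot>\<^bsub>regular\<^esub> translate x (single l y)) z = single (k \<otimes>\<^bsub>K\<^esub> l \<otimes>\<^bsub>K\<^esub> \<alpha> x y) (x \<otimes> y) z"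
      using assms by (auto simp: regular_simps translate_def single_def K.m_ac)
  qed
  finally show ?thesis .
qed

definition module_rep :: "('g \<Rightarrow> 'k, 'v) module \<Rightarrow> ('k, 'v, 'g) proj_rep" where
  "module_rep N = \<lparr>carrier = carrier N, mult = monoid.mult N, one = monoid.one N, ring.zero = ring.zero N,
     add = ring.add N, smult = (\<lambda>k v. single k \<one> \<odot>\<^bsub>N\<^esub> v), rho = (\<lambda>z v. single \<one>\<^bsub>K\<^esub> z \<odot>\<^bsub>N\<^esub> v)\<rparr>"

text \<open>Products of multiples of basis vectors are given by \<open>single_mult\<close>, so the laws of a projective
representation are instances of associativity of the module. The two actions of the algebra agree
because every element is the sum of its multiples of basis vectors.\<close>

lemma projective_representation_module_rep:
  assumes N: "left_module TA N"
  shows "projective_representation K (module_rep N) Z \<alpha>"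
    and "\<lbrakk>a \<in> carrier TA; v \<in> carrier N\<rbrakk> \<Longrightarrow> a \<odot>\<^bsub>algebra_module K (module_rep N)\<^esub> v = a \<odot>\<^bsub>N\<^esub> v"
proof -
  interpret N: left_module TA N by (rule N)
  let ?V = "module_rep N"
  have c [simp]: "carrier ?V = carrier N" "v \<oplus>\<^bsub>?V\<^esub> w = v \<oplus>\<^bsub>N\<^esub> w" "\<zero>\<^bsub>?V\<^esub> = \<zero>\<^bsub>N\<^esub>"
    "k \<odot>\<^bsub>?V\<^esub> v = single k \<one> \<odot>\<^bsub>N\<^esub> v" "rho ?V z v = single \<one>\<^bsub>K\<^esub> z \<odot>\<^bsub>N\<^esub> v" for v w k z
    by (simp_all add: module_rep_def)
  have ss: "single k x \<odot>\<^bsub>N\<^esub> (single l y \<odot>\<^bsub>N\<^esub> v) = single (k \<otimes>\<^bsub>K\<^esub> l \<otimes>\<^bsub>K\<^esub> \<alpha> x y) (x \<otimes> y) \<odot>\<^bsub>N\<^esub> v"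
    if "k \<in> carrier K" "l \<in> carrier K" "x \<in> carrier Z" "y \<in> carrier Z" "v \<in> carrier N" for k l x y v
    using N.smult_assoc[of "single k x" "single l y" v] that by (simp add: single_mult)
  have ab: "abelian_group ?V"
  proof (rule abelian_groupI)
    fix x assume "x \<in> carrier ?V"
    then show "\<exists>y\<in>carrier ?V. y \<oplus>\<^bsub>?V\<^esub> x = \<zero>\<^bsub>?V\<^esub>"
      by (intro bexI[of _ "\<ominus>\<^bsub>N\<^esub> x"]) (simp_all add: N.M.l_neg)
  qed (simp_all add: N.M.a_ac)
  have add: "single (k \<oplus>\<^bsub>K\<^esub> l) x = single k x \<oplus>\<^bsub>TA\<^esub> single l x" if "k \<in> carrier K" "l \<in> carrier K" for k l x
    using that by (auto simp: TA_ops single_def)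
  have mod: "module K ?V"
    by (rule moduleI)
      (simp_all add: K.is_cring ab N.smult_closed add N.smult_l_distr N.smult_r_distr ss N.smult_one[unfolded TA_ops(3)])
  have lin: "rho ?V z \<in> linear_maps K ?V ?V" if "z \<in> carrier Z" for z
    using that by (auto simp: linear_maps_def N.smult_closed N.smult_r_distr ss)
  have bij: "bij_betw (rho ?V z) (carrier ?V) (carrier ?V)" if z: "z \<in> carrier Z" for z
  proof (rule bij_betw_byWitness)
    let ?k = "\<lambda>x y. inv\<^bsub>K\<^esub> \<alpha> x y"
    have u: "?k x y \<otimes>\<^bsub>K\<^esub> \<alpha> x y = \<one>\<^bsub>K\<^esub>" "?k x y \<in> carrier K" if "x \<in> carrier Z" "y \<in> carrier Z" for x y
      using that by simp_all
    define g where "g v = single (?k (inv z) z) (inv z) \<odot>\<^bsub>N\<^esub> v" for v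
    define g' where "g' v = single (?k z (inv z)) (inv z) \<odot>\<^bsub>N\<^esub> v" for v
    have l: "g (rho ?V z v) = v" if "v \<in> carrier N" for v
      using z that u[of "inv z" z] by (simp add: g_def ss N.smult_one[unfolded TA_ops(3)])
    have r: "rho ?V z (g' v) = v" if "v \<in> carrier N" for v
      using z that u[of z "inv z"] by (simp add: g'_def ss N.smult_one[unfolded TA_ops(3)])
    have g'c: "g' v \<in> carrier N" if "v \<in> carrier N" for v
      using z that u by (simp add: g'_def N.smult_closed)
    \<comment> \<open>The scalars in \<open>g\<close> and \<open>g'\<close> are inverse to \<open>\<alpha> z\<inverse> z\<close> and \<open>\<alpha> z z\<inverse>\<close>; that they agree follows from
      \<open>g\<close> and \<open>g'\<close> being a left and a right inverse.\<close>
    have gg: "g v = g' v" if "v \<in> carrier N" for v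
      using l[OF g'c[OF that]] r[OF that] by simp
    show "\<forall>a\<in>carrier ?V. g' (rho ?V z a) = a"
      using l gg z by (simp add: N.smult_closed)
    show "\<forall>a\<in>carrier ?V. rho ?V z (g' a) = a" using r by simp
    show "rho ?V z ` carrier ?V \<subseteq> carrier ?V" using z by (auto simp: N.smult_closed)
    show "g' ` carrier ?V \<subseteq> carrier ?V" using g'c by auto
  qed
  show V: "projective_representation K ?V Z \<alpha>"
    using lin bij
    by (intro projective_representation.intro mod projective_representation_axioms.intro)
      (simp_all add: GL_def ss N.smult_one[unfolded TA_ops(3)])
  show "a \<odot>\<^bsub>algebra_module K ?V\<^esub> v = a \<odot>\<^bsub>N\<^esub> v" if a: "a \<in> carrier TA" and v: "v \<in> carrier N"
  proof -
    interpret V: twisted_rep K Z \<alpha> ?V "rho ?V" by (rule projective_twisted_rep[OF V])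
    have "a \<odot>\<^bsub>N\<^esub> v = finsum TA (\<lambda>z. single (a z) z) (support a) \<odot>\<^bsub>N\<^esub> v"
    proof -
      have "finsum TA (\<lambda>z. single (a z) z) (support a) = a"
      proof
        fix w
        have "finsum TA (\<lambda>z. single (a z) z) (support a) w = finsum K (\<lambda>z. single (a z) z w) (support a)"
          by (rule additive_finsum[where f = "\<lambda>b. b w"])
            (use a support_in[OF a] in \<open>auto simp: TA_ops(2) TA_support(1) K.abelian_group_axioms N.R.abelian_group_axioms\<close>)
        also have "\<dots> = finsum K (\<lambda>z. if w = z then a w else \<zero>\<^bsub>K\<^esub>) (support a)"
          using a by (intro K.finsum_cong') (auto simp: single_def)
        also have "\<dots> = a w"
          using a by (subst K.finsum_delta[OF TA_support(1)[OF a]]) (auto simp: support_def)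
        finally show "finsum TA (\<lambda>z. single (a z) z) (support a) w = a w" .
      qed
      then show ?thesis by simp
    qed
    also have "\<dots> = finsum N (\<lambda>z. single (a z) z \<odot>\<^bsub>N\<^esub> v) (support a)"
      by (rule additive_finsum[where f = "\<lambda>b. b \<odot>\<^bsub>N\<^esub> v"])
        (use a v support_in[OF a] in \<open>auto simp: TA_support(1) N.smult_closed N.smult_l_distr
          N.R.abelian_group_axioms N.M.abelian_group_axioms\<close>)
    also have "\<dots> = finsum N (\<lambda>z. a z \<odot>\<^bsub>?V\<^esub> rho ?V z v) (support a)"
      using a v support_in[OF a] by (intro N.M.finsum_cong') (auto simp: ss N.smult_closed)
    also have "\<dots> = finsum ?V (\<lambda>z. a z \<odot>\<^bsub>?V\<^esub> rho ?V z v) (support a)"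
      by (simp only: finsum_def) (simp add: module_rep_def finprod_def)
    finally show ?thesis by (simp only: algebra_module_smult[OF V] V.act_def)
  qed
qed

lemma ff_ess_surj_algebra_module:
  "ff_ess_surj (proj_rep_category K Z \<alpha> :: (('k, 'v, 'g) proj_rep, 'v \<Rightarrow> 'v) cat)
    (left_module_category TA) (algebra_module K) (\<lambda>V W f. f)"
  unfolding ff_ess_surj_def
proof (intro conjI ballI)
  show "is_functor (proj_rep_category K Z \<alpha> :: (('k, 'v, 'g) proj_rep, 'v \<Rightarrow> 'v) cat)
      (left_module_category TA) (algebra_module K) (\<lambda>V W f. f)"
  proof -
    have "f \<in> linear_maps TA (algebra_module K V) (algebra_module K W) \<and> f \<in> extensional (carrier V)"
      if "projective_representation K V Z \<alpha>" "projective_representation K W Z \<alpha>" "f \<in> proj_rep_homs K Z V W"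
      for V W :: "('k, 'v, 'g) proj_rep" and f
      using algebra_module_homs[OF that(1,2)] that(3) by blast
    moreover have "left_module TA (algebra_module K V)" if "projective_representation K V Z \<alpha>"
      for V :: "('k, 'v, 'g) proj_rep"
      using that by (rule left_module_algebra_module)
    ultimately show ?thesis
      unfolding is_functor_def proj_rep_category_def left_module_category_def by simp
  qed
next
  fix V W :: "('k, 'v, 'g) proj_rep"
  assume "V \<in> obj (proj_rep_category K Z \<alpha>)" "W \<in> obj (proj_rep_category K Z \<alpha>)"
  then show "bij_betw (\<lambda>f. f) (arr (proj_rep_category K Z \<alpha>) V W)
      (arr (left_module_category TA) (algebra_module K V) (algebra_module K W))"
    using algebra_module_homs[of V W] bij_betw_id[unfolded id_def]
    by (simp add: proj_rep_category_def left_module_category_def)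
next
  fix N :: "('g \<Rightarrow> 'k, 'v) module" assume "N \<in> obj (left_module_category TA)"
  then have N: "left_module TA N" by (simp add: left_module_category_def)
  interpret N: left_module TA N by (rule N)
  note V = projective_representation_module_rep[OF N]
  have c: "carrier (module_rep N) = carrier N" "v \<oplus>\<^bsub>module_rep N\<^esub> w = v \<oplus>\<^bsub>N\<^esub> w" for v w
    by (simp_all add: module_rep_def)
  have "is_iso (left_module_category TA) (algebra_module K (module_rep N)) N (restrict id (carrier N))"
    unfolding is_iso_def left_module_category_def
    by (intro conjI bexI[of _ "restrict id (carrier N)"])
      (auto simp: linear_maps_def c V(2) N.smult_closed compose_def fun_eq_iff)
  then show "\<exists>V\<in>obj (proj_rep_category K Z \<alpha>). \<exists>f. is_iso (left_module_category TA) (algebra_module K V) N f"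
    using V(1) by (intro bexI[of _ "module_rep N"]) (auto simp: proj_rep_category_def)
qed

end

lemma (in class_reps) two_cocycle_centralizer:
  assumes C: "C \<in> conjugacy_classes G"
  shows "two_cocycle K (centralizer G (gC C)) (\<lambda>e f. Phi_tilde K G \<Phi> e f (gC C))"
proof (intro two_cocycle.intro K.field_axioms G.group_centralizer(1) two_cocycle_axioms.intro)
  note g [simp] = gC_closed[OF C]
  show "gC C \<in> carrier G" by simp
qed (use Phi_tilde_cocycle[OF gC_closed[OF C]] gC_closed[OF C] in \<open>simp_all add: centralizer_def\<close>)

section \<open>The equivalences\<close>

theorem theorem3p3:
  fixes K :: "('k, 'r) ring_scheme" and G :: "('g, 's) monoid_scheme"
    and \<Phi> :: "'g \<Rightarrow> 'g \<Rightarrow> 'g \<Rightarrow> 'k" and gC :: "'g set \<Rightarrow> 'g"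
    and Z :: "'g set \<Rightarrow> ('g, 's) monoid_scheme" and \<Phi>C :: "'g set \<Rightarrow> 'g \<Rightarrow> 'g \<Rightarrow> 'k"
  assumes "field K" and "group G" and "normalized_3_cocycle K G \<Phi>"
    and "\<And>C. C \<in> conjugacy_classes G \<Longrightarrow> gC C \<in> C"
    and "\<And>C. Z C = centralizer G (gC C)"
    and "\<And>C e f. \<Phi>C C e f = Phi_tilde K G \<Phi> e f (gC C)"
    and universe: "infinite (UNIV :: 'v set)" "carrier G \<lesssim> (UNIV :: 'v set)"
  shows "equivalent_categories
           (Majid_category K G \<Phi> :: (('k, 'v, 'g) majid_bimodule, 'v \<Rightarrow> 'v) cat)
           (product_category (conjugacy_classes G) (\<lambda>C. proj_rep_category K (Z C) (\<Phi>C C)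
              :: (('k, 'v, 'g) proj_rep, 'v \<Rightarrow> 'v) cat)) \<and>
         equivalent_categories
           (product_category (conjugacy_classes G) (\<lambda>C. proj_rep_category K (Z C) (\<Phi>C C)
              :: (('k, 'v, 'g) proj_rep, 'v \<Rightarrow> 'v) cat))
           (product_category (conjugacy_classes G)
              (\<lambda>C. left_module_category (twisted_group_algebra K (Z C) (\<Phi>C C))
              :: (('g \<Rightarrow> 'k, 'v) module, 'v \<Rightarrow> 'v) cat))"
proof -
  interpret class_reps K G \<Phi> gC
    using assms(1-4) by (intro class_reps.intro three_cocycle.intro three_cocycle_axioms.intro class_reps_axioms.intro)
  have Z: "Z C = centralizer G (gC C)" and \<Phi>C: "\<Phi>C C = (\<lambda>e f. Phi_tilde K G \<Phi> e f (gC C))" for C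
    using assms(5,6) by (auto simp: fun_eq_iff)
  have "ff_ess_surj (reps_category :: ('g set \<Rightarrow> ('k, 'v, 'g) proj_rep, 'g set \<Rightarrow> 'v \<Rightarrow> 'v) cat)
      (product_category (conjugacy_classes G) (\<lambda>C. left_module_category
        (twisted_group_algebra K (centralizer G (gC C)) (\<lambda>e f. Phi_tilde K G \<Phi> e f (gC C)))))
      (\<lambda>V. \<lambda>C\<in>conjugacy_classes G. algebra_module K (V C)) (\<lambda>V W f. \<lambda>C\<in>conjugacy_classes G. f C)"
    by (rule ff_ess_surj_product[OF two_cocycle.ff_ess_surj_algebra_module[OF two_cocycle_centralizer]])
  then have "equivalent_categories (reps_category :: ('g set \<Rightarrow> ('k, 'v, 'g) proj_rep, 'g set \<Rightarrow> 'v \<Rightarrow> 'v) cat)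
      (product_category (conjugacy_classes G) (\<lambda>C. left_module_category
        (twisted_group_algebra K (centralizer G (gC C)) (\<lambda>e f. Phi_tilde K G \<Phi> e f (gC C)))
        :: (('g \<Rightarrow> 'k, 'v) module, 'v \<Rightarrow> 'v) cat))"
    by (intro ff_ess_surj_imp_equivalent[rotated 2] category_product category_proj_rep category_left_module)
  with Majid_equivalent_reps[OF universe] show ?thesis
    unfolding Z \<Phi>C by (rule conjI)
qed

end
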